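(* For any integers $n,p\ge 1$, $$U(n)^p \sim \bigoplus_{0\le i<p} U\left(\left\lceil \frac{n-i}{p}\right\rceil\right);$$ that is, the following two eigenvalue distributions are the same: $$\operatorname{eig}(U^p)\sim \bigcup_{0\le i<p} \operatorname{eig}(U_i),$$ where $U$ is a uniform random element of $U(n)$ and, for $0\le i<p$, $U_i$ is a uniform random element of $U(\lceil \frac{n-i}{p}\rceil)$, the $U_i$ being independent.
   Context: $U(m)$ is the group of $m\times m$ complex unitary matrices; "uniform random" means distributed according to normalized Haar measure. $U(0)$ is the trivial group (with no eigenvalues). $\operatorname{eig}(A)$ is the multiset of eigenvalues of $A$ (with multiplicity), $\bigcup$ denotes the union of multisets (multiplicities add), and $\sim$ denotes equality in distribution of random multisets. *)

theory Defs
  imports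
    "HOL-Probability.Probability"
    "Jordan_Normal_Form.Schur_Decomposition"
begin

definition unitary_group :: "nat \<Rightarrow> complex mat set" where
  "unitary_group m =
     {A \<in> carrier_mat m m. mat_adjoint A * A = 1\<^sub>m m \<and> A * mat_adjoint A = 1\<^sub>m m}"

(* The Borel sigma-algebra of U(m), seen as a subspace of the space of m x m complex matrices:
   the trace of the m^2-fold product of the Borel sigma-algebra of the complex plane, which is
   the Borel sigma-algebra of the product because the plane is second countable.
   Only the space and the sets of this measure are used. *)
definition unitary_borel :: "nat \<Rightarrow> complex mat measure" where
  "unitary_borel m =
     vimage_algebra (unitary_group m)
       (\<lambda>A. restrict (\<lambda>ij. A $$ ij) ({..<m} \<times> {..<m}))
       (PiM ({..<m} \<times> {..<m}) (\<lambda>_. borel))"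

definition haar_unitary :: "nat \<Rightarrow> complex mat measure \<Rightarrow> bool" where
  "haar_unitary m \<mu> \<longleftrightarrow>
     prob_space \<mu> \<and> sets \<mu> = sets (unitary_borel m) \<and>
     (\<forall>g \<in> unitary_group m. distr \<mu> (unitary_borel m) (\<lambda>A. g * A) = \<mu>)"

definition uniform_unitary :: "'a measure \<Rightarrow> nat \<Rightarrow> ('a \<Rightarrow> complex mat) \<Rightarrow> bool" where
  "uniform_unitary M m U \<longleftrightarrow>
     prob_space M \<and> U \<in> M \<rightarrow>\<^sub>M unitary_borel m \<and> haar_unitary m (distr M (unitary_borel m) U)"

(* Eigenvalues are counted with algebraic multiplicity; for unitary (hence diagonalizable)
   matrices this is also the geometric multiplicity. *)
definition eig :: "complex mat \<Rightarrow> complex multiset" where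
  "eig A = proots (char_poly A)"

(* The usual sigma-algebra for random finite multisets (point processes), generated by the
   maps that count the points lying in a Borel set. *)
definition multiset_borel :: "complex multiset measure" where
  "multiset_borel =
     sigma UNIV {{X. size {#z \<in># X. z \<in> B#} = k} | B k. B \<in> sets (borel :: complex measure)}"

(* Measurability is part of the definition because distr is only meaningful for
   measurable maps. *)
definition eq_in_distr ::
  "'c measure \<Rightarrow> 'a measure \<Rightarrow> ('a \<Rightarrow> 'c) \<Rightarrow> 'b measure \<Rightarrow> ('b \<Rightarrow> 'c) \<Rightarrow> bool" where
  "eq_in_distr N M X M' Y \<longleftrightarrow>
     X \<in> M \<rightarrow>\<^sub>M N \<and> Y \<in> M' \<rightarrow>\<^sub>M N \<and> distr M N X = distr M' N Y"

(* The ceiling is nonnegative for i < p, so nat does not truncate there. *)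
definition block_dim :: "nat \<Rightarrow> nat \<Rightarrow> nat \<Rightarrow> nat" where
  "block_dim n p i = nat \<lceil>(real n - real i) / real p\<rceil>"

end

theory Submission
  imports Defs
begin

text \<open>For a Laurent polynomial \<open>g\<close> with coefficients \<open>c\<close>, the Heine--Szego identity expresses the Haar mean of
  the product of \<open>g\<close> over the eigenvalues as the Toeplitz determinant of \<open>c\<close>. Replacing \<open>g x\<close> by \<open>g (x ^ p)\<close>
  spreads the coefficients out to multiples of \<open>p\<close>, so that the Toeplitz matrix splits, along residue
  classes of indices modulo \<open>p\<close>, into blocks that are the Toeplitz matrices of \<open>c\<close> of the sizes in the
  theorem. As the law of a random multiset on the circle is determined by the means of such products,
  the two laws agree.

  The identity is proved without the Weyl integration formula. Invariance under left multiplication by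
  \<open>exp (\<i> t v v\<^sup>*)\<close> gives Schwinger--Dyson equations for the traces of powers. These say that Dunkl operators
  applied to symmetrised monomials in the eigenvalues have mean zero. The Weyl density satisfies the same
  linear equations by integration by parts, and together with the total mass they determine all moments.\<close>

text \<open>Eigenvalues come in no canonical measurable order, so only symmetric functions of them
  can be integrated, and these are reached through traces of powers, which are polynomials in the
  matrix entries and their conjugates. Written in traces, the Schwinger--Dyson equations show no
  quantity that decreases. Written in monomials they do: a Dunkl operator moves two exponents
  towards each other, which lowers the sum of their squares. Multiplying by a power sum means
  raising one exponent in all possible positions, and undoing such raises carries the equations from
  traces over to all monomials. Haar measure enters through left invariance and total mass, and two
  families of moments are compared rather than two densities. The ceiling in the theorem counts the
  indices below \<open>n\<close> in one residue class modulo \<open>p\<close>. Since the law of a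
  multiset is defined by counts of points, the final comparison replaces Laurent polynomials by
  continuous functions, and these by exponentials of indicators of closed sets, whose products over
  the points generate the joint law of finitely many counts.\<close>

abbreviation transposition :: "nat \<Rightarrow> nat \<Rightarrow> nat \<Rightarrow> nat" where
  "transposition \<equiv> Transposition.transpose"

subsection \<open>Recursions on exponent vectors\<close>

text \<open>Sums over all ways of raising the entries of an exponent vector \<open>k\<close> by the members of
  \<open>ms\<close>: on monomials this is multiplication by the corresponding product of power sums.\<close>
fun raise_sum :: "nat \<Rightarrow> ((nat \<Rightarrow> int) \<Rightarrow> 'w \<Rightarrow> complex) \<Rightarrow> (nat \<Rightarrow> int) \<Rightarrow> int list \<Rightarrow> 'w \<Rightarrow> complex" where
  "raise_sum n \<rho> k [] w = \<rho> k w"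
| "raise_sum n \<rho> k (m # ms) w = (\<Sum>i<n. raise_sum n \<rho> (k(i := k i + m)) ms w)"

text \<open>Position \<open>0\<close> is excluded because a Dunkl operator in the first variable is
  symmetric in the other variables only. The sum over raised positions is invariant under
  relabelling, so the symmetry passes from \<open>\<rho>\<close> to
  \<open>raise_sum\<close>.\<close>

lemma raise_sum_swap:
  assumes sym: "\<And>k i j. i \<in> {1..<n} \<Longrightarrow> j \<in> {1..<n} \<Longrightarrow> \<rho> (k \<circ> transposition i j) = \<rho> k"
    and ij: "i \<in> {1..<n}" "j \<in> {1..<n}"
  shows "raise_sum n \<rho> (k \<circ> transposition i j) ms w = raise_sum n \<rho> k ms w"
proof (induction ms arbitrary: k)
  case Nil
  show ?case by (simp only: raise_sum.simps sym[OF ij])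
next
  case (Cons m ms)
  have perm: "transposition i j permutes {..<n}"
    using ij by (intro permutes_swap_id) auto
  have *: "(k \<circ> transposition i j)(l := (k \<circ> transposition i j) l + m)
      = (k(transposition i j l := k (transposition i j l) + m)) \<circ> transposition i j" for l
    by (auto simp: fun_eq_iff Transposition.transpose_def)
  have "raise_sum n \<rho> (k \<circ> transposition i j) (m # ms) w
     = (\<Sum>l<n. raise_sum n \<rho> (k(transposition i j l := k (transposition i j l) + m)) ms w)"
    by (simp only: raise_sum.simps * Cons.IH)
  also have "\<dots> = (\<Sum>l<n. raise_sum n \<rho> (k(l := k l + m)) ms w)"
    using sum.permute[OF perm, of "\<lambda>l. raise_sum n \<rho> (k(l := k l + m)) ms w"]
    by (simp add: o_def)
  finally show ?case by (simp only: raise_sum.simps)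
qed

lemma raise_sum_cong:
  assumes agree: "\<And>k k'. (\<And>i. i < n \<Longrightarrow> k i = k' i) \<Longrightarrow> \<rho> k = \<rho> k'"
    and "\<And>i. i < n \<Longrightarrow> k i = k' i"
  shows "raise_sum n \<rho> k ms w = raise_sum n \<rho> k' ms w"
  using assms(2)
proof (induction ms arbitrary: k k')
  case Nil
  then show ?case by (simp add: agree[of k k'])
next
  case (Cons m ms)
  show ?case
    unfolding raise_sum.simps
    by (intro sum.cong refl Cons.IH) (simp add: Cons.prems fun_upd_def)
qed

text \<open>By induction on the number of nonzero exponents besides the first. If \<open>k\<close> has the exponent \<open>m\<close> at
  its last nonzero position, then deleting it and raising by \<open>m\<close> gives a positive multiple of \<open>\<rho> k\<close> (by
  symmetry all positions beyond the remaining ones contribute alike) plus terms with fewer nonzero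
  exponents.\<close>
lemma raise_sum_descent:
  fixes \<rho> :: "(nat \<Rightarrow> int) \<Rightarrow> 'w \<Rightarrow> complex" and P :: "('w \<Rightarrow> complex) \<Rightarrow> bool"
  assumes n: "n \<ge> 1"
    and agree: "\<And>k k'. (\<And>i. i < n \<Longrightarrow> k i = k' i) \<Longrightarrow> \<rho> k = \<rho> k'"
    and sym: "\<And>k i j. i \<in> {1..<n} \<Longrightarrow> j \<in> {1..<n} \<Longrightarrow> \<rho> (k \<circ> transposition i j) = \<rho> k"
    and P0: "P (\<lambda>_. 0)"
    and Padd: "\<And>f g. P f \<Longrightarrow> P g \<Longrightarrow> P (\<lambda>w. f w + g w)"
    and Pscale: "\<And>c f. P f \<Longrightarrow> P (\<lambda>w. c * f w)"
    and base: "\<And>a ms. P (raise_sum n \<rho> ((\<lambda>_. 0)(0 := a)) ms)"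
  shows "P (\<rho> k)"
proof -
  have Psum: "P (\<lambda>w. \<Sum>i\<in>A. f i w)" if "finite A" "\<And>i. i \<in> A \<Longrightarrow> P (f i)"
    for A and f :: "nat \<Rightarrow> 'w \<Rightarrow> complex"
    using that
  proof (induction A rule: finite_induct)
    case empty
    then show ?case using P0 by simp
  next
    case (insert i A)
    then show ?case using Padd[of "f i" "\<lambda>w. \<Sum>i\<in>A. f i w"] by simp
  qed
  \<comment> \<open>The list \<open>ms\<close> has to be arbitrary: deleting the exponent
    \<open>m\<close> puts \<open>m\<close> in front of it, and the base case is available for every
    list.\<close>
  have main: "P (raise_sum n \<rho> k ms)" if "r < n" "\<And>i. r < i \<Longrightarrow> i < n \<Longrightarrow> k i = 0" for r k ms
    using that
  proof (induction r arbitrary: k ms)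
    case 0
    have "raise_sum n \<rho> k ms w = raise_sum n \<rho> ((\<lambda>_. 0)(0 := k 0)) ms w" for w
      by (rule raise_sum_cong[OF agree]) (use 0 in auto)
    then have "raise_sum n \<rho> k ms = raise_sum n \<rho> ((\<lambda>_. 0)(0 := k 0)) ms" by (rule ext)
    then show ?case using base by simp
  next
    case (Suc r)
    define m where "m = k (Suc r)"
    define k' where "k' = k(Suc r := 0)"
    have k': "\<And>i. r < i \<Longrightarrow> i < n \<Longrightarrow> k' i = 0" using Suc.prems by (auto simp: k'_def)
    have P1: "P (raise_sum n \<rho> k' (m # ms))"
      by (rule Suc.IH) (use k' Suc.prems in simp_all)
    have P2: "P (\<lambda>w. \<Sum>i\<le>r. raise_sum n \<rho> (k'(i := k' i + m)) ms w)"
      by (rule Psum[OF finite_atMost Suc.IH]) (use Suc.prems k' in simp_all)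
    have same: "raise_sum n \<rho> (k'(i := k' i + m)) ms w = raise_sum n \<rho> k ms w"
      if "i \<in> {Suc r..<n}" for i w
    proof -
      have "raise_sum n \<rho> (k'(i := k' i + m)) ms w
          = raise_sum n \<rho> (k'(i := k' i + m) \<circ> transposition i (Suc r)) ms w"
        by (rule raise_sum_swap[OF sym, symmetric]) (use that Suc.prems in auto)
      also have "k'(i := k' i + m) \<circ> transposition i (Suc r) = k"
        using that k' Suc.prems(2)[of i]
        by (cases "i = Suc r") (auto simp: fun_eq_iff Transposition.transpose_def k'_def m_def)
      finally show ?thesis .
    qed
    have "raise_sum n \<rho> k' (m # ms) w
        = (\<Sum>i\<le>r. raise_sum n \<rho> (k'(i := k' i + m)) ms w) + of_nat (n - Suc r) * raise_sum n \<rho> k ms w" for w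
    proof -
      have "raise_sum n \<rho> k' (m # ms) w = (\<Sum>i\<in>{..r} \<union> {Suc r..<n}. raise_sum n \<rho> (k'(i := k' i + m)) ms w)"
        unfolding raise_sum.simps by (rule sum.cong) (use Suc.prems(1) in auto)
      also have "\<dots> = (\<Sum>i\<le>r. raise_sum n \<rho> (k'(i := k' i + m)) ms w)
         + (\<Sum>i\<in>{Suc r..<n}. raise_sum n \<rho> (k'(i := k' i + m)) ms w)"
        by (rule sum.union_disjoint) auto
      also have "(\<Sum>i\<in>{Suc r..<n}. raise_sum n \<rho> (k'(i := k' i + m)) ms w) = (\<Sum>i\<in>{Suc r..<n}. raise_sum n \<rho> k ms w)"
        by (rule sum.cong[OF refl same])
      finally show ?thesis by (simp only: sum_constant card_atLeastLessThan)
    qed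
    moreover have "(of_nat (n - Suc r) :: complex) \<noteq> 0" using Suc.prems(1) by (simp only: of_nat_eq_0_iff)
    ultimately have eq: "raise_sum n \<rho> k ms = (\<lambda>w. (1 / of_nat (n - Suc r)) *
        (raise_sum n \<rho> k' (m # ms) w + (-1) * (\<Sum>i\<le>r. raise_sum n \<rho> (k'(i := k' i + m)) ms w)))"
      by (intro ext) (simp del: raise_sum.simps of_nat_diff)
    show ?case
      unfolding eq by (rule Pscale[OF Padd[OF P1 Pscale[OF P2]]])
  qed
  have "P (raise_sum n \<rho> k [])" using n by (intro main[of "n - 1"]) auto
  moreover have "raise_sum n \<rho> k [] = \<rho> k" by (rule ext) simp
  ultimately show ?thesis by simp
qed

text \<open>These exponent vectors occur when the divided difference in the variables
  \<open>0\<close> and \<open>j\<close> is written out; moving the full difference of the two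
  exponents interchanges them.\<close>

definition move :: "(nat \<Rightarrow> int) \<Rightarrow> nat \<Rightarrow> nat \<Rightarrow> nat \<Rightarrow> int" where
  "move k j l = k(0 := k 0 - int l, j := k j + int l)"

text \<open>By induction on the sum of squares. Up to symmetry and conjugation the first exponent is the largest in
  absolute value and positive; then the interior terms of the recursion have smaller sum of squares, while
  each of its end terms is \<open>D k\<close> itself, so that \<open>D k\<close> is multiplied by a positive number.\<close>
lemma monomial_recursion_unique:
  fixes D :: "(nat \<Rightarrow> int) \<Rightarrow> complex" and B :: int
  assumes agree: "\<And>k k'. (\<And>i. i < n \<Longrightarrow> k i = k' i) \<Longrightarrow> D k = D k'"
    and sym: "\<And>k i j. i < n \<Longrightarrow> j < n \<Longrightarrow> D (k \<circ> transposition i j) = D k"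
    and conj: "\<And>k. D (\<lambda>i. - k i) = cnj (D k)"
    and zero: "D (\<lambda>_. 0) = 0"
    and rec: "\<And>k. (\<And>i. i < n \<Longrightarrow> \<bar>k i\<bar> \<le> B) \<Longrightarrow> (\<And>j. j \<in> {1..<n} \<Longrightarrow> k j \<le> k 0) \<Longrightarrow>
       of_int (k 0) * D k + (\<Sum>j\<in>{1..<n}. (\<Sum>l<nat (k 0 - k j). D (move k j l) + D (move k j (Suc l))) / 2) = 0"
  shows "(\<And>i. i < n \<Longrightarrow> \<bar>k i\<bar> \<le> B) \<Longrightarrow> D k = 0"
proof (induction "nat (\<Sum>i<n. (k i)\<^sup>2)" arbitrary: k rule: less_induct)
  case less
  show ?case
  proof (cases "\<forall>i<n. k i = 0")
    case True
    then show ?thesis using agree[of k "\<lambda>_. 0"] zero by simp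
  next
    case False
    have "Max ((\<lambda>i. \<bar>k i\<bar>) ` {..<n}) \<in> (\<lambda>i. \<bar>k i\<bar>) ` {..<n}"
      using False by (intro Max_in) auto
    then obtain i0 where i0: "i0 < n" "\<bar>k i0\<bar> = Max ((\<lambda>i. \<bar>k i\<bar>) ` {..<n})" by auto
    have i0_max: "\<bar>k i\<bar> \<le> \<bar>k i0\<bar>" if "i < n" for i
      unfolding i0(2) using that by (intro Max_ge) auto
    define k1 where "k1 = (if k i0 > 0 then k else (\<lambda>i. - k i)) \<circ> transposition 0 i0"
    have n: "0 < n" using i0 by auto
    have Dk1: "D k1 = 0 \<Longrightarrow> D k = 0"
      unfolding k1_def using sym[of 0 i0] i0 n conj[of k] by (auto split: if_splits)
    have sq1: "(\<Sum>i<n. (k1 i)\<^sup>2) = (\<Sum>i<n. (k i)\<^sup>2)"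
    proof -
      have "(\<Sum>i<n. (k1 i)\<^sup>2) = (\<Sum>i<n. (k (transposition 0 i0 i))\<^sup>2)"
        by (auto simp: k1_def)
      also have "\<dots> = (\<Sum>i<n. (k i)\<^sup>2)"
        using sum.permute[of "transposition 0 i0" "{..<n}" "\<lambda>i. (k i)\<^sup>2"] i0 n
        by (simp add: permutes_swap_id o_def)
      finally show ?thesis .
    qed
    have tr: "transposition 0 i0 i < n" if "i < n" for i
      using that i0(1) n by (simp add: Transposition.transpose_def)
    have bd: "\<bar>k1 i\<bar> \<le> B" if "i < n" for i
      using less.prems[OF tr[OF that]] by (auto simp: k1_def)
    have pos: "k1 0 > 0"
    proof -
      obtain i where "i < n" "k i \<noteq> 0" using False by auto
      then have "k i0 \<noteq> 0" using i0_max[of i] by auto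
      then show ?thesis by (auto simp: k1_def)
    qed
    have mx: "\<bar>k1 i\<bar> \<le> k1 0" if "i < n" for i
      using i0_max[OF tr[OF that]] pos by (auto simp: k1_def split: if_splits)
    have small: "D (move k1 j l) = 0" if j: "j \<in> {1..<n}" and l: "0 < l" "l < nat (k1 0 - k1 j)" for j l
    proof (rule less.hyps)
      have "(\<Sum>i<n. (move k1 j l i)\<^sup>2) = (move k1 j l 0)\<^sup>2 + (move k1 j l j)\<^sup>2 + (\<Sum>i\<in>{..<n}-{0,j}. (k1 i)\<^sup>2)"
      proof -
        have "(\<Sum>i<n. (move k1 j l i)\<^sup>2) = (\<Sum>i\<in>{0,j}. (move k1 j l i)\<^sup>2) + (\<Sum>i\<in>{..<n}-{0,j}. (move k1 j l i)\<^sup>2)"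
          by (subst sum.union_disjoint[symmetric]) (use j n in \<open>auto intro!: sum.cong\<close>)
        moreover have "(\<Sum>i\<in>{..<n}-{0,j}. (move k1 j l i)\<^sup>2) = (\<Sum>i\<in>{..<n}-{0,j}. (k1 i)\<^sup>2)"
          by (intro sum.cong) (auto simp: move_def)
        ultimately show ?thesis using j by simp
      qed
      moreover have "(\<Sum>i<n. (k1 i)\<^sup>2) = (k1 0)\<^sup>2 + (k1 j)\<^sup>2 + (\<Sum>i\<in>{..<n}-{0,j}. (k1 i)\<^sup>2)"
      proof -
        have "(\<Sum>i<n. (k1 i)\<^sup>2) = (\<Sum>i\<in>{0,j}. (k1 i)\<^sup>2) + (\<Sum>i\<in>{..<n}-{0,j}. (k1 i)\<^sup>2)"
          by (subst sum.union_disjoint[symmetric]) (use j n in \<open>auto intro!: sum.cong\<close>)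
        then show ?thesis using j by simp
      qed
      moreover have "(move k1 j l 0)\<^sup>2 + (move k1 j l j)\<^sup>2 < (k1 0)\<^sup>2 + (k1 j)\<^sup>2"
      proof -
        have "(k1 0 - int l)\<^sup>2 + (k1 j + int l)\<^sup>2 = (k1 0)\<^sup>2 + (k1 j)\<^sup>2 - 2 * int l * (k1 0 - k1 j - int l)"
          by (simp add: power2_eq_square algebra_simps)
        moreover have "int l * (k1 0 - k1 j - int l) > 0" using l by (intro mult_pos_pos) auto
        ultimately show ?thesis using j by (simp add: move_def)
      qed
      ultimately have "(\<Sum>i<n. (move k1 j l i)\<^sup>2) < (\<Sum>i<n. (k i)\<^sup>2)" unfolding sq1[symmetric] by linarith
      moreover have "0 \<le> (\<Sum>i<n. (move k1 j l i)\<^sup>2)" by (intro sum_nonneg) auto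
      ultimately show "nat (\<Sum>i<n. (move k1 j l i)\<^sup>2) < nat (\<Sum>i<n. (k i)\<^sup>2)" by linarith
    next
      fix i assume i: "i < n"
      \<comment> \<open>Both changed exponents lie strictly between \<open>k1 j\<close> and
        \<open>k1 0\<close>, so the bound survives. It keeps the induction among exponents that a
        fixed grid resolves.\<close>
      show "\<bar>move k1 j l i\<bar> \<le> B"
        using bd[OF i] bd[OF n] bd[of j] j l mx[of j] by (auto simp: move_def)
    qed
    have inner: "(\<Sum>l<nat (k1 0 - k1 j). D (move k1 j l) + D (move k1 j (Suc l))) / 2 = (if k1 j < k1 0 then D k1 else 0)"
      if j: "j \<in> {1..<n}" for j
    proof (cases "k1 j < k1 0")
      case True
      define d where "d = nat (k1 0 - k1 j)"
      have d: "d > 0" using True by (simp add: d_def)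
      have e0: "D (move k1 j 0) = D k1" by (intro agree) (simp add: move_def)
      have e1: "D (move k1 j d) = D k1"
      proof -
        have "move k1 j d = k1 \<circ> transposition 0 j"
          using True j by (auto simp: move_def d_def fun_eq_iff Transposition.transpose_def)
        then show ?thesis using sym[of 0 j k1] j n by simp
      qed
      have "(\<Sum>l<d. D (move k1 j l)) = (\<Sum>l<d. if l = 0 then D k1 else 0)"
        by (intro sum.cong) (use small[OF j] e0 in \<open>auto simp: d_def\<close>)
      also have "\<dots> = D k1" using d by simp
      finally have 1: "(\<Sum>l<d. D (move k1 j l)) = D k1" .
      have "(\<Sum>l<d. D (move k1 j (Suc l))) = (\<Sum>l<d. if l = d - 1 then D k1 else 0)"
        using small[OF j] e1 d by (intro sum.cong) (auto simp: d_def[symmetric])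
      also have "\<dots> = D k1" using d by simp
      finally have 2: "(\<Sum>l<d. D (move k1 j (Suc l))) = D k1" .
      show ?thesis using 1 2 True by (simp add: sum.distrib d_def)
    qed auto
    have "of_int (k1 0) * D k1 + (\<Sum>j\<in>{1..<n}. if k1 j < k1 0 then D k1 else 0) = 0"
      using rec[of k1] bd mx inner by (simp add: abs_le_iff)
    moreover have "(\<Sum>j\<in>{1..<n}. if k1 j < k1 0 then D k1 else 0) = of_nat (card {j\<in>{1..<n}. k1 j < k1 0}) * D k1"
      by (simp add: sum.If_cases Int_def conj_commute)
    ultimately have "(of_int (k1 0) + of_nat (card {j\<in>{1..<n}. k1 j < k1 0})) * D k1 = 0"
      by (simp add: algebra_simps)
    moreover have "(of_int (k1 0) + of_nat (card {j\<in>{1..<n}. k1 j < k1 0}) :: complex) \<noteq> 0"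
    proof -
      have "k1 0 + int (card {j\<in>{1..<n}. k1 j < k1 0}) \<noteq> 0" using pos by linarith
      then have "(of_int (k1 0 + int (card {j\<in>{1..<n}. k1 j < k1 0})) :: complex) \<noteq> 0"
        by (simp only: of_int_eq_0_iff not_False_eq_True)
      then show ?thesis by simp
    qed
    ultimately have "D k1 = 0" by simp
    then show ?thesis by (rule Dk1)
  qed
qed

subsection \<open>Dunkl operators on Laurent monomials\<close>

definition zmon :: "nat \<Rightarrow> (nat \<Rightarrow> int) \<Rightarrow> (nat \<Rightarrow> complex) \<Rightarrow> complex" where
  "zmon n k z = (\<Prod>i<n. z i powi k i)"

text \<open>The value at \<open>x = y\<close> is the continuous extension.\<close>
definition dunkl :: "int \<Rightarrow> int \<Rightarrow> complex \<Rightarrow> complex \<Rightarrow> complex" where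
  "dunkl a b x y = (if x = y then of_int (a - b) * x powi (a + b)
     else (x + y) / (2 * (x - y)) * (x powi a * y powi b - x powi b * y powi a))"

text \<open>A Dunkl operator in the first variable, applied to the monomial with exponents \<open>k\<close>: the derivative
  \<open>z\<^sub>0 \<partial>\<^sub>0\<close> plus half of the logarithmic derivative \<open>\<Sum>\<^sub>j (z\<^sub>0 + z\<^sub>j) / (z\<^sub>0 - z\<^sub>j)\<close> of the Weyl density,
  antisymmetrised so that no poles remain. Integration by parts shows that its mean is zero.\<close>
definition dunkl_mon :: "nat \<Rightarrow> (nat \<Rightarrow> int) \<Rightarrow> (nat \<Rightarrow> complex) \<Rightarrow> complex" where
  "dunkl_mon n k z = of_int (k 0) * zmon n k z +
     (\<Sum>j\<in>{1..<n}. dunkl (k 0) (k j) (z 0) (z j) * (\<Prod>l\<in>{1..<n}-{j}. z l powi k l))"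

text \<open>Consecutive terms satisfy
  \<open>(x - y) * (f l + f (Suc l)) = (x + y) * (f l - f (Suc l))\<close>, so the sum telescopes.
  Interior terms end up with weight 1 and the two end terms with weight 1/2.\<close>

lemma dunkl_expand:
  assumes nz: "x \<noteq> 0" "y \<noteq> 0" and ba: "b \<le> a"
  shows "dunkl a b x y = (\<Sum>l<nat (a - b). x powi (a - int l) * y powi (b + int l)
            + x powi (a - int (Suc l)) * y powi (b + int (Suc l))) / 2"
proof (cases "x = y")
  case True
  have "x powi c * x powi d = x powi (a + b)" if "c + d = a + b" for c d
    using nz that by (simp add: power_int_add[symmetric])
  then show ?thesis using True ba by (simp add: dunkl_def)
next
  case False
  define f where "f l = x powi (a - int l) * y powi (b + int l)" for l
  have step: "(x - y) * (f l + f (Suc l)) = (x + y) * (f l - f (Suc l))" for l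
  proof -
    have "f l = x * (x powi (a - int (Suc l)) * y powi (b + int l))"
      using nz by (simp add: f_def power_int_diff power_int_add field_simps)
    moreover have "f (Suc l) = y * (x powi (a - int (Suc l)) * y powi (b + int l))"
      using nz by (simp add: f_def power_int_add field_simps)
    ultimately show ?thesis by (simp add: algebra_simps)
  qed
  define S where "S = (\<Sum>l<nat (a - b). f l + f (Suc l))"
  define C where "C = x powi a * y powi b - x powi b * y powi a"
  have "(x - y) * S = (x + y) * (\<Sum>l<nat (a - b). f l - f (Suc l))"
    unfolding S_def sum_distrib_left by (rule sum.cong[OF refl step])
  also have "(\<Sum>l<nat (a - b). f l - f (Suc l)) = f 0 - f (nat (a - b))"
    by (rule sum_lessThan_telescope')
  also have "f 0 - f (nat (a - b)) = C"
    using ba by (simp add: f_def C_def)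
  finally have "S = (x + y) * C / (x - y)" using False by (simp add: eq_divide_eq mult.commute)
  then have "(x + y) / (2 * (x - y)) * C = S / 2" by (simp add: mult.commute)
  then show ?thesis using False by (simp only: dunkl_def C_def S_def f_def if_False)
qed

text \<open>The multiplier \<open>x powi m + y powi m\<close> is symmetric in the two variables and
  hence commutes with antisymmetrisation.\<close>

lemma dunkl_shift:
  assumes "x \<noteq> 0" "y \<noteq> 0"
  shows "dunkl (a + m) b x y + dunkl a (b + m) x y = dunkl a b x y * (x powi m + y powi m)"
proof (cases "x = y")
  case True
  then show ?thesis using assms by (simp add: dunkl_def power_int_add algebra_simps)
next
  case False
  define c where "c = (x + y) / (2 * (x - y))"
  show ?thesis using assms False
    unfolding dunkl_def c_def[symmetric] by (simp add: power_int_add algebra_simps)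
qed

lemma cnj_unit: "norm x = 1 \<Longrightarrow> cnj x = inverse x"
  by (metis complex_div_cnj inverse_eq_divide mult_1 norm_one of_real_1 one_power2 div_by_1)

lemma cnj_powi: "norm x = 1 \<Longrightarrow> cnj (x powi a) = x powi (- a)"
  by (simp add: power_int_minus cnj_unit power_int_inverse)

text \<open>On the unit circle conjugation is inversion, and \<open>(x + y) / (x - y)\<close> is odd
  under simultaneous inversion of both points; this is the source of the sign.\<close>

lemma cnj_dunkl:
  assumes "norm x = 1" "norm y = 1"
  shows "cnj (dunkl a b x y) = - dunkl (- a) (- b) x y"
proof (cases "x = y")
  case True
  have "cnj (x powi (a + b)) = x powi (- a - b)" using cnj_powi[OF assms(1), of "a + b"] by simp
  with True show ?thesis by (simp add: dunkl_def algebra_simps)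
next
  case False
  have nz: "x \<noteq> 0" "y \<noteq> 0" using assms by auto
  have [simp]: "cnj x \<noteq> cnj y" "inverse x \<noteq> inverse y" using False by auto
  have "(inverse x + inverse y) / (2 * (inverse x - inverse y)) = - ((x + y) / (2 * (x - y)))"
    using nz False by (simp add: field_simps)
  then have "cnj ((x + y) / (2 * (x - y))) = - ((x + y) / (2 * (x - y)))"
    using assms by (simp add: cnj_unit)
  then show ?thesis using False assms unfolding dunkl_def
    by (simp only: if_False complex_cnj_mult complex_cnj_diff cnj_powi minus_mult_left)
qed

text \<open>Leibniz rule. The difference part of a Dunkl operator commutes with multiplication by a
  symmetric function, so a power sum is differentiated only by the part
  \<open>z\<^sub>0 \<partial>\<^sub>0\<close>, which turns it into
  \<open>m * z\<^sub>0 powi m\<close>.\<close>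

lemma raise_dunkl_mon:
  assumes nz: "\<And>i. i < n \<Longrightarrow> z i \<noteq> 0" and n: "n \<ge> 1"
  shows "(\<Sum>i<n. zmon n (k(i := k i + m)) z) = zmon n k z * (\<Sum>i<n. z i powi m)"
    and "(\<Sum>i<n. dunkl_mon n (k(i := k i + m)) z) = dunkl_mon n k z * (\<Sum>i<n. z i powi m) + of_int m * z 0 powi m * zmon n k z"
proof -
  define km where "km i = k(i := k i + m)" for i
  have mon1: "zmon n (km i) z = zmon n k z * z i powi m" if "i < n" for i
  proof -
    have "zmon n (km i) z = z i powi (k i + m) * (\<Prod>l\<in>{..<n}-{i}. z l powi k l)"
      unfolding zmon_def km_def using that by (subst prod.remove[of _ i]) (auto intro!: prod.cong)
    moreover have "zmon n k z = z i powi k i * (\<Prod>l\<in>{..<n}-{i}. z l powi k l)"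
      unfolding zmon_def km_def using that by (subst prod.remove[of _ i]) (auto intro!: prod.cong)
    ultimately show ?thesis using nz[OF that] by (simp add: power_int_add)
  qed
  then show "(\<Sum>i<n. zmon n (k(i := k i + m)) z) = zmon n k z * (\<Sum>i<n. z i powi m)"
    by (simp add: sum_distrib_left km_def)
  define R where "R k j = (\<Prod>l\<in>{1..<n}-{j}. z l powi (k l :: int))" for k j
  have R1: "R (km i) j = R k j * (if i = j then 1 else z i powi m)"
    if "i \<in> {1..<n}" "j \<in> {1..<n}" for i j
  proof (cases "i = j")
    case True
    then show ?thesis unfolding R_def km_def by (auto intro!: prod.cong)
  next
    case False
    have "R (km i) j = z i powi (k i + m) * (\<Prod>l\<in>{1..<n}-{j}-{i}. z l powi k l)"
      unfolding R_def km_def using that False by (subst prod.remove[of _ i]) (auto intro!: prod.cong)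
    moreover have "R k j = z i powi k i * (\<Prod>l\<in>{1..<n}-{j}-{i}. z l powi k l)"
      unfolding R_def km_def using that False by (subst prod.remove[of _ i]) (auto intro!: prod.cong)
    ultimately show ?thesis using nz[of i] that False by (simp add: power_int_add)
  qed
  have R0: "R (km 0) j = R k j" for j unfolding R_def km_def by (auto intro!: prod.cong)
  define K where "K a b j = dunkl a b (z 0) (z j)" for a b j
  have dunkl_mon_eq: "dunkl_mon n k z = of_int (k 0) * zmon n k z + (\<Sum>j\<in>{1..<n}. K (k 0) (k j) j * R k j)" for k
    by (simp add: dunkl_mon_def K_def R_def)
  have split: "(\<Sum>i<n. f i) = f 0 + (\<Sum>i\<in>{1..<n}. f i)" for f :: "nat \<Rightarrow> complex"
    using n by (simp add: lessThan_atLeast0 sum.atLeast_Suc_lessThan)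
  have km: "i \<noteq> 0 \<Longrightarrow> km i 0 = k 0" "km 0 0 = k 0 + m" "j \<noteq> 0 \<Longrightarrow> km 0 j = k j"
      "km i j = (if j = i then k j + m else k j)" for i j
    by (simp_all add: km_def)
  have "(\<Sum>i\<in>{1..<n}. dunkl_mon n (km i) z)
      = (\<Sum>i\<in>{1..<n}. of_int (k 0) * zmon n k z * z i powi m
          + (\<Sum>j\<in>{1..<n}. if i = j then K (k 0) (k j + m) j * R k j else K (k 0) (k j) j * R k j * z i powi m))"
    proof (intro sum.cong refl)
    fix i assume i: "i \<in> {1..<n}"
    have "(\<Sum>j\<in>{1..<n}. K (km i 0) (km i j) j * R (km i) j)
        = (\<Sum>j\<in>{1..<n}. if i = j then K (k 0) (k j + m) j * R k j else K (k 0) (k j) j * R k j * z i powi m)"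
      using i by (intro sum.cong) (auto simp: R1 km)
    then show "dunkl_mon n (km i) z = of_int (k 0) * zmon n k z * z i powi m
          + (\<Sum>j\<in>{1..<n}. if i = j then K (k 0) (k j + m) j * R k j else K (k 0) (k j) j * R k j * z i powi m)"
      unfolding dunkl_mon_eq using i by (simp add: mon1 km mult.assoc)
  qed
  also have "\<dots> = of_int (k 0) * zmon n k z * (\<Sum>i\<in>{1..<n}. z i powi m)
      + (\<Sum>j\<in>{1..<n}. \<Sum>i\<in>{1..<n}. if i = j then K (k 0) (k j + m) j * R k j else K (k 0) (k j) j * R k j * z i powi m)"
    by (subst sum.swap) (simp add: sum.distrib sum_distrib_left)
  also have "(\<Sum>j\<in>{1..<n}. \<Sum>i\<in>{1..<n}. if i = j then K (k 0) (k j + m) j * R k j else K (k 0) (k j) j * R k j * z i powi m)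
     = (\<Sum>j\<in>{1..<n}. K (k 0) (k j + m) j * R k j - K (k 0) (k j) j * R k j * z j powi m
         + K (k 0) (k j) j * R k j * (\<Sum>i\<in>{1..<n}. z i powi m))"
  proof (intro sum.cong refl)
    fix j assume j: "j \<in> {1..<n}"
    have "(\<Sum>i\<in>{1..<n}. if i = j then K (k 0) (k j + m) j * R k j else K (k 0) (k j) j * R k j * z i powi m)
       = (\<Sum>i\<in>{1..<n}. (if i = j then K (k 0) (k j + m) j * R k j - K (k 0) (k j) j * R k j * z j powi m else 0)
            + K (k 0) (k j) j * R k j * z i powi m)"
      by (intro sum.cong) auto
    then show "(\<Sum>i\<in>{1..<n}. if i = j then K (k 0) (k j + m) j * R k j else K (k 0) (k j) j * R k j * z i powi m)
       = K (k 0) (k j + m) j * R k j - K (k 0) (k j) j * R k j * z j powi m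
         + K (k 0) (k j) j * R k j * (\<Sum>i\<in>{1..<n}. z i powi m)"
      using j by (simp add: sum.distrib sum_distrib_left)
  qed
  finally have 1: "(\<Sum>i\<in>{1..<n}. dunkl_mon n (km i) z) = dunkl_mon n k z * (\<Sum>i\<in>{1..<n}. z i powi m)
      + (\<Sum>j\<in>{1..<n}. K (k 0) (k j + m) j * R k j - K (k 0) (k j) j * R k j * z j powi m)"
    unfolding dunkl_mon_eq[of k] sum.distrib distrib_right sum_distrib_right by (simp only: ac_simps)
  have "dunkl_mon n (km 0) z = of_int (k 0 + m) * zmon n k z * z 0 powi m
      + (\<Sum>j\<in>{1..<n}. K (k 0 + m) (k j) j * R k j)"
    using mon1[of 0] n by (simp add: dunkl_mon_eq R0 km)
  also have "(\<Sum>j\<in>{1..<n}. K (k 0 + m) (k j) j * R k j)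
      = (\<Sum>j\<in>{1..<n}. K (k 0) (k j) j * R k j * z 0 powi m
           - (K (k 0) (k j + m) j * R k j - K (k 0) (k j) j * R k j * z j powi m))"
  proof (intro sum.cong refl)
    fix j assume j: "j \<in> {1..<n}"
    \<comment> \<open>Raising position \<open>j\<close> misses the exact product by one kernel term;
      raising position \<open>0\<close> misses it by the negative of that term.\<close>
    have "K (k 0 + m) (k j) j = K (k 0) (k j) j * (z 0 powi m + z j powi m) - K (k 0) (k j + m) j"
      using dunkl_shift[of "z 0" "z j" "k 0" m "k j"] nz n j unfolding K_def by (simp add: eq_diff_eq)
    then show "K (k 0 + m) (k j) j * R k j = K (k 0) (k j) j * R k j * z 0 powi m
           - (K (k 0) (k j + m) j * R k j - K (k 0) (k j) j * R k j * z j powi m)"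
      by (simp only:) (simp only: algebra_simps)
  qed
  finally have 2: "dunkl_mon n (km 0) z = dunkl_mon n k z * z 0 powi m + of_int m * z 0 powi m * zmon n k z
      - (\<Sum>j\<in>{1..<n}. K (k 0) (k j + m) j * R k j - K (k 0) (k j) j * R k j * z j powi m)"
    unfolding dunkl_mon_eq[of k] sum_subtractf[of "\<lambda>j. K (k 0) (k j) j * R k j * z 0 powi m"] sum_distrib_right[symmetric]
    by (simp only: of_int_add algebra_simps)
  show "(\<Sum>i<n. dunkl_mon n (k(i := k i + m)) z) = dunkl_mon n k z * (\<Sum>i<n. z i powi m) + of_int m * z 0 powi m * zmon n k z"
    unfolding km_def[symmetric] split[of "\<lambda>i. dunkl_mon n (km i) z"] split[of "\<lambda>i. z i powi m"] 1 2
    by (simp add: algebra_simps)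
qed

definition psum :: "nat \<Rightarrow> (nat \<Rightarrow> complex) \<Rightarrow> int \<Rightarrow> complex" where
  "psum n z m = (\<Sum>i<n. z i powi m)"

text \<open>The derivative of \<open>\<Prod>m\<leftarrow>ms. p m\<close> when \<open>p m\<close> has derivative \<open>m * f m\<close>.\<close>
fun dprod :: "(int \<Rightarrow> complex) \<Rightarrow> (int \<Rightarrow> complex) \<Rightarrow> int list \<Rightarrow> complex" where
  "dprod p f [] = 0"
| "dprod p f (m # ms) = of_int m * f m * prod_list (map p ms) + p m * dprod p f ms"

lemma raise_sum_zmon:
  assumes "\<And>i. i < n \<Longrightarrow> z i \<noteq> 0" "n \<ge> 1"
  shows "raise_sum n (zmon n) k ms z = zmon n k z * prod_list (map (psum n z) ms)"
proof (induction ms arbitrary: k)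
  case (Cons m ms)
  have "raise_sum n (zmon n) k (m # ms) z = (\<Sum>i<n. zmon n (k(i := k i + m)) z) * prod_list (map (psum n z) ms)"
    by (simp add: Cons.IH sum_distrib_right del: fun_upd_apply)
  also have "\<dots> = zmon n k z * prod_list (map (psum n z) (m # ms))"
  proof -
    have "(\<Sum>i<n. zmon n (k(i := k i + m)) z) = zmon n k z * psum n z m"
      unfolding psum_def by (rule raise_dunkl_mon(1)) (use assms in auto)
    then show ?thesis by simp
  qed
  finally show ?case .
qed simp

text \<open>Iterated Leibniz rule: \<open>dprod\<close> collects the terms in which the derivative
  in the first variable hits one of the power sums.\<close>

lemma raise_sum_dunkl_mon:
  assumes "\<And>i. i < n \<Longrightarrow> z i \<noteq> 0" "n \<ge> 1"
  shows "raise_sum n (dunkl_mon n) k ms z = dunkl_mon n k z * prod_list (map (psum n z) ms)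
     + zmon n k z * dprod (psum n z) (\<lambda>m. z 0 powi m) ms"
proof (induction ms arbitrary: k)
  case (Cons m ms)
  have "raise_sum n (dunkl_mon n) k (m # ms) z = (\<Sum>i<n. dunkl_mon n (k(i := k i + m)) z) * prod_list (map (psum n z) ms)
     + (\<Sum>i<n. zmon n (k(i := k i + m)) z) * dprod (psum n z) (\<lambda>m. z 0 powi m) ms"
    by (simp add: Cons.IH sum_distrib_right sum.distrib del: fun_upd_apply)
  also have "\<dots> = dunkl_mon n k z * prod_list (map (psum n z) (m # ms)) + zmon n k z * dprod (psum n z) (\<lambda>m. z 0 powi m) (m # ms)"
  proof -
    have "(\<Sum>i<n. zmon n (k(i := k i + m)) z) = zmon n k z * psum n z m"
      unfolding psum_def by (rule raise_dunkl_mon(1)) (use assms in auto)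
    moreover have "(\<Sum>i<n. dunkl_mon n (k(i := k i + m)) z) = dunkl_mon n k z * psum n z m + of_int m * z 0 powi m * zmon n k z"
      unfolding psum_def by (rule raise_dunkl_mon(2)) (use assms in auto)
    ultimately show ?thesis by (simp only: dprod.simps list.map prod_list.Cons) (simp add: algebra_simps)
  qed
  finally show ?case .
qed simp

lemma raise_sum_sum:
  "raise_sum n (\<lambda>k w. \<Sum>\<sigma>\<in>S. \<rho> k (g \<sigma> w)) k ms w = (\<Sum>\<sigma>\<in>S. raise_sum n \<rho> k ms (g \<sigma> w))"
proof (induction ms arbitrary: k)
  case (Cons m ms)
  show ?case unfolding raise_sum.simps Cons.IH by (rule sum.swap)
qed simp

lemma raise_sum_cnj:
  assumes "\<And>k. cnj (\<rho> k w) = - \<rho> (\<lambda>i. - k i) w"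
  shows "cnj (raise_sum n \<rho> k ms w) = - raise_sum n \<rho> (\<lambda>i. - k i) (map uminus ms) w"
proof (induction ms arbitrary: k)
  case (Cons m ms)
  have "(\<lambda>l. - (k(i := k i + m)) l) = (\<lambda>l. - k l)(i := - k i + - m)" for i
    by auto
  then show ?case
    unfolding raise_sum.simps cnj_sum Cons.IH list.map by (simp only: sum_negf)
qed (simp add: assms)

section \<open>Permutations of the variables and symmetrised monomials\<close>

lemma zmon_perm:
  assumes "\<sigma> permutes {..<n}"
  shows "zmon n (k \<circ> \<sigma>) (z \<circ> \<sigma>) = zmon n k z"
  unfolding zmon_def using prod.permute[OF assms, of "\<lambda>i. z i powi k i"] by (simp add: o_def)

lemma zmon_transpose:
  assumes "i < n" "j < n"
  shows "zmon n (k \<circ> transposition i j) z = zmon n k (z \<circ> transposition i j)"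
proof -
  have "zmon n ((k \<circ> transposition i j) \<circ> transposition i j) (z \<circ> transposition i j)
      = zmon n (k \<circ> transposition i j) z"
    using assms by (intro zmon_perm permutes_swap_id) auto
  then show ?thesis by (simp add: comp_assoc)
qed

lemma dunkl_mon_transpose:
  assumes "i \<in> {1..<n}" "j \<in> {1..<n}"
  shows "dunkl_mon n (k \<circ> transposition i j) z = dunkl_mon n k (z \<circ> transposition i j)"
proof -
  define t where "t = transposition i j"
  have tt: "t (t l) = l" for l by (simp add: t_def)
  have t: "t permutes {1..<n}" unfolding t_def using assms by (intro permutes_swap_id) auto
  have t0: "t 0 = 0" using assms by (auto simp: t_def transpose_apply_other)
  have "(\<Sum>l\<in>{1..<n}. dunkl (k 0) (k (t l)) (z 0) (z l) * (\<Prod>q\<in>{1..<n}-{l}. z q powi k (t q)))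
      = (\<Sum>l\<in>{1..<n}. dunkl (k 0) (k l) (z 0) (z (t l)) * (\<Prod>q\<in>{1..<n}-{t l}. z q powi k (t q)))"
    using sum.permute[OF t, of "\<lambda>l. dunkl (k 0) (k (t l)) (z 0) (z l) * (\<Prod>q\<in>{1..<n}-{l}. z q powi k (t q))"]
    by (simp add: o_def tt)
  also have "\<dots> = (\<Sum>l\<in>{1..<n}. dunkl (k 0) (k l) (z 0) (z (t l)) * (\<Prod>q\<in>{1..<n}-{l}. z (t q) powi k q))"
  proof (intro sum.cong refl arg_cong2[where f = "(*)"])
    fix l assume "l \<in> {1..<n}"
    have "bij_betw t ({1..<n}-{l}) ({1..<n}-{t l})"
      using permutes_imp_bij[OF t] \<open>l \<in> {1..<n}\<close> permutes_in_image[OF t, of l] by (intro bij_betw_DiffI) auto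
    then show "(\<Prod>q\<in>{1..<n}-{t l}. z q powi k (t q)) = (\<Prod>q\<in>{1..<n}-{l}. z (t q) powi k q)"
      using prod.reindex_bij_betw[of t "{1..<n}-{l}" "{1..<n}-{t l}" "\<lambda>q. z q powi k (t q)"] by (simp add: tt)
  qed
  finally show ?thesis
    using zmon_transpose[of i n j k z] assms unfolding dunkl_mon_def by (simp add: t_def[symmetric] t0)
qed

text \<open>Summing over all orderings makes the value depend only on the multiset of the first
  \<open>n\<close> entries of \<open>z\<close>, hence meaningful for eigenvalues. There is no
  division by the number of orderings, which is why factorials appear below.\<close>

definition zmon_sym :: "nat \<Rightarrow> (nat \<Rightarrow> int) \<Rightarrow> (nat \<Rightarrow> complex) \<Rightarrow> complex" where
  "zmon_sym n k z = (\<Sum>\<sigma> | \<sigma> permutes {..<n}. zmon n k (z \<circ> \<sigma>))"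

definition dunkl_mon_sym :: "nat \<Rightarrow> (nat \<Rightarrow> int) \<Rightarrow> (nat \<Rightarrow> complex) \<Rightarrow> complex" where
  "dunkl_mon_sym n k z = (\<Sum>\<sigma> | \<sigma> permutes {..<n}. dunkl_mon n k (z \<circ> \<sigma>))"

lemma sum_permutes_compose:
  assumes "\<tau> permutes S"
  shows "(\<Sum>\<sigma> | \<sigma> permutes S. f (\<sigma> \<circ> \<tau>)) = (\<Sum>\<sigma> | \<sigma> permutes S. f \<sigma>)"
  by (rule sum_permutations_compose_right[OF assms, symmetric])

lemma zmon_sym_transpose:
  assumes "i < n" "j < n"
  shows "zmon_sym n (k \<circ> transposition i j) = zmon_sym n k"
proof
  fix z
  have "transposition i j permutes {..<n}" using assms by (intro permutes_swap_id) auto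
  from sum_permutes_compose[OF this, of "\<lambda>\<sigma>. zmon n k (z \<circ> \<sigma>)"]
  show "zmon_sym n (k \<circ> transposition i j) z = zmon_sym n k z"
    using assms by (simp add: zmon_sym_def zmon_transpose comp_assoc)
qed

lemma dunkl_mon_sym_transpose:
  assumes "i \<in> {1..<n}" "j \<in> {1..<n}"
  shows "dunkl_mon_sym n (k \<circ> transposition i j) = dunkl_mon_sym n k"
proof
  fix z
  have "transposition i j permutes {..<n}" using assms by (intro permutes_swap_id) auto
  from sum_permutes_compose[OF this, of "\<lambda>\<sigma>. dunkl_mon n k (z \<circ> \<sigma>)"]
  show "dunkl_mon_sym n (k \<circ> transposition i j) z = dunkl_mon_sym n k z"
    using assms by (simp add: dunkl_mon_sym_def dunkl_mon_transpose comp_assoc)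
qed

lemma cnj_zmon:
  assumes "\<And>i. i < n \<Longrightarrow> norm (z i) = 1"
  shows "cnj (zmon n k z) = zmon n (\<lambda>i. - k i) z"
  unfolding zmon_def cnj_prod by (intro prod.cong refl cnj_powi assms) simp

lemma cnj_dunkl_mon:
  assumes "\<And>i. i < n \<Longrightarrow> norm (z i) = 1" "n \<ge> 1"
  shows "cnj (dunkl_mon n k z) = - dunkl_mon n (\<lambda>i. - k i) z"
proof -
  have "cnj (\<Prod>l\<in>{1..<n}-{j}. z l powi k l) = (\<Prod>l\<in>{1..<n}-{j}. z l powi (- k l))" for j
    unfolding cnj_prod by (intro prod.cong refl cnj_powi assms(1)) simp
  then have "cnj (\<Sum>j\<in>{1..<n}. dunkl (k 0) (k j) (z 0) (z j) * (\<Prod>l\<in>{1..<n}-{j}. z l powi k l))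
      = (\<Sum>j\<in>{1..<n}. - (dunkl (- k 0) (- k j) (z 0) (z j) * (\<Prod>l\<in>{1..<n}-{j}. z l powi - k l)))"
    unfolding cnj_sum by (intro sum.cong refl) (simp only: complex_cnj_mult cnj_dunkl assms atLeastLessThan_iff, simp add: cnj_dunkl assms)
  then show ?thesis
    unfolding dunkl_mon_def using cnj_zmon[OF assms(1)] by (simp add: sum_negf del: cnj_sum)
qed

lemma permutes_unit:
  assumes "\<And>i. i < n \<Longrightarrow> norm (z i :: complex) = 1" "\<sigma> permutes {..<n}" "i < n"
  shows "norm ((z \<circ> \<sigma>) i) = 1"
  using assms permutes_in_image[OF assms(2), of i] by simp

lemma cnj_zmon_sym:
  assumes "\<And>i. i < n \<Longrightarrow> norm (z i) = 1"
  shows "cnj (zmon_sym n k z) = zmon_sym n (\<lambda>i. - k i) z"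
  unfolding zmon_sym_def cnj_sum
  by (intro sum.cong refl cnj_zmon) (use permutes_unit[of n z] assms in auto)

lemma cnj_dunkl_mon_sym:
  assumes "\<And>i. i < n \<Longrightarrow> norm (z i) = 1" "n \<ge> 1"
  shows "cnj (dunkl_mon_sym n k z) = - dunkl_mon_sym n (\<lambda>i. - k i) z"
  unfolding dunkl_mon_sym_def cnj_sum sum_negf[symmetric]
  by (intro sum.cong refl cnj_dunkl_mon) (use permutes_unit[of n z] assms in auto)

lemma zmon_cong: "(\<And>i. i < n \<Longrightarrow> k i = k' i) \<Longrightarrow> zmon n k = zmon n k'"
  by (intro ext) (simp add: zmon_def)

lemma dunkl_mon_cong: "n \<ge> 1 \<Longrightarrow> (\<And>i. i < n \<Longrightarrow> k i = k' i) \<Longrightarrow> dunkl_mon n k = dunkl_mon n k'"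
  by (intro ext) (simp add: dunkl_mon_def zmon_cong[of n k k'])

lemma zmon_move:
  assumes "j \<in> {1..<n}"
  shows "zmon n (move k j l) z = z 0 powi (k 0 - int l) * z j powi (k j + int l) * (\<Prod>q\<in>{1..<n}-{j}. z q powi k q)"
proof -
  define S where "S = {1..<n} - {j}"
  have S: "{..<n} = insert 0 (insert j S)" "finite S" "0 \<notin> S" "j \<notin> S" "j \<noteq> 0"
    using assms by (auto simp: S_def)
  have "(\<Prod>q\<in>S. z q powi move k j l q) = (\<Prod>q\<in>S. z q powi k q)"
    using S by (intro prod.cong) (auto simp: move_def)
  then show ?thesis
    unfolding zmon_def S_def[symmetric] S(1) using S(2-) by (simp add: move_def)
qed

lemma dunkl_mon_expand:
  assumes nz: "\<And>i. i < n \<Longrightarrow> z i \<noteq> 0" and mx: "\<And>j. j \<in> {1..<n} \<Longrightarrow> k j \<le> k 0"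
  shows "dunkl_mon n k z = of_int (k 0) * zmon n k z
     + (\<Sum>j\<in>{1..<n}. (\<Sum>l<nat (k 0 - k j). zmon n (move k j l) z + zmon n (move k j (Suc l)) z) / 2)"
  unfolding dunkl_mon_def
proof (intro arg_cong2[where f = "(+)"] refl sum.cong)
  fix j assume j: "j \<in> {1..<n}"
  then have nz2: "z 0 \<noteq> 0" "z j \<noteq> 0" using nz by auto
  show "dunkl (k 0) (k j) (z 0) (z j) * (\<Prod>l\<in>{1..<n}-{j}. z l powi k l)
      = (\<Sum>l<nat (k 0 - k j). zmon n (move k j l) z + zmon n (move k j (Suc l)) z) / 2"
    unfolding dunkl_expand[OF nz2 mx[OF j]] zmon_move[OF j] distrib_right[symmetric] sum_distrib_right[symmetric] by simp
qed

text \<open>The right-hand side has the shape of the recursion in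
  \<open>monomial_recursion_unique\<close>. The first exponent must be the largest, as otherwise the
  range of \<open>l\<close> would be empty.\<close>

lemma dunkl_mon_sym_expand:
  assumes nz: "\<And>i. i < n \<Longrightarrow> z i \<noteq> 0" and mx: "\<And>j. j \<in> {1..<n} \<Longrightarrow> k j \<le> k 0"
  shows "dunkl_mon_sym n k z = of_int (k 0) * zmon_sym n k z
     + (\<Sum>j\<in>{1..<n}. (\<Sum>l<nat (k 0 - k j). zmon_sym n (move k j l) z + zmon_sym n (move k j (Suc l)) z) / 2)"
proof -
  have "dunkl_mon_sym n k z = (\<Sum>\<sigma> | \<sigma> permutes {..<n}. of_int (k 0) * zmon n k (z \<circ> \<sigma>)
     + (\<Sum>j\<in>{1..<n}. (\<Sum>l<nat (k 0 - k j). zmon n (move k j l) (z \<circ> \<sigma>) + zmon n (move k j (Suc l)) (z \<circ> \<sigma>)) / 2))"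
    unfolding dunkl_mon_sym_def
  proof (rule sum.cong[OF refl], rule dunkl_mon_expand)
    fix \<sigma> i assume "\<sigma> \<in> {\<sigma>. \<sigma> permutes {..<n}}" "i < n"
    then show "(z \<circ> \<sigma>) i \<noteq> 0" using nz permutes_in_image[of \<sigma> "{..<n}" i] by simp
  qed (rule mx)
  also have "\<dots> = of_int (k 0) * zmon_sym n k z
     + (\<Sum>j\<in>{1..<n}. (\<Sum>l<nat (k 0 - k j). zmon_sym n (move k j l) z + zmon_sym n (move k j (Suc l)) z) / 2)"
  proof -
    have "(\<Sum>l<d. zmon_sym n (f l) z + zmon_sym n (g l) z) / 2
        = (\<Sum>\<sigma> | \<sigma> permutes {..<n}. (\<Sum>l<d. zmon n (f l) (z \<circ> \<sigma>) + zmon n (g l) (z \<circ> \<sigma>)) / 2)" for d :: nat and f g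
      unfolding zmon_sym_def sum.distrib[symmetric] sum_divide_distrib[symmetric]
      by (subst sum.swap) (rule refl)
    then show ?thesis
      unfolding zmon_sym_def[of n k] sum_distrib_left
      by (subst sum.distrib, subst sum.swap) (simp only:)
  qed
  finally show ?thesis .
qed

text \<open>Each value of \<open>\<sigma> 0\<close> is taken by \<open>fact (n - 1)\<close>
  permutations. By symmetry the position \<open>0\<close> may be averaged over all positions, and
  every permutation then contributes the same sum.\<close>

lemma sum_permutes_apply:
  assumes "n \<ge> 1"
  shows "(\<Sum>\<sigma> | \<sigma> permutes {..<n}. H (\<sigma> 0)) = (fact (n - 1) :: complex) * (\<Sum>i<n. H i)"
proof -
  have "(\<Sum>\<sigma> | \<sigma> permutes {..<n}. H (\<sigma> i)) = (\<Sum>\<sigma> | \<sigma> permutes {..<n}. H (\<sigma> 0))" if "i < n" for i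
    using sum_permutes_compose[of "transposition 0 i" "{..<n}" "\<lambda>\<sigma>. H (\<sigma> 0)"]
      permutes_swap_id[of 0 "{..<n}" i] that assms by simp
  then have "(\<Sum>i<n. \<Sum>\<sigma> | \<sigma> permutes {..<n}. H (\<sigma> i)) = (\<Sum>i<n. \<Sum>\<sigma> | \<sigma> permutes {..<n}. H (\<sigma> 0))"
    by (rule sum.cong[OF refl]) simp
  then have "of_nat n * (\<Sum>\<sigma> | \<sigma> permutes {..<n}. H (\<sigma> 0)) = (\<Sum>i<n. \<Sum>\<sigma> | \<sigma> permutes {..<n}. H (\<sigma> i))"
    by (simp only: sum_constant card_lessThan)
  also have "\<dots> = (\<Sum>\<sigma> | \<sigma> permutes {..<n}. \<Sum>i<n. H (\<sigma> i))" by (rule sum.swap)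
  also have "\<dots> = (\<Sum>\<sigma> | \<sigma> permutes {..<n}. \<Sum>i<n. H i)"
  proof (rule sum.cong[OF refl])
    fix \<sigma> assume "\<sigma> \<in> {\<sigma>. \<sigma> permutes {..<n}}"
    then show "(\<Sum>i<n. H (\<sigma> i)) = (\<Sum>i<n. H i)"
      using sum.permute[of \<sigma> "{..<n}" H] by (simp add: o_def)
  qed
  also have "\<dots> = fact n * (\<Sum>i<n. H i)" by (simp add: card_permutations)
  also have "fact n = (of_nat n * fact (n - 1) :: complex)" using assms by (cases n) auto
  finally have "of_nat n * (\<Sum>\<sigma> | \<sigma> permutes {..<n}. H (\<sigma> 0)) = of_nat n * (fact (n - 1) * (\<Sum>i<n. H i))"
    by (simp only: mult.assoc)
  moreover have "(of_nat n :: complex) \<noteq> 0" using assms by simp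
  ultimately show ?thesis by (simp only: mult_cancel_left simp_thms)
qed

text \<open>In the product of two power sums the diagonal pairs give \<open>z i ^ a\<close> once for
  each of the \<open>a\<close> values of \<open>l\<close>, which is the derivative term. The
  remaining pairs are the Dunkl terms, whose half weights are absorbed by exchanging
  \<open>i\<close> and \<open>j\<close>.\<close>

lemma sum_dunkl_pairs:
  assumes nz: "\<And>i. i < n \<Longrightarrow> z i \<noteq> 0"
  shows "(\<Sum>i<n. of_nat a * z i ^ a + (\<Sum>j\<in>{..<n}-{i}. dunkl (int a) 0 (z i) (z j)))
     = (\<Sum>l<a. psum n z (int l) * psum n z (int (a - l)))"
proof -
  define f where "f l i j = z i ^ l * z j ^ (a - l)" for l i j
  define T where "T l = (\<Sum>i<n. \<Sum>j\<in>{..<n}-{i}. f l i j)" for l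
  have T_swap: "(\<Sum>i<n. \<Sum>j\<in>{..<n}-{i}. f l j i) = T l" for l
  proof -
    have *: "(\<Sum>i<n. \<Sum>j\<in>{..<n}-{i}. g i j) = (\<Sum>i<n. \<Sum>j<n. g i j) - (\<Sum>i<n. g i i)" for g :: "nat \<Rightarrow> nat \<Rightarrow> complex"
      by (simp add: sum_diff1 sum_subtractf)
    show ?thesis unfolding T_def * by (subst sum.swap) (rule refl)
  qed
  have pp: "psum n z (int l) * psum n z (int (a - l)) = (\<Sum>i<n. z i ^ a) + T l" if "l < a" for l
  proof -
    have "psum n z (int l) * psum n z (int (a - l)) = (\<Sum>i<n. \<Sum>j<n. f l i j)"
      by (simp add: psum_def f_def sum_product del: of_nat_diff)
    also have "\<dots> = (\<Sum>i<n. f l i i + (\<Sum>j\<in>{..<n}-{i}. f l i j))"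
      by (intro sum.cong refl) (simp add: sum.remove)
    also have "\<dots> = (\<Sum>i<n. z i ^ a) + T l"
      using that by (simp add: sum.distrib T_def f_def power_add[symmetric])
    finally show ?thesis .
  qed
  have dk: "dunkl (int a) 0 (z i) (z j) = (\<Sum>l<a. f l j i + f l i j) / 2" if "i < n" "j < n" for i j
  proof -
    have nzij: "z i \<noteq> 0" "z j \<noteq> 0" using nz that by auto
    have "dunkl (int a) 0 (z i) (z j) = (\<Sum>l<a. z i powi (int a - int l) * z j powi (int l)
        + z i powi (int a - int (Suc l)) * z j powi int (Suc l)) / 2"
      using dunkl_expand[OF nzij, of 0 "int a"] by simp
    also have "(\<Sum>l<a. z i powi (int a - int l) * z j powi (int l)
        + z i powi (int a - int (Suc l)) * z j powi int (Suc l)) = (\<Sum>l<a. f l j i + f (a - Suc l) i j)"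
    proof (intro sum.cong refl)
      fix l assume l: "l \<in> {..<a}"
      then have "int a - int l = int (a - l)" "int a - int (Suc l) = int (a - Suc l)" "a - (a - Suc l) = Suc l" by auto
      then show "z i powi (int a - int l) * z j powi (int l) + z i powi (int a - int (Suc l)) * z j powi int (Suc l)
          = f l j i + f (a - Suc l) i j"
        by (simp only: f_def power_int_of_nat mult.commute)
    qed
    also have "(\<Sum>l<a. f l j i + f (a - Suc l) i j) = (\<Sum>l<a. f l j i) + (\<Sum>l<a. f l i j)"
      unfolding sum.distrib by (subst sum.nat_diff_reindex) simp
    finally show ?thesis by (simp add: sum.distrib)
  qed
  have "(\<Sum>i<n. \<Sum>j\<in>{..<n}-{i}. dunkl (int a) 0 (z i) (z j)) = (\<Sum>i<n. \<Sum>j\<in>{..<n}-{i}. (\<Sum>l<a. f l j i + f l i j) / 2)"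
    by (intro sum.cong refl dk) auto
  also have "\<dots> = (\<Sum>l<a. (\<Sum>i<n. \<Sum>j\<in>{..<n}-{i}. f l j i) + T l) / 2"
  proof -
    have "(\<Sum>i<n. \<Sum>j\<in>{..<n}-{i}. (\<Sum>l<a. f l j i + f l i j) / 2)
        = (\<Sum>l<a. \<Sum>i<n. \<Sum>j\<in>{..<n}-{i}. (f l j i + f l i j) / 2)"
      unfolding sum_divide_distrib sum.swap[of _ _ "{..<a}"] by (rule refl)
    then show ?thesis unfolding T_def sum.distrib[symmetric] sum_divide_distrib[symmetric] by simp
  qed
  also have "\<dots> = (\<Sum>l<a. T l)" by (simp add: T_swap sum_divide_distrib)
  finally have "(\<Sum>i<n. \<Sum>j\<in>{..<n}-{i}. dunkl (int a) 0 (z i) (z j)) = (\<Sum>l<a. T l)" .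
  moreover have "(\<Sum>l<a. psum n z (int l) * psum n z (int (a - l))) = (\<Sum>l<a. (\<Sum>i<n. z i ^ a) + T l)"
    by (intro sum.cong refl pp) simp
  ultimately show ?thesis by (simp add: sum.distrib sum_distrib_left)
qed

lemma dprod_sum: "(\<Sum>i\<in>S. c i * dprod p (f i) ms) = dprod p (\<lambda>m. \<Sum>i\<in>S. c i * f i m) ms"
proof (induction ms)
  case (Cons m ms)
  have "(\<Sum>i\<in>S. c i * dprod p (f i) (m # ms))
      = (\<Sum>i\<in>S. of_int m * (c i * f i m) * prod_list (map p ms) + p m * (c i * dprod p (f i) ms))"
    by (rule sum.cong[OF refl]) (simp add: algebra_simps)
  then show ?case
    by (simp only: sum.distrib sum_distrib_left[symmetric] sum_distrib_right[symmetric] Cons.IH dprod.simps)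
qed simp

text \<open>The bracket on the right becomes the integrand of \<open>haar_schwinger_dyson\<close>
  when power sums are read as traces of powers; this identity links Dunkl operators to random
  matrices.\<close>

lemma raise_sum_dunkl_mon_sym:
  assumes nz: "\<And>i. i < n \<Longrightarrow> z i \<noteq> 0" and n: "n \<ge> 1"
  shows "raise_sum n (dunkl_mon_sym n) ((\<lambda>_. 0)(0 := int a)) ms z = fact (n - 1) *
    ((\<Sum>l<a. psum n z (int l) * psum n z (int (a - l))) * prod_list (map (psum n z) ms)
      + dprod (psum n z) (\<lambda>m. psum n z (int a + m)) ms)"
proof -
  define k where "k = (\<lambda>_::nat. 0 :: int)(0 := int a)"
  define H where "H i = (of_nat a * z i ^ a + (\<Sum>j\<in>{..<n}-{i}. dunkl (int a) 0 (z i) (z j))) * prod_list (map (psum n z) ms)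
      + z i ^ a * dprod (psum n z) (\<lambda>m. z i powi m) ms" for i
  have "raise_sum n (dunkl_mon_sym n) k ms z = (\<Sum>\<sigma> | \<sigma> permutes {..<n}. raise_sum n (dunkl_mon n) k ms (z \<circ> \<sigma>))"
    unfolding dunkl_mon_sym_def[abs_def] by (rule raise_sum_sum)
  also have "\<dots> = (\<Sum>\<sigma> | \<sigma> permutes {..<n}. H (\<sigma> 0))"
  proof (intro sum.cong refl)
    fix \<sigma> assume "\<sigma> \<in> {\<sigma>. \<sigma> permutes {..<n}}"
    then have \<sigma>: "\<sigma> permutes {..<n}" by simp
    have psum: "psum n (z \<circ> \<sigma>) = psum n z"
      using sum.permute[OF \<sigma>, of "\<lambda>i. z i powi _"] by (auto simp: psum_def o_def fun_eq_iff)
    have mon: "zmon n k (z \<circ> \<sigma>) = z (\<sigma> 0) ^ a"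
    proof -
      have "zmon n k (z \<circ> \<sigma>) = (\<Prod>i<n. if i = 0 then z (\<sigma> 0) ^ a else 1)"
        unfolding zmon_def k_def by (intro prod.cong) auto
      then show ?thesis using n by simp
    qed
    have "bij_betw \<sigma> {1..<n} ({..<n} - {\<sigma> 0})"
    proof -
      have "bij_betw \<sigma> ({..<n} - {0}) ({..<n} - {\<sigma> 0})"
        using permutes_imp_bij[OF \<sigma>] permutes_in_image[OF \<sigma>, of 0] n by (intro bij_betw_DiffI) auto
      moreover have "{..<n} - {0} = {1..<n}" by auto
      ultimately show ?thesis by simp
    qed
    then have "(\<Sum>j\<in>{1..<n}. dunkl (int a) 0 (z (\<sigma> 0)) (z (\<sigma> j))) = (\<Sum>j\<in>{..<n}-{\<sigma> 0}. dunkl (int a) 0 (z (\<sigma> 0)) (z j))"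
      by (rule sum.reindex_bij_betw)
    moreover have "(\<Prod>l\<in>{1..<n}-{j}. z (\<sigma> l) powi k l) = 1" for j
      by (intro prod.neutral) (auto simp: k_def)
    ultimately have dunkl_mon: "dunkl_mon n k (z \<circ> \<sigma>) = of_nat a * z (\<sigma> 0) ^ a + (\<Sum>j\<in>{..<n}-{\<sigma> 0}. dunkl (int a) 0 (z (\<sigma> 0)) (z j))"
      unfolding dunkl_mon_def mon by (simp add: k_def)
    have "raise_sum n (dunkl_mon n) k ms (z \<circ> \<sigma>) = dunkl_mon n k (z \<circ> \<sigma>) * prod_list (map (psum n (z \<circ> \<sigma>)) ms)
       + zmon n k (z \<circ> \<sigma>) * dprod (psum n (z \<circ> \<sigma>)) (\<lambda>m. (z \<circ> \<sigma>) 0 powi m) ms"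
      by (rule raise_sum_dunkl_mon) (use n nz permutes_in_image[OF \<sigma>] in auto)
    then show "raise_sum n (dunkl_mon n) k ms (z \<circ> \<sigma>) = H (\<sigma> 0)"
      unfolding H_def psum mon dunkl_mon by simp
  qed
  also have "\<dots> = fact (n - 1) * (\<Sum>i<n. H i)" by (rule sum_permutes_apply[OF n])
  also have "(\<Sum>i<n. H i) = (\<Sum>l<a. psum n z (int l) * psum n z (int (a - l))) * prod_list (map (psum n z) ms)
      + dprod (psum n z) (\<lambda>m. \<Sum>i<n. z i ^ a * z i powi m) ms"
    unfolding H_def sum.distrib sum_distrib_right[symmetric] dprod_sum
    by (simp only: sum.distrib[symmetric] sum_dunkl_pairs[OF nz])
  also have "(\<lambda>m. \<Sum>i<n. z i ^ a * z i powi m) = (\<lambda>m. psum n z (int a + m))"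
    using nz by (auto simp: psum_def power_int_add intro!: sum.cong)
  finally show ?thesis unfolding k_def .
qed

subsection \<open>The Weyl density on a grid of roots of unity\<close>

definition vander_prod :: "nat \<Rightarrow> (nat \<Rightarrow> complex) \<Rightarrow> complex" where
  "vander_prod n z = (\<Prod>i<n. \<Prod>j<i. z i - z j)"

text \<open>Multiplying the Vandermonde matrix \<open>V\<close> by the unitriangular matrix
  \<open>C\<close> of coefficients of the Newton polynomials \<open>q j\<close> gives the matrix of
  values \<open>poly (q j) (z i)\<close>. It is lower triangular, and its diagonal is the asserted
  product.\<close>

lemma vandermonde:
  "(\<Sum>\<sigma> | \<sigma> permutes {..<n}. of_int (sign \<sigma>) * (\<Prod>i<n. z i ^ \<sigma> i)) = vander_prod n z"
proof -
  define q where "q j = (\<Prod>l<j. [:- z l, 1:])" for j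
  have deg: "degree (q j) = j" for j
    unfolding q_def by (subst degree_prod_sum_eq) auto
  have lead: "coeff (q j) j = 1" for j
  proof -
    have "lead_coeff (q j) = 1" unfolding q_def by (simp add: lead_coeff_prod)
    then show ?thesis by (simp add: deg)
  qed
  define V where "V = mat n n (\<lambda>(i, k). z i ^ k)"
  define C where "C = mat n n (\<lambda>(k, j). coeff (q j) k)"
  have V: "V \<in> carrier_mat n n" and C: "C \<in> carrier_mat n n" by (auto simp: V_def C_def)
  have "det C = prod_list (diag_mat C)"
    by (rule det_upper_triangular[OF _ C]) (auto simp: C_def upper_triangular_def deg intro!: coeff_eq_0)
  also have "\<dots> = 1"
    unfolding prod_list_diag_prod using lead by (intro prod.neutral) (auto simp: C_def)
  finally have detC: "det C = 1" .
  have VC: "(V * C) $$ (i, j) = poly (q j) (z i)" if "i < n" "j < n" for i j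
  proof -
    have "(V * C) $$ (i, j) = (\<Sum>k<n. coeff (q j) k * z i ^ k)"
      using that by (simp add: V_def C_def scalar_prod_def lessThan_atLeast0 mult.commute)
    also have "\<dots> = poly (q j) (z i)"
      unfolding poly_altdef deg using that
      by (intro sum.mono_neutral_right) (auto intro: coeff_eq_0 simp: deg)
    finally show ?thesis .
  qed
  have "det (V * C) = prod_list (diag_mat (V * C))"
  proof (rule det_lower_triangular[OF _ mult_carrier_mat[OF V C]])
    fix i j assume "i < j" "j < n"
    then have "poly (q j) (z i) = 0" by (auto simp: q_def poly_prod)
    then show "(V * C) $$ (i, j) = 0" using VC \<open>i < j\<close> \<open>j < n\<close> by simp
  qed
  also have "\<dots> = (\<Prod>i<n. poly (q i) (z i))"
    unfolding prod_list_diag_prod using V C VC by (auto simp: lessThan_atLeast0 intro!: prod.cong)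
  also have "\<dots> = vander_prod n z" by (simp add: vander_prod_def q_def poly_prod)
  finally have "det V = vander_prod n z" using det_mult[OF V C] detC by simp
  moreover have "det V = (\<Sum>\<sigma> | \<sigma> permutes {..<n}. of_int (sign \<sigma>) * (\<Prod>i<n. z i ^ \<sigma> i))"
    unfolding det_def'[OF V] lessThan_atLeast0[symmetric]
  proof (rule sum.cong[OF refl])
    fix \<sigma> assume "\<sigma> \<in> {\<sigma>. \<sigma> permutes {..<n}}"
    then show "signof \<sigma> * (\<Prod>i<n. V $$ (i, \<sigma> i)) = of_int (sign \<sigma>) * (\<Prod>i<n. z i ^ \<sigma> i)"
      using permutes_in_image[of \<sigma> "{..<n}"] by (simp add: V_def)
  qed
  ultimately show ?thesis by simp
qed

text \<open>Laurent polynomials of bounded degree have the same mean over the torus and over a fine enough grid of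
  roots of unity; finite sums take the place of torus integrals throughout.\<close>
definition unity_roots :: "nat \<Rightarrow> complex set" where "unity_roots N = {z. z ^ N = 1}"

definition grid :: "nat \<Rightarrow> nat \<Rightarrow> (nat \<Rightarrow> complex) set" where
  "grid n N = PiE {..<n} (\<lambda>_. unity_roots N)"

text \<open>On the torus this is the squared modulus of the Vandermonde product. Written with
  quotients instead of conjugates it is visibly a Laurent polynomial.\<close>

definition weyl :: "nat \<Rightarrow> (nat \<Rightarrow> complex) \<Rightarrow> complex" where
  "weyl n z = (\<Prod>i<n. \<Prod>j\<in>{..<n}-{i}. 1 - z i / z j)"

section \<open>Character sums and Heine's identity on the grid\<close>

lemma finite_unity_roots: "N > 0 \<Longrightarrow> finite (unity_roots N)"
  unfolding unity_roots_def by (intro finite_roots_unity) simp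

lemma unity_roots_nz: "N > 0 \<Longrightarrow> x \<in> unity_roots N \<Longrightarrow> x \<noteq> 0"
  by (auto simp: unity_roots_def power_0_left)

lemma grid_nz: "N > 0 \<Longrightarrow> z \<in> grid n N \<Longrightarrow> i < n \<Longrightarrow> z i \<noteq> 0"
  using unity_roots_nz by (auto simp: grid_def)

text \<open>Multiplication by a primitive root permutes the roots and scales the sum by a factor
  other than 1. The bound on \<open>a\<close> excludes the nonzero multiples of \<open>N\<close>,
  for which the sum would not vanish.\<close>

lemma sum_unity_roots:
  assumes N: "N > 0" and a: "\<bar>a\<bar> < int N"
  shows "(\<Sum>x\<in>unity_roots N. x powi a) = (if a = 0 then of_nat N else 0)"
proof -
  have pos: "(\<Sum>x\<in>unity_roots N. x ^ b) = 0" if b: "0 < b" "b < N" for b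
  proof -
    define w where "w = cis (2 * pi / real N)"
    have bij: "bij_betw (\<lambda>k. cis (2 * pi * real k / real N)) {..<N} {z. z ^ N = 1}"
      using Complex.bij_betw_roots_unity[OF N] .
    have w: "w ^ N = 1" using N by (simp add: w_def Complex.DeMoivre)
    have "w \<noteq> 0" by (simp add: w_def)
    have "w ^ b = cis (2 * pi * real b / real N)" by (simp add: w_def Complex.DeMoivre mult_ac)
    moreover have "cis (2 * pi * real b / real N) \<noteq> cis (2 * pi * real 0 / real N)"
      using bij_betw_imp_inj_on[OF bij] b by (metis inj_onD lessThan_iff less_numeral_extra(3) order.strict_trans)
    ultimately have wb: "w ^ b \<noteq> 1" by simp
    have "(\<Sum>x\<in>unity_roots N. (w * x) ^ b) = (\<Sum>x\<in>unity_roots N. x ^ b)"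
      by (rule sum.reindex_bij_witness[of _ "\<lambda>x. x / w" "\<lambda>x. w * x"])
        (use w \<open>w \<noteq> 0\<close> in \<open>auto simp: unity_roots_def power_mult_distrib power_divide\<close>)
    then have "w ^ b * (\<Sum>x\<in>unity_roots N. x ^ b) = (\<Sum>x\<in>unity_roots N. x ^ b)"
      by (simp add: power_mult_distrib sum_distrib_left)
    then show ?thesis using wb by simp
  qed
  consider "a = 0" | "a > 0" | "a < 0" by linarith
  then show ?thesis
  proof cases
    case 1
    then show ?thesis using N card_roots_unity_eq[of N] by (simp add: unity_roots_def)
  next
    case 2
    then show ?thesis using pos[of "nat a"] a by (simp add: power_int_def)
  next
    case 3
    have "(\<Sum>x\<in>unity_roots N. x powi a) = (\<Sum>x\<in>unity_roots N. x ^ nat (- a))"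
      by (rule sum.reindex_bij_witness[of _ inverse inverse])
        (use 3 in \<open>auto simp: unity_roots_def power_int_def power_inverse\<close>)
    then show ?thesis using pos[of "nat (- a)"] 3 a by simp
  qed
qed

lemma weyl_vander_prod:
  assumes "\<And>i. i < n \<Longrightarrow> z i \<noteq> 0"
  shows "weyl n z = vander_prod n z * vander_prod n (\<lambda>i. inverse (z i))"
proof -
  have "weyl n z = (\<Prod>i<n. (\<Prod>j<i. 1 - z i / z j) * (\<Prod>j\<in>{i<..<n}. 1 - z i / z j))"
    unfolding weyl_def
  proof (rule prod.cong[OF refl])
    fix i assume "i \<in> {..<n}"
    then have split: "{..<n} - {i} = {..<i} \<union> {i<..<n}" by auto
    show "(\<Prod>j\<in>{..<n}-{i}. 1 - z i / z j) = (\<Prod>j<i. 1 - z i / z j) * (\<Prod>j\<in>{i<..<n}. 1 - z i / z j)"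
      unfolding split by (rule prod.union_disjoint) auto
  qed
  also have "\<dots> = (\<Prod>i<n. \<Prod>j<i. 1 - z i / z j) * (\<Prod>i<n. \<Prod>j\<in>{i<..<n}. 1 - z i / z j)"
    by (rule prod.distrib)
  also have "(\<Prod>i<n. \<Prod>j\<in>{i<..<n}. 1 - z i / z j) = (\<Prod>i<n. \<Prod>j<i. 1 - z j / z i)"
    unfolding prod.Sigma[OF finite_lessThan ballI[OF finite_lessThan]] prod.Sigma[OF finite_lessThan ballI[OF finite_greaterThanLessThan]]
    by (rule prod.reindex_bij_witness[of _ "\<lambda>(i, j). (j, i)" "\<lambda>(i, j). (j, i)"]) auto
  also have "(\<Prod>i<n. \<Prod>j<i. 1 - z i / z j) * (\<Prod>i<n. \<Prod>j<i. 1 - z j / z i)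
      = (\<Prod>i<n. \<Prod>j<i. (z i - z j) * (inverse (z i) - inverse (z j)))"
    unfolding prod.distrib[symmetric]
  proof (intro prod.cong refl)
    fix i j assume "i \<in> {..<n}" "j \<in> {..<i}"
    then have "z i \<noteq> 0" "z j \<noteq> 0" using assms by auto
    then show "(1 - z i / z j) * (1 - z j / z i) = (z i - z j) * (inverse (z i) - inverse (z j))"
      by (simp add: field_simps)
  qed
  finally show ?thesis by (simp add: vander_prod_def prod.distrib)
qed

text \<open>Leibniz formula for the matrix with entry \<open>c (j - i)\<close> in row
  \<open>i\<close> and column \<open>j\<close>. For \<open>n = 0\<close> it gives 1, so that blocks
  of size 0 do not disturb products.\<close>

definition toeplitz_det :: "nat \<Rightarrow> (int \<Rightarrow> complex) \<Rightarrow> complex" where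
  "toeplitz_det n c = (\<Sum>\<pi> | \<pi> permutes {..<n}. of_int (sign \<pi>) * (\<Prod>i<n. c (int (\<pi> i) - int i)))"

lemma sum_unity_roots_laurent:
  assumes N: "N > 0" and a: "\<bar>a\<bar> + int d < int N" and c: "\<And>k. \<bar>k\<bar> > int d \<Longrightarrow> c k = 0"
  shows "(\<Sum>x\<in>unity_roots N. x powi a * (\<Sum>k\<in>{- int d..int d}. c k * x powi k)) = of_nat N * c (- a)"
proof -
  have "(\<Sum>x\<in>unity_roots N. x powi a * (\<Sum>k\<in>{- int d..int d}. c k * x powi k))
      = (\<Sum>x\<in>unity_roots N. \<Sum>k\<in>{- int d..int d}. c k * x powi (a + k))"
    using unity_roots_nz[OF N] by (intro sum.cong refl) (simp add: sum_distrib_left power_int_add mult_ac)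
  also have "\<dots> = (\<Sum>k\<in>{- int d..int d}. c k * (\<Sum>x\<in>unity_roots N. x powi (a + k)))"
    by (subst sum.swap) (simp add: sum_distrib_left)
  also have "\<dots> = (\<Sum>k\<in>{- int d..int d}. if k = - a then of_nat N * c (- a) else 0)"
    using a by (intro sum.cong refl) (subst sum_unity_roots[OF N], auto)
  also have "\<dots> = of_nat N * c (- a)" using c[of "- a"] by (auto simp: not_less abs_le_iff)
  finally show ?thesis .
qed

text \<open>Expanding both Vandermonde factors over permutations splits the grid sum into
  one-variable sums, each of which picks out a coefficient of \<open>g\<close>. The ratio of the two
  permutations alone matters, whence the factor \<open>fact n\<close>. The exponents
  \<open>\<sigma> i - \<tau> i\<close> stay below \<open>n\<close> in absolute value, so
  \<open>N > n + d\<close> prevents aliasing.\<close>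

lemma heine_grid:
  assumes N: "int n + int d < int N" and c: "\<And>k. \<bar>k\<bar> > int d \<Longrightarrow> c k = 0"
  defines "g \<equiv> \<lambda>x. \<Sum>k\<in>{- int d..int d}. c k * x powi k"
  shows "(\<Sum>z\<in>grid n N. weyl n z * (\<Prod>i<n. g (z i))) = of_nat N ^ n * fact n * toeplitz_det n c"
proof -
  have N0: "N > 0" using N by simp
  let ?P = "{\<sigma>. \<sigma> permutes {..<n}}"
  have "(\<Sum>z\<in>grid n N. weyl n z * (\<Prod>i<n. g (z i)))
     = (\<Sum>z\<in>grid n N. \<Sum>\<tau>\<in>?P. \<Sum>\<sigma>\<in>?P. of_int (sign \<tau> * sign \<sigma>) * (\<Prod>i<n. z i powi (int (\<sigma> i) - int (\<tau> i)) * g (z i)))"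
  proof (rule sum.cong[OF refl])
    fix z assume z: "z \<in> grid n N"
    have nz: "z i \<noteq> 0" if "i < n" for i using grid_nz[OF N0 z that] .
    have w: "weyl n z = (\<Sum>\<sigma>\<in>?P. of_int (sign \<sigma>) * (\<Prod>i<n. z i ^ \<sigma> i)) * (\<Sum>\<tau>\<in>?P. of_int (sign \<tau>) * (\<Prod>i<n. inverse (z i) ^ \<tau> i))"
      unfolding vandermonde by (rule weyl_vander_prod[OF nz])
    have "weyl n z * (\<Prod>i<n. g (z i)) = (\<Sum>\<tau>\<in>?P. \<Sum>\<sigma>\<in>?P. of_int (sign \<sigma>) * (\<Prod>i<n. z i ^ \<sigma> i) * (of_int (sign \<tau>) * (\<Prod>i<n. inverse (z i) ^ \<tau> i)) * (\<Prod>i<n. g (z i)))"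
      unfolding w[unfolded sum_product] sum_distrib_right by (rule sum.swap)
    also have "\<dots> = (\<Sum>\<tau>\<in>?P. \<Sum>\<sigma>\<in>?P. of_int (sign \<tau> * sign \<sigma>) * (\<Prod>i<n. z i powi (int (\<sigma> i) - int (\<tau> i)) * g (z i)))"
    proof (intro sum.cong refl)
      fix \<sigma> \<tau>
      have "(\<Prod>i<n. z i powi (int (\<sigma> i) - int (\<tau> i)) * g (z i)) = (\<Prod>i<n. z i ^ \<sigma> i) * (\<Prod>i<n. inverse (z i) ^ \<tau> i) * (\<Prod>i<n. g (z i))"
        unfolding prod.distrib[symmetric] using nz
        by (intro prod.cong refl) (simp add: power_int_diff field_simps)
      then show "of_int (sign \<sigma>) * (\<Prod>i<n. z i ^ \<sigma> i) * (of_int (sign \<tau>) * (\<Prod>i<n. inverse (z i) ^ \<tau> i)) * (\<Prod>i<n. g (z i))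
          = of_int (sign \<tau> * sign \<sigma>) * (\<Prod>i<n. z i powi (int (\<sigma> i) - int (\<tau> i)) * g (z i))"
        by (simp only: of_int_mult mult_ac)
    qed
    finally show "weyl n z * (\<Prod>i<n. g (z i)) = (\<Sum>\<tau>\<in>?P. \<Sum>\<sigma>\<in>?P. of_int (sign \<tau> * sign \<sigma>) * (\<Prod>i<n. z i powi (int (\<sigma> i) - int (\<tau> i)) * g (z i)))" .
  qed
  also have "\<dots> = (\<Sum>\<tau>\<in>?P. \<Sum>\<sigma>\<in>?P. of_int (sign \<tau> * sign \<sigma>) * (\<Sum>z\<in>grid n N. \<Prod>i<n. z i powi (int (\<sigma> i) - int (\<tau> i)) * g (z i)))"
    unfolding sum_distrib_left by (subst sum.swap, rule sum.cong[OF refl], rule sum.swap)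
  also have "\<dots> = (\<Sum>\<tau>\<in>?P. \<Sum>\<sigma>\<in>?P. of_int (sign \<tau> * sign \<sigma>) * (of_nat N ^ n * (\<Prod>i<n. c (int (\<tau> i) - int (\<sigma> i)))))"
  proof (intro sum.cong refl arg_cong2[where f = "(*)"])
    fix \<sigma> \<tau> assume "\<tau> \<in> ?P" "\<sigma> \<in> ?P"
    then have lt: "\<tau> i < n" "\<sigma> i < n" if "i < n" for i
      using permutes_in_image[of \<tau> "{..<n}" i] permutes_in_image[of \<sigma> "{..<n}" i] that by auto
    have "(\<Sum>z\<in>grid n N. \<Prod>i<n. z i powi (int (\<sigma> i) - int (\<tau> i)) * g (z i))
        = (\<Prod>i<n. \<Sum>x\<in>unity_roots N. x powi (int (\<sigma> i) - int (\<tau> i)) * g x)"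
      unfolding grid_def by (rule prod_sum_PiE[symmetric]) (auto simp: finite_unity_roots[OF N0])
    also have "\<dots> = (\<Prod>i<n. of_nat N * c (int (\<tau> i) - int (\<sigma> i)))"
    proof (intro prod.cong refl)
      fix i assume "i \<in> {..<n}"
      then have "\<bar>int (\<sigma> i) - int (\<tau> i)\<bar> + int d < int N" using lt[of i] N by auto
      from sum_unity_roots_laurent[OF N0 this c]
      show "(\<Sum>x\<in>unity_roots N. x powi (int (\<sigma> i) - int (\<tau> i)) * g x) = of_nat N * c (int (\<tau> i) - int (\<sigma> i))"
        by (simp add: g_def)
    qed
    finally show "(\<Sum>z\<in>grid n N. \<Prod>i<n. z i powi (int (\<sigma> i) - int (\<tau> i)) * g (z i))
        = of_nat N ^ n * (\<Prod>i<n. c (int (\<tau> i) - int (\<sigma> i)))"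
      by (simp add: prod.distrib)
  qed
  also have "\<dots> = (\<Sum>\<sigma>\<in>?P. \<Sum>\<tau>\<in>?P. of_int (sign \<tau> * sign \<sigma>) * (of_nat N ^ n * (\<Prod>i<n. c (int (\<tau> i) - int (\<sigma> i)))))"
    by (rule sum.swap)
  also have "\<dots> = (\<Sum>\<sigma>\<in>?P. of_nat N ^ n * toeplitz_det n c)"
  proof (rule sum.cong[OF refl])
    fix \<sigma> assume "\<sigma> \<in> ?P"
    then have \<sigma>: "\<sigma> permutes {..<n}" by simp
    have "(\<Sum>\<tau>\<in>?P. of_int (sign \<tau> * sign \<sigma>) * (of_nat N ^ n * (\<Prod>i<n. c (int (\<tau> i) - int (\<sigma> i)))))
        = (\<Sum>\<pi>\<in>?P. of_int (sign (\<pi> \<circ> \<sigma>) * sign \<sigma>) * (of_nat N ^ n * (\<Prod>i<n. c (int ((\<pi> \<circ> \<sigma>) i) - int (\<sigma> i)))))"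
      by (rule sum_permutes_compose[OF \<sigma>, symmetric])
    also have "\<dots> = (\<Sum>\<pi>\<in>?P. of_nat N ^ n * (of_int (sign \<pi>) * (\<Prod>i<n. c (int (\<pi> i) - int i))))"
    proof (rule sum.cong[OF refl])
      fix \<pi> assume "\<pi> \<in> ?P"
      then have "sign (\<pi> \<circ> \<sigma>) * sign \<sigma> = sign \<pi>"
        using sign_compose[of \<pi> \<sigma>] \<sigma> by (simp add: permutes_imp_permutation[of "{..<n}"] mult.assoc sign_idempotent)
      moreover have "(\<Prod>i<n. c (int ((\<pi> \<circ> \<sigma>) i) - int (\<sigma> i))) = (\<Prod>i<n. c (int (\<pi> i) - int i))"
        using prod.permute[OF \<sigma>, of "\<lambda>i. c (int (\<pi> i) - int i)"] by (simp add: o_def)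
      ultimately show "of_int (sign (\<pi> \<circ> \<sigma>) * sign \<sigma>) * (of_nat N ^ n * (\<Prod>i<n. c (int ((\<pi> \<circ> \<sigma>) i) - int (\<sigma> i))))
         = of_nat N ^ n * (of_int (sign \<pi>) * (\<Prod>i<n. c (int (\<pi> i) - int i)))"
        by (simp only: mult_ac)
    qed
    finally show "(\<Sum>\<tau>\<in>?P. of_int (sign \<tau> * sign \<sigma>) * (of_nat N ^ n * (\<Prod>i<n. c (int (\<tau> i) - int (\<sigma> i)))))
        = of_nat N ^ n * toeplitz_det n c"
      by (simp only: toeplitz_det_def sum_distrib_left)
  qed
  finally show ?thesis by (simp add: card_permutations)
qed

lemma weyl_permute:
  assumes \<sigma>: "\<sigma> permutes {..<n}"
  shows "weyl n (z \<circ> \<sigma>) = weyl n z"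
proof -
  have "weyl n z = (\<Prod>i<n. \<Prod>j\<in>{..<n}-{\<sigma> i}. 1 - z (\<sigma> i) / z j)"
    unfolding weyl_def using prod.permute[OF \<sigma>, of "\<lambda>i. \<Prod>j\<in>{..<n}-{i}. 1 - z i / z j"] by (simp add: o_def)
  also have "\<dots> = (\<Prod>i<n. \<Prod>j\<in>{..<n}-{i}. 1 - z (\<sigma> i) / z (\<sigma> j))"
  proof (rule prod.cong[OF refl])
    fix i assume "i \<in> {..<n}"
    then have "bij_betw \<sigma> ({..<n}-{i}) ({..<n}-{\<sigma> i})"
      using permutes_imp_bij[OF \<sigma>] permutes_in_image[OF \<sigma>, of i] by (intro bij_betw_DiffI) auto
    from prod.reindex_bij_betw[OF this, of "\<lambda>j. 1 - z (\<sigma> i) / z j"]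
    show "(\<Prod>j\<in>{..<n}-{\<sigma> i}. 1 - z (\<sigma> i) / z j) = (\<Prod>j\<in>{..<n}-{i}. 1 - z (\<sigma> i) / z (\<sigma> j))" by simp
  qed
  finally show ?thesis by (simp add: weyl_def)
qed

lemma sum_grid_transpose:
  assumes "i < n" "j < n"
  shows "(\<Sum>z\<in>grid n N. f (z \<circ> transposition i j)) = (\<Sum>z\<in>grid n N. f z)"
proof -
  let ?t = "transposition i j"
  have "z \<circ> ?t \<in> grid n N" if z: "z \<in> grid n N" for z
    using z assms unfolding grid_def PiE_def extensional_def Pi_def
    by (auto simp: Transposition.transpose_def)
  then show ?thesis
    by (intro sum.reindex_bij_witness[of _ "\<lambda>z. z \<circ> ?t" "\<lambda>z. z \<circ> ?t"]) (auto simp: comp_assoc)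
qed

section \<open>Summation by parts on roots of unity\<close>

text \<open>The summand is the Euler operator \<open>x d/dx\<close> applied to
  \<open>x powi e * poly P x\<close>. It kills the exponent 0, and every other exponent that occurs
  is too small to be a multiple of \<open>N\<close>.\<close>

lemma sum_unity_roots_euler:
  assumes N: "N > 0" and P: "\<bar>e\<bar> < int N" "\<bar>e + int (degree P)\<bar> < int N"
  shows "(\<Sum>x\<in>unity_roots N. x powi e * (of_int e * poly P x + x * poly (pderiv P) x)) = 0"
proof -
  have "x powi e * (of_int e * poly P x + x * poly (pderiv P) x)
      = (\<Sum>l\<le>degree P. coeff P l * of_int (e + int l) * x powi (e + int l))" if "x \<noteq> 0" for x
  proof -
    have "x * poly (pderiv P) x = (\<Sum>l\<le>degree P. coeff P l * of_nat l * x ^ l)"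
    proof -
      have "poly (pderiv P) x = (\<Sum>l\<le>degree P. poly (pderiv (monom (coeff P l) l)) x)"
        by (subst (1) poly_as_sum_of_monoms[of P, symmetric]) (simp only: pderiv_sum poly_sum)
      moreover have "x * poly (pderiv (monom (coeff P l) l)) x = coeff P l * of_nat l * x ^ l" for l
        by (cases l) (simp_all add: pderiv_monom poly_monom)
      ultimately show ?thesis by (simp only: sum_distrib_left)
    qed
    moreover have "of_int e * poly P x = (\<Sum>l\<le>degree P. coeff P l * of_int e * x ^ l)"
      unfolding poly_altdef sum_distrib_left by (rule sum.cong[OF refl]) (simp only: mult_ac)
    ultimately have "of_int e * poly P x + x * poly (pderiv P) x = (\<Sum>l\<le>degree P. coeff P l * of_int (e + int l) * x ^ l)"
      unfolding sum.distrib[symmetric] by (simp add: algebra_simps)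
    then show ?thesis
      unfolding sum_distrib_left using that by (simp add: sum_distrib_left power_int_add mult_ac)
  qed
  then have "(\<Sum>x\<in>unity_roots N. x powi e * (of_int e * poly P x + x * poly (pderiv P) x))
     = (\<Sum>x\<in>unity_roots N. \<Sum>l\<le>degree P. coeff P l * of_int (e + int l) * x powi (e + int l))"
    using unity_roots_nz[OF N] by (intro sum.cong refl) auto
  also have "\<dots> = (\<Sum>l\<le>degree P. coeff P l * (of_int (e + int l) * (\<Sum>x\<in>unity_roots N. x powi (e + int l))))"
    by (subst sum.swap) (simp add: sum_distrib_left mult.assoc)
  also have "\<dots> = 0"
  proof (rule sum.neutral, rule ballI)
    fix l assume "l \<in> {..degree P}"
    then have "\<bar>e + int l\<bar> < int N" using P by auto
    from sum_unity_roots[OF N this]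
    show "coeff P l * (of_int (e + int l) * (\<Sum>x\<in>unity_roots N. x powi (e + int l))) = 0"
      by (cases "e + int l = 0") (simp_all only: of_int_0 mult_zero_left mult_zero_right if_False)
  qed
  finally show ?thesis .
qed

text \<open>Logarithmic derivative. With division by zero giving zero it also holds at
  \<open>x = y j\<close>: the root is double, so both sides vanish.\<close>

lemma pderiv_prod_squares:
  fixes y :: "'a \<Rightarrow> complex"
  assumes "finite S"
  shows "poly (pderiv (\<Prod>j\<in>S. [:- y j, 1:]\<^sup>2)) x = poly (\<Prod>j\<in>S. [:- y j, 1:]\<^sup>2) x * (\<Sum>j\<in>S. 2 / (x - y j))"
  using assms
proof (induction S rule: finite_induct)
  case (insert i S)
  define Q where "Q = (\<Prod>j\<in>S. [:- y j, 1:]\<^sup>2)"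
  have q: "poly (pderiv ([:- y i, 1:]\<^sup>2)) x = 2 * (x - y i)"
    by (simp add: power2_eq_square pderiv_mult pderiv_pCons)
  have "poly (pderiv ([:- y i, 1:]\<^sup>2 * Q)) x = (x - y i)\<^sup>2 * poly (pderiv Q) x + poly Q x * (2 * (x - y i))"
    unfolding pderiv_mult poly_add poly_mult q by simp
  moreover have "2 * (x - y i) = (x - y i)\<^sup>2 * (2 / (x - y i))" by (simp add: power2_eq_square)
  ultimately have "poly (pderiv ([:- y i, 1:]\<^sup>2 * Q)) x = (x - y i)\<^sup>2 * poly Q x * (2 / (x - y i) + (\<Sum>j\<in>S. 2 / (x - y j)))"
    using insert.IH by (simp only: Q_def[symmetric] distrib_left mult_ac add_ac)
  then show ?case using insert.hyps by (simp add: Q_def[symmetric])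
qed simp

text \<open>The product is a constant times \<open>x powi (- card S) * poly P x\<close>, where
  \<open>P\<close> has the double roots \<open>y j\<close>, and
  \<open>(x + y) / (x - y) = x * (2 / (x - y)) - 1\<close> away from \<open>y\<close>. So the
  summand is an Euler derivative with exponents from \<open>a - card S\<close> to
  \<open>a + card S\<close>.\<close>

lemma sum_unity_roots_pairs:
  assumes N: "N > 0" and S: "finite S" and y: "\<And>j. j \<in> S \<Longrightarrow> y j \<noteq> 0" and a: "\<bar>a\<bar> + int (card S) < int N"
  shows "(\<Sum>x\<in>unity_roots N. (\<Prod>j\<in>S. (1 - x / y j) * (1 - y j / x)) * x powi a *
           (of_int a + (\<Sum>j\<in>S. (x + y j) / (x - y j)))) = 0"
proof -
  define P where "P = (\<Prod>j\<in>S. [:- y j, 1:]\<^sup>2)"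
  define C where "C = (\<Prod>j\<in>S. - inverse (y j))"
  have deg: "degree P = 2 * card S"
    unfolding P_def by (subst degree_prod_sum_eq) (auto simp: degree_power_eq)
  have polyP: "poly P x = (\<Prod>j\<in>S. (x - y j)\<^sup>2)" for x by (simp add: P_def poly_prod)
  define e where "e = a - int (card S)"
  have "(\<Prod>j\<in>S. (1 - x / y j) * (1 - y j / x)) * x powi a * (of_int a + (\<Sum>j\<in>S. (x + y j) / (x - y j)))
      = C * (x powi e * (of_int e * poly P x + x * poly (pderiv P) x))" if x: "x \<noteq> 0" for x
  proof -
    have "(\<Prod>j\<in>S. (1 - x / y j) * (1 - y j / x)) = (\<Prod>j\<in>S. - inverse (y j) * (x - y j)\<^sup>2 * inverse x)"
      using x y by (intro prod.cong refl) (simp add: field_simps power2_eq_square)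
    also have "\<dots> = C * poly P x * x powi (- int (card S))"
      unfolding prod.distrib C_def polyP by (simp add: power_int_minus power_inverse)
    finally have 1: "(\<Prod>j\<in>S. (1 - x / y j) * (1 - y j / x)) = C * poly P x * x powi (- int (card S))" .
    have 2: "x powi e = x powi (- int (card S)) * x powi a"
      using x by (simp add: e_def power_int_add[symmetric])
    have 3: "poly P x * (of_int a + (\<Sum>j\<in>S. (x + y j) / (x - y j))) = of_int e * poly P x + x * poly (pderiv P) x"
    proof (cases "\<exists>j\<in>S. x = y j")
      case True
      then have "poly P x = 0" using S by (auto simp: polyP)
      then show ?thesis using pderiv_prod_squares[OF S, of y x] by (simp add: P_def)
    next
      case False
      have "(\<Sum>j\<in>S. (x + y j) / (x - y j)) = (\<Sum>j\<in>S. x * (2 / (x - y j)) - 1)"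
        using False by (intro sum.cong refl) (auto simp: field_simps)
      then have sm: "(\<Sum>j\<in>S. (x + y j) / (x - y j)) = x * (\<Sum>j\<in>S. 2 / (x - y j)) - of_nat (card S)"
        by (simp add: sum_subtractf sum_distrib_left)
      have pd: "poly (pderiv P) x = poly P x * (\<Sum>j\<in>S. 2 / (x - y j))"
        using pderiv_prod_squares[OF S, of y x] by (simp add: P_def)
      show ?thesis unfolding sm pd by (simp add: e_def algebra_simps)
    qed
    show ?thesis unfolding 1 2 3[symmetric] by (simp only: mult_ac)
  qed
  then have "(\<Sum>x\<in>unity_roots N. (\<Prod>j\<in>S. (1 - x / y j) * (1 - y j / x)) * x powi a * (of_int a + (\<Sum>j\<in>S. (x + y j) / (x - y j))))
      = C * (\<Sum>x\<in>unity_roots N. x powi e * (of_int e * poly P x + x * poly (pderiv P) x))"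
    unfolding sum_distrib_left using unity_roots_nz[OF N] by (intro sum.cong refl) auto
  also have "(\<Sum>x\<in>unity_roots N. x powi e * (of_int e * poly P x + x * poly (pderiv P) x)) = 0"
    by (rule sum_unity_roots_euler[OF N]) (use a deg in \<open>auto simp: e_def\<close>)
  finally show ?thesis by simp
qed

lemma sum_grid_insert:
  assumes n: "n \<ge> 1"
  shows "(\<Sum>z\<in>grid n N. f z) = (\<Sum>y\<in>PiE {1..<n} (\<lambda>_. unity_roots N). \<Sum>x\<in>unity_roots N. f (y(0 := x)))"
proof -
  have *: "{..<n} = insert 0 {1..<n}" using n by auto
  have "grid n N = (\<lambda>(x, y). y(0 := x)) ` (unity_roots N \<times> PiE {1..<n} (\<lambda>_. unity_roots N))"
    unfolding grid_def * PiE_insert_eq ..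
  then have "(\<Sum>z\<in>grid n N. f z) = (\<Sum>(x, y)\<in>unity_roots N \<times> PiE {1..<n} (\<lambda>_. unity_roots N). f (y(0 := x)))"
    using sum.reindex[OF inj_combinator[of 0 "{1..<n}" "\<lambda>_. unity_roots N"], of f]
    by (simp only: o_def case_prod_unfold atLeastLessThan_iff not_one_le_zero simp_thms if_True)
  also have "\<dots> = (\<Sum>x\<in>unity_roots N. \<Sum>y\<in>PiE {1..<n} (\<lambda>_. unity_roots N). f (y(0 := x)))"
    by (rule sum.cartesian_product[symmetric])
  finally show ?thesis by (subst sum.swap)
qed

text \<open>With all variables but the first frozen, the density is a constant times the product
  over \<open>j\<close> of \<open>(1 - x / y j) * (1 - y j / x)\<close>, which reduces the claim to
  one variable with \<open>n - 1\<close> points \<open>y j\<close>.\<close>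

lemma grid_integration_by_parts:
  assumes n: "n \<ge> 1" and k: "\<bar>k 0\<bar> + int n \<le> int N"
  shows "(\<Sum>z\<in>grid n N. weyl n z * zmon n k z * (of_int (k 0) + (\<Sum>j\<in>{1..<n}. (z 0 + z j) / (z 0 - z j)))) = 0"
proof -
  have N: "N > 0" using n k by auto
  show ?thesis
    unfolding sum_grid_insert[OF n]
  proof (rule sum.neutral, rule ballI)
    fix y assume y: "y \<in> PiE {1..<n} (\<lambda>_. unity_roots N)"
    have ynz: "y j \<noteq> 0" if "j \<in> {1..<n}" for j
      using PiE_mem[OF y that] unity_roots_nz[OF N] by auto
    have ins: "{..<n} = insert 0 {1..<n}" using n by auto
    define C where "C = (\<Prod>i\<in>{1..<n}. \<Prod>j\<in>{1..<n}-{i}. 1 - y i / y j) * (\<Prod>i\<in>{1..<n}. y i powi k i)"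
    have "weyl n (y(0 := x)) * zmon n k (y(0 := x)) = C * ((\<Prod>j\<in>{1..<n}. (1 - x / y j) * (1 - y j / x)) * x powi k 0)" for x
    proof -
      have "weyl n (y(0 := x)) = (\<Prod>j\<in>{..<n}-{0}. 1 - x / (y(0 := x)) j) * (\<Prod>i\<in>{1..<n}. \<Prod>j\<in>{..<n}-{i}. 1 - (y(0 := x)) i / (y(0 := x)) j)"
        unfolding weyl_def ins by (subst prod.insert) auto
      also have "(\<Prod>j\<in>{..<n}-{0}. 1 - x / (y(0 := x)) j) = (\<Prod>j\<in>{1..<n}. 1 - x / y j)"
        by (intro prod.cong) auto
      also have "(\<Prod>i\<in>{1..<n}. \<Prod>j\<in>{..<n}-{i}. 1 - (y(0 := x)) i / (y(0 := x)) j)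
          = (\<Prod>i\<in>{1..<n}. (1 - y i / x) * (\<Prod>j\<in>{1..<n}-{i}. 1 - y i / y j))"
      proof (rule prod.cong[OF refl])
        fix i assume i: "i \<in> {1..<n}"
        then have "{..<n} - {i} = insert 0 ({1..<n} - {i})" by auto
        then have "(\<Prod>j\<in>{..<n}-{i}. 1 - (y(0 := x)) i / (y(0 := x)) j) = (1 - y i / x) * (\<Prod>j\<in>{1..<n}-{i}. 1 - (y(0 := x)) i / (y(0 := x)) j)"
          using i by simp
        also have "(\<Prod>j\<in>{1..<n}-{i}. 1 - (y(0 := x)) i / (y(0 := x)) j) = (\<Prod>j\<in>{1..<n}-{i}. 1 - y i / y j)"
          using i by (intro prod.cong) auto
        finally show "(\<Prod>j\<in>{..<n}-{i}. 1 - (y(0 := x)) i / (y(0 := x)) j) = (1 - y i / x) * (\<Prod>j\<in>{1..<n}-{i}. 1 - y i / y j)" .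
      qed
      finally have 1: "weyl n (y(0 := x)) = (\<Prod>j\<in>{1..<n}. (1 - x / y j) * (1 - y j / x)) * (\<Prod>i\<in>{1..<n}. \<Prod>j\<in>{1..<n}-{i}. 1 - y i / y j)"
        by (simp only: prod.distrib mult.assoc)
      have "zmon n k (y(0 := x)) = x powi k 0 * (\<Prod>i\<in>{1..<n}. (y(0 := x)) i powi k i)"
        unfolding zmon_def ins by (subst prod.insert) auto
      also have "(\<Prod>i\<in>{1..<n}. (y(0 := x)) i powi k i) = (\<Prod>i\<in>{1..<n}. y i powi k i)"
        by (intro prod.cong) auto
      finally show ?thesis unfolding 1 C_def by (simp only: mult_ac)
    qed
    moreover have "(\<Sum>j\<in>{1..<n}. ((y(0 := x)) 0 + (y(0 := x)) j) / ((y(0 := x)) 0 - (y(0 := x)) j)) = (\<Sum>j\<in>{1..<n}. (x + y j) / (x - y j))" for x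
      by (intro sum.cong) auto
    ultimately have "(\<Sum>x\<in>unity_roots N. weyl n (y(0 := x)) * zmon n k (y(0 := x)) *
         (of_int (k 0) + (\<Sum>j\<in>{1..<n}. ((y(0 := x)) 0 + (y(0 := x)) j) / ((y(0 := x)) 0 - (y(0 := x)) j))))
       = C * (\<Sum>x\<in>unity_roots N. (\<Prod>j\<in>{1..<n}. (1 - x / y j) * (1 - y j / x)) * x powi k 0 *
           (of_int (k 0) + (\<Sum>j\<in>{1..<n}. (x + y j) / (x - y j))))"
      by (simp only: sum_distrib_left mult.assoc)
    also have "(\<Sum>x\<in>unity_roots N. (\<Prod>j\<in>{1..<n}. (1 - x / y j) * (1 - y j / x)) * x powi k 0 *
           (of_int (k 0) + (\<Sum>j\<in>{1..<n}. (x + y j) / (x - y j)))) = 0"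
      by (rule sum_unity_roots_pairs[OF N]) (use ynz n k in auto)
    finally show "(\<Sum>x\<in>unity_roots N. weyl n (y(0 := x)) * zmon n k (y(0 := x)) *
         (of_int (k 0) + (\<Sum>j\<in>{1..<n}. ((y(0 := x)) 0 + (y(0 := x)) j) / ((y(0 := x)) 0 - (y(0 := x)) j)))) = 0"
      by (simp only: mult_zero_right)
  qed
qed

lemma weyl_eq_0:
  assumes "i < n" "j < n" "i \<noteq> j" "z i = z j" "z j \<noteq> 0"
  shows "weyl n z = 0"
proof -
  have "\<exists>q\<in>{..<n}-{i}. 1 - z i / z q = 0" using assms by (intro bexI[of _ j]) simp_all
  then have "(\<Prod>q\<in>{..<n}-{i}. 1 - z i / z q) = 0" by (intro prod_zero) auto
  then have "\<exists>i\<in>{..<n}. (\<Prod>q\<in>{..<n}-{i}. 1 - z i / z q) = 0" using assms(1) by blast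
  then show ?thesis unfolding weyl_def by (intro prod_zero) auto
qed

text \<open>The density is symmetric and the kernel \<open>(z 0 + z j) / (z 0 - z j)\<close>
  antisymmetric. Under the sum the two halves of the antisymmetrised term therefore agree and add up
  to the plain logarithmic derivative. Where \<open>z 0 = z j\<close> the density is zero.\<close>

lemma grid_dunkl_mon:
  assumes n: "n \<ge> 1" and k: "\<bar>k 0\<bar> + int n \<le> int N"
  shows "(\<Sum>z\<in>grid n N. weyl n z * dunkl_mon n k z) = 0"
proof -
  have N: "N > 0" using n k by auto
  have pair: "(\<Sum>z\<in>grid n N. weyl n z * (dunkl (k 0) (k j) (z 0) (z j) * (\<Prod>l\<in>{1..<n}-{j}. z l powi k l)))
     = (\<Sum>z\<in>grid n N. weyl n z * zmon n k z * ((z 0 + z j) / (z 0 - z j)))" if j: "j \<in> {1..<n}" for j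
  proof -
    let ?t = "transposition 0 j"
    have half: "a / 2 + a / 2 = a" for a :: complex by simp
    define F where "F z = weyl n z * ((z 0 + z j) / (z 0 - z j)) * zmon n k z / 2" for z
    have t: "?t permutes {..<n}" using j by (intro permutes_swap_id) auto
    have "weyl n z * (dunkl (k 0) (k j) (z 0) (z j) * (\<Prod>l\<in>{1..<n}-{j}. z l powi k l)) = F z + F (z \<circ> ?t)"
      if z: "z \<in> grid n N" for z
    proof (cases "z 0 = z j")
      case True
      then have "weyl n z = 0" using j n grid_nz[OF N z] by (intro weyl_eq_0[of 0 n j]) auto
      then show ?thesis using True by (simp add: F_def weyl_permute[OF t])
    next
      case False
      define S where "S = {1..<n} - {j}"
      have S: "{..<n} = insert 0 (insert j S)" "finite S" "0 \<notin> S" "j \<notin> S" "j \<noteq> 0"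
        using j by (auto simp: S_def)
      have 1: "zmon n k z = z 0 powi k 0 * z j powi k j * (\<Prod>l\<in>S. z l powi k l)"
        unfolding zmon_def S(1) using S(2-) by simp
      have "(\<Prod>l\<in>S. (z \<circ> ?t) l powi k l) = (\<Prod>l\<in>S. z l powi k l)"
        using S by (intro prod.cong) (auto simp: Transposition.transpose_def)
      then have 2: "zmon n k (z \<circ> ?t) = z j powi k 0 * z 0 powi k j * (\<Prod>l\<in>S. z l powi k l)"
        unfolding zmon_def S(1) using S(2-) by simp
      define c where "c = (z 0 + z j) / (z 0 - z j)"
      have "(z j + z 0) / (z j - z 0) = - c"
        using False by (simp add: c_def field_simps)
      then have 3: "F (z \<circ> ?t) = - (weyl n z * c * zmon n k (z \<circ> ?t) / 2)"
        unfolding F_def weyl_permute[OF t] by simp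
      have 4: "F z = weyl n z * c * zmon n k z / 2" by (simp add: F_def c_def)
      have 5: "dunkl (k 0) (k j) (z 0) (z j) = c / 2 * (z 0 powi k 0 * z j powi k j - z 0 powi k j * z j powi k 0)"
        using False by (simp add: dunkl_def c_def)
      show ?thesis
        unfolding 3 4 5 1 2 S_def[symmetric] by (simp add: algebra_simps diff_divide_distrib)
    qed
    then have "(\<Sum>z\<in>grid n N. weyl n z * (dunkl (k 0) (k j) (z 0) (z j) * (\<Prod>l\<in>{1..<n}-{j}. z l powi k l)))
        = (\<Sum>z\<in>grid n N. F z) + (\<Sum>z\<in>grid n N. F (z \<circ> ?t))"
      by (simp add: sum.distrib)
    also have "(\<Sum>z\<in>grid n N. F (z \<circ> ?t)) = (\<Sum>z\<in>grid n N. F z)"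
      using j by (intro sum_grid_transpose) auto
    also have "(\<Sum>z\<in>grid n N. F z) + (\<Sum>z\<in>grid n N. F z) = (\<Sum>z\<in>grid n N. weyl n z * zmon n k z * ((z 0 + z j) / (z 0 - z j)))"
      unfolding sum.distrib[symmetric] F_def by (rule sum.cong[OF refl]) (simp only: half mult_ac)
    finally show ?thesis .
  qed
  have "(\<Sum>z\<in>grid n N. weyl n z * dunkl_mon n k z) = (\<Sum>z\<in>grid n N. weyl n z * zmon n k z * of_int (k 0))
     + (\<Sum>j\<in>{1..<n}. \<Sum>z\<in>grid n N. weyl n z * (dunkl (k 0) (k j) (z 0) (z j) * (\<Prod>l\<in>{1..<n}-{j}. z l powi k l)))"
    unfolding dunkl_mon_def by (subst sum.swap) (simp add: distrib_left sum.distrib sum_distrib_left mult_ac)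
  also have "(\<Sum>j\<in>{1..<n}. \<Sum>z\<in>grid n N. weyl n z * (dunkl (k 0) (k j) (z 0) (z j) * (\<Prod>l\<in>{1..<n}-{j}. z l powi k l)))
      = (\<Sum>j\<in>{1..<n}. \<Sum>z\<in>grid n N. weyl n z * zmon n k z * ((z 0 + z j) / (z 0 - z j)))"
    by (rule sum.cong[OF refl pair])
  also have "(\<Sum>z\<in>grid n N. weyl n z * zmon n k z * of_int (k 0)) + \<dots>
      = (\<Sum>z\<in>grid n N. weyl n z * zmon n k z * (of_int (k 0) + (\<Sum>j\<in>{1..<n}. (z 0 + z j) / (z 0 - z j))))"
    by (subst sum.swap) (simp only: distrib_left sum.distrib sum_distrib_left)
  also have "\<dots> = 0" by (rule grid_integration_by_parts[of n k N, OF n k])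
  finally show ?thesis .
qed

subsection \<open>Schwinger--Dyson equations for Haar measure\<close>

text \<open>\<open>F'\<close> is the derivative of \<open>F (T t u)\<close> at \<open>t = 0\<close>, with a quadratic error that is uniform in \<open>u\<close>; the
  uniformity allows differentiation under the integral without a dominated convergence argument.\<close>
definition unif_expansion ::
  "'u set \<Rightarrow> (real \<Rightarrow> 'u \<Rightarrow> 'u) \<Rightarrow> ('u \<Rightarrow> complex) \<Rightarrow> ('u \<Rightarrow> complex) \<Rightarrow> bool" where
  "unif_expansion S T F F' \<longleftrightarrow> (\<exists>C\<ge>0. \<forall>u\<in>S. norm (F u) \<le> C \<and> norm (F' u) \<le> C \<and>
     (\<forall>t. \<bar>t\<bar> \<le> 1 \<longrightarrow> norm (F (T t u) - F u - of_real t * F' u) \<le> C * t\<^sup>2))"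

lemma unif_expansionI:
  assumes "C \<ge> 0" "\<And>u. u \<in> S \<Longrightarrow> norm (F u) \<le> C" "\<And>u. u \<in> S \<Longrightarrow> norm (F' u) \<le> C"
    "\<And>u t. u \<in> S \<Longrightarrow> \<bar>t\<bar> \<le> 1 \<Longrightarrow> norm (F (T t u) - F u - of_real t * F' u) \<le> C * t\<^sup>2"
  shows "unif_expansion S T F F'"
  unfolding unif_expansion_def using assms by blast

lemma unif_expansionE:
  assumes "unif_expansion S T F F'"
  obtains C where "C \<ge> 0" "\<And>u. u \<in> S \<Longrightarrow> norm (F u) \<le> C" "\<And>u. u \<in> S \<Longrightarrow> norm (F' u) \<le> C"
    "\<And>u t. u \<in> S \<Longrightarrow> \<bar>t\<bar> \<le> 1 \<Longrightarrow> norm (F (T t u) - F u - of_real t * F' u) \<le> C * t\<^sup>2"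
  using assms unfolding unif_expansion_def by blast

lemma unif_expansion_const: "unif_expansion S T (\<lambda>_. c) (\<lambda>_. 0)"
  by (rule unif_expansionI[of "norm c"]) auto

lemma unif_expansion_add:
  assumes "unif_expansion S T F F'" "unif_expansion S T G G'"
  shows "unif_expansion S T (\<lambda>u. F u + G u) (\<lambda>u. F' u + G' u)"
proof -
  from assms(1) obtain C where C: "C \<ge> 0" "\<And>u. u \<in> S \<Longrightarrow> norm (F u) \<le> C" "\<And>u. u \<in> S \<Longrightarrow> norm (F' u) \<le> C"
    "\<And>u t. u \<in> S \<Longrightarrow> \<bar>t\<bar> \<le> 1 \<Longrightarrow> norm (F (T t u) - F u - of_real t * F' u) \<le> C * t\<^sup>2"
    by (rule unif_expansionE) blast
  from assms(2) obtain D where D: "D \<ge> 0" "\<And>u. u \<in> S \<Longrightarrow> norm (G u) \<le> D" "\<And>u. u \<in> S \<Longrightarrow> norm (G' u) \<le> D"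
    "\<And>u t. u \<in> S \<Longrightarrow> \<bar>t\<bar> \<le> 1 \<Longrightarrow> norm (G (T t u) - G u - of_real t * G' u) \<le> D * t\<^sup>2"
    by (rule unif_expansionE) blast
  show ?thesis
  proof (rule unif_expansionI[of "C + D"])
    fix u t assume u: "u \<in> S" and t: "\<bar>t::real\<bar> \<le> 1"
    have eq: "F (T t u) + G (T t u) - (F u + G u) - of_real t * (F' u + G' u)
        = (F (T t u) - F u - of_real t * F' u) + (G (T t u) - G u - of_real t * G' u)"
      by (simp add: algebra_simps)
    show "norm (F (T t u) + G (T t u) - (F u + G u) - of_real t * (F' u + G' u)) \<le> (C + D) * t\<^sup>2"
      unfolding eq distrib_right by (rule norm_triangle_mono[OF C(4)[OF u t] D(4)[OF u t]])
  next
    fix u assume u: "u \<in> S"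
    show "norm (F u + G u) \<le> C + D" by (rule norm_triangle_mono[OF C(2)[OF u] D(2)[OF u]])
    show "norm (F' u + G' u) \<le> C + D" by (rule norm_triangle_mono[OF C(3)[OF u] D(3)[OF u]])
  qed (use C(1) D(1) in simp)
qed

text \<open>The error splits into four products, each at most \<open>C * D * t\<^sup>2\<close>. One
  of them contains \<open>G\<close> at the moved point \<open>T t u\<close>, so \<open>T\<close> has
  to preserve \<open>S\<close>.\<close>

lemma unif_expansion_mult:
  assumes "unif_expansion S T F F'" "unif_expansion S T G G'"
    and T: "\<And>t u. u \<in> S \<Longrightarrow> T t u \<in> S"
  shows "unif_expansion S T (\<lambda>u. F u * G u) (\<lambda>u. F' u * G u + F u * G' u)"
proof -
  from assms(1) obtain C where C: "C \<ge> 0" "\<And>u. u \<in> S \<Longrightarrow> norm (F u) \<le> C" "\<And>u. u \<in> S \<Longrightarrow> norm (F' u) \<le> C"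
    "\<And>u t. u \<in> S \<Longrightarrow> \<bar>t\<bar> \<le> 1 \<Longrightarrow> norm (F (T t u) - F u - of_real t * F' u) \<le> C * t\<^sup>2"
    by (rule unif_expansionE) blast
  from assms(2) obtain D where D: "D \<ge> 0" "\<And>u. u \<in> S \<Longrightarrow> norm (G u) \<le> D" "\<And>u. u \<in> S \<Longrightarrow> norm (G' u) \<le> D"
    "\<And>u t. u \<in> S \<Longrightarrow> \<bar>t\<bar> \<le> 1 \<Longrightarrow> norm (G (T t u) - G u - of_real t * G' u) \<le> D * t\<^sup>2"
    by (rule unif_expansionE) blast
  have CD: "C * D \<ge> 0" using C D by simp
  show ?thesis
  proof (rule unif_expansionI[of "4 * (C * D)"])
    fix u assume u: "u \<in> S"
    have a: "norm (F u * G u) \<le> C * D" "norm (F' u * G u) \<le> C * D" "norm (F u * G' u) \<le> C * D"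
      unfolding norm_mult using C D u by (auto intro!: mult_mono)
    show "norm (F u * G u) \<le> 4 * (C * D)" using a CD by linarith
    show "norm (F' u * G u + F u * G' u) \<le> 4 * (C * D)"
      using norm_triangle_mono[OF a(2,3)] CD by linarith
    fix t :: real assume t: "\<bar>t\<bar> \<le> 1"
    define r where "r = F (T t u) - F u - of_real t * F' u"
    define s where "s = G (T t u) - G u - of_real t * G' u"
    have r: "norm r \<le> C * t\<^sup>2" and s: "norm s \<le> D * t\<^sup>2" using C(4)[OF u t] D(4)[OF u t] by (auto simp: r_def s_def)
    have eq: "F (T t u) * G (T t u) - F u * G u - of_real t * (F' u * G u + F u * G' u)
       = r * G (T t u) + F u * s + of_real t * F' u * s + of_real t ^ 2 * (F' u * G' u)"
      unfolding r_def s_def by (simp add: algebra_simps power2_eq_square)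
    have 1: "norm (r * G (T t u)) \<le> (C * t\<^sup>2) * D"
      unfolding norm_mult using r C D T[OF u] by (intro mult_mono) auto
    have 2: "norm (F u * s) \<le> C * (D * t\<^sup>2)"
      unfolding norm_mult using s C D u by (intro mult_mono) auto
    have 3: "norm (of_real t * F' u * s) \<le> (1 * C) * (D * t\<^sup>2)"
      unfolding norm_mult norm_of_real using s C D u t by (intro mult_mono) auto
    have 4: "norm (of_real t ^ 2 * (F' u * G' u)) \<le> t\<^sup>2 * (C * D)"
      unfolding norm_mult norm_power norm_of_real power2_abs using C D u by (intro mult_mono) auto
    show "norm (F (T t u) * G (T t u) - F u * G u - of_real t * (F' u * G u + F u * G' u)) \<le> 4 * (C * D) * t\<^sup>2"
      unfolding eq using norm_triangle_mono[OF norm_triangle_mono[OF norm_triangle_mono[OF 1 2] 3] 4]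
      by (simp add: algebra_simps)
  qed (use CD in auto)
qed

lemma unif_expansion_cnj:
  assumes "unif_expansion S T F F'"
  shows "unif_expansion S T (\<lambda>u. cnj (F u)) (\<lambda>u. cnj (F' u))"
proof -
  have "norm (cnj (F (T t u)) - cnj (F u) - of_real t * cnj (F' u)) = norm (F (T t u) - F u - of_real t * F' u)" for t u
    by (metis complex_cnj_complex_of_real complex_cnj_diff complex_cnj_mult complex_mod_cnj)
  then show ?thesis using assms unfolding unif_expansion_def by simp
qed

text \<open>Invariance cancels the terms of order zero in \<open>t\<close>, so \<open>t\<close>
  times the norm of the integral of \<open>F'\<close> is at most \<open>C * t\<^sup>2\<close>; small
  \<open>t\<close> then forces this integral to vanish.\<close>

lemma unif_expansion_integral_0:
  fixes \<mu> :: "'u measure"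
  assumes "prob_space \<mu>" and exp: "unif_expansion (space \<mu>) T F F'"
    and T: "\<And>t u. u \<in> space \<mu> \<Longrightarrow> T t u \<in> space \<mu>"
    and F: "F \<in> borel_measurable \<mu>" and F': "F' \<in> borel_measurable \<mu>"
    and FT: "\<And>t. (\<lambda>u. F (T t u)) \<in> borel_measurable \<mu>"
    and inv: "\<And>t. (\<integral>u. F (T t u) \<partial>\<mu>) = (\<integral>u. F u \<partial>\<mu>)"
  shows "(\<integral>u. F' u \<partial>\<mu>) = 0"
proof -
  interpret prob_space \<mu> by fact
  from exp obtain C where C: "C \<ge> 0" "\<And>u. u \<in> space \<mu> \<Longrightarrow> norm (F u) \<le> C" "\<And>u. u \<in> space \<mu> \<Longrightarrow> norm (F' u) \<le> C"
    "\<And>u t. u \<in> space \<mu> \<Longrightarrow> \<bar>t\<bar> \<le> 1 \<Longrightarrow> norm (F (T t u) - F u - of_real t * F' u) \<le> C * t\<^sup>2"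
    by (rule unif_expansionE) blast
  have iF: "integrable \<mu> F" and iF': "integrable \<mu> F'"
    by (rule integrable_const_bound[of _ C]; use C F F' in auto)+
  have iFT: "integrable \<mu> (\<lambda>u. F (T t u))" for t
    by (rule integrable_const_bound[of _ C]; use C(2)[OF T] FT in auto)
  have bd: "\<bar>t\<bar> * norm (\<integral>u. F' u \<partial>\<mu>) \<le> C * t\<^sup>2" if t: "\<bar>t\<bar> \<le> 1" for t
  proof -
    have "of_real t * (\<integral>u. F' u \<partial>\<mu>) = - (\<integral>u. F (T t u) - F u - of_real t * F' u \<partial>\<mu>)"
      using iF iF' iFT inv by simp
    moreover have "norm (\<integral>u. F (T t u) - F u - of_real t * F' u \<partial>\<mu>) \<le> C * t\<^sup>2"
    proof -
      have "norm (\<integral>u. F (T t u) - F u - of_real t * F' u \<partial>\<mu>) \<le> (\<integral>u. norm (F (T t u) - F u - of_real t * F' u) \<partial>\<mu>)"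
        by simp
      also have "\<dots> \<le> (\<integral>u. C * t\<^sup>2 \<partial>\<mu>)"
        using C(4)[OF _ t] iF iF' iFT by (intro integral_mono) auto
      finally show ?thesis by (simp add: prob_space)
    qed
    ultimately show ?thesis by (metis norm_minus_cancel norm_mult norm_of_real)
  qed
  show ?thesis
  proof (rule ccontr)
    assume "(\<integral>u. F' u \<partial>\<mu>) \<noteq> 0"
    then have pos: "norm (\<integral>u. F' u \<partial>\<mu>) > 0" by simp
    \<comment> \<open>Small enough to make \<open>C * t\<close> at most half of the norm to be
      refuted; \<open>C + 1\<close> replaces \<open>C\<close> because \<open>C\<close> may be
      0.\<close>
    define t where "t = min 1 (norm (\<integral>u. F' u \<partial>\<mu>) / (2 * (C + 1)))"
    have t: "0 < t" "t \<le> 1" using pos C by (auto simp: t_def)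
    have "t * norm (\<integral>u. F' u \<partial>\<mu>) \<le> t * (C * t)"
      using bd[of t] t by (simp add: power2_eq_square mult_ac)
    then have "norm (\<integral>u. F' u \<partial>\<mu>) \<le> C * t" using t by simp
    also have "\<dots> \<le> (C + 1) * (norm (\<integral>u. F' u \<partial>\<mu>) / (2 * (C + 1)))"
      using C t by (intro mult_mono) (auto simp: t_def)
    also have "\<dots> = norm (\<integral>u. F' u \<partial>\<mu>) / 2" using C by (simp add: field_simps)
    finally show False using pos by simp
  qed
qed

section \<open>Entries of matrix powers and their first variations\<close>

fun pow_entry :: "nat \<Rightarrow> complex mat \<Rightarrow> nat \<Rightarrow> nat \<Rightarrow> nat \<Rightarrow> complex" where
  "pow_entry n A 0 a b = (if a = b then 1 else 0)"
| "pow_entry n A (Suc k) a b = (\<Sum>c<n. pow_entry n A k a c * A $$ (c, b))"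

text \<open>On unitary matrices this is an entry of \<open>A\<close> to the integer power \<open>m\<close>.\<close>
definition powi_entry :: "nat \<Rightarrow> complex mat \<Rightarrow> int \<Rightarrow> nat \<Rightarrow> nat \<Rightarrow> complex" where
  "powi_entry n A m a b = (if m \<ge> 0 then pow_entry n A (nat m) a b else cnj (pow_entry n A (nat (- m)) b a))"

definition powi_trace :: "nat \<Rightarrow> complex mat \<Rightarrow> int \<Rightarrow> complex" where
  "powi_trace n A m = (\<Sum>a<n. powi_entry n A m a a)"

text \<open>The coefficient of \<open>X $$ (c, d)\<close> in the first variation of \<open>pow_entry n A k a b\<close> as \<open>A\<close> varies
  to \<open>A + X * A\<close>.\<close>
fun pow_entry_grad :: "nat \<Rightarrow> complex mat \<Rightarrow> nat \<Rightarrow> nat \<Rightarrow> nat \<Rightarrow> nat \<Rightarrow> nat \<Rightarrow> complex" where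
  "pow_entry_grad n A 0 a b c d = 0"
| "pow_entry_grad n A (Suc k) a b c d = (\<Sum>e<n. pow_entry_grad n A k a e c d * A $$ (e, b)) + pow_entry n A k a c * A $$ (d, b)"

lemma pow_entry_1: "a < n \<Longrightarrow> pow_entry n A (Suc 0) a b = A $$ (a, b)"
  by (simp add: if_distrib[of "\<lambda>x. x * _"] cong: if_cong)

lemma pow_entry_add: "a < n \<Longrightarrow> b < n \<Longrightarrow> (\<Sum>c<n. pow_entry n A k a c * pow_entry n A l c b) = pow_entry n A (k + l) a b"
proof (induction l arbitrary: b)
  case 0
  then show ?case by (simp add: if_distrib[of "\<lambda>x. _ * x"] cong: if_cong)
next
  case (Suc l)
  have "(\<Sum>c<n. pow_entry n A k a c * pow_entry n A (Suc l) c b) = (\<Sum>e<n. (\<Sum>c<n. pow_entry n A k a c * pow_entry n A l c e) * A $$ (e, b))"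
    by (simp add: sum_distrib_left sum_distrib_right mult.assoc) (rule sum.swap)
  also have "\<dots> = (\<Sum>e<n. pow_entry n A (k + l) a e * A $$ (e, b))"
    using Suc by (intro sum.cong refl) simp
  finally show ?case by simp
qed

text \<open>Product rule: when one of the \<open>k\<close> factors \<open>A\<close> becomes
  \<open>X * A\<close>, there are \<open>l\<close> factors before \<open>X\<close> and
  \<open>k - l\<close> after it, the varied factor included.\<close>

lemma pow_entry_grad_eq: "a < n \<Longrightarrow> b < n \<Longrightarrow> d < n \<Longrightarrow> pow_entry_grad n A k a b c d = (\<Sum>l<k. pow_entry n A l a c * pow_entry n A (k - l) d b)"
proof (induction k arbitrary: b)
  case (Suc k)
  have "pow_entry_grad n A (Suc k) a b c d = (\<Sum>e<n. (\<Sum>l<k. pow_entry n A l a c * pow_entry n A (k - l) d e) * A $$ (e, b)) + pow_entry n A k a c * pow_entry n A 1 d b"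
    using Suc pow_entry_1[of d n A b] by simp
  also have "(\<Sum>e<n. (\<Sum>l<k. pow_entry n A l a c * pow_entry n A (k - l) d e) * A $$ (e, b)) = (\<Sum>l<k. pow_entry n A l a c * pow_entry n A (Suc (k - l)) d b)"
    by (simp add: sum_distrib_left sum_distrib_right mult.assoc) (rule sum.swap)
  also have "\<dots> = (\<Sum>l<k. pow_entry n A l a c * pow_entry n A (Suc k - l) d b)"
    by (intro sum.cong refl) (simp only: lessThan_iff Suc_diff_le less_imp_le)
  finally show ?case by simp
qed simp

lemma unitary_rows:
  assumes A: "A \<in> unitary_group n" and ab: "a < n" "b < n"
  shows "(\<Sum>c<n. A $$ (a, c) * cnj (A $$ (b, c))) = (if a = b then 1 else 0)"
    and "(\<Sum>c<n. cnj (A $$ (c, a)) * A $$ (c, b)) = (if a = b then 1 else 0)"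
proof -
  have c: "A \<in> carrier_mat n n" and AA: "A * mat_adjoint A = 1\<^sub>m n" "mat_adjoint A * A = 1\<^sub>m n"
    using A by (auto simp: unitary_group_def)
  have adj: "mat_adjoint A \<in> carrier_mat n n" "\<And>i j. i < n \<Longrightarrow> j < n \<Longrightarrow> mat_adjoint A $$ (i, j) = cnj (A $$ (j, i))"
    using c by (auto simp: mat_adjoint_def mat_of_rows_def conjugate_vec_def)
  have "(A * mat_adjoint A) $$ (a, b) = (\<Sum>c<n. A $$ (a, c) * cnj (A $$ (b, c)))"
    using c adj ab by (simp add: scalar_prod_def lessThan_atLeast0)
  then show "(\<Sum>c<n. A $$ (a, c) * cnj (A $$ (b, c))) = (if a = b then 1 else 0)"
    unfolding AA using ab by simp
  have "(mat_adjoint A * A) $$ (a, b) = (\<Sum>c<n. cnj (A $$ (c, a)) * A $$ (c, b))"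
    using c adj ab by (simp add: scalar_prod_def lessThan_atLeast0)
  then show "(\<Sum>c<n. cnj (A $$ (c, a)) * A $$ (c, b)) = (if a = b then 1 else 0)"
    unfolding AA using ab by simp
qed

text \<open>For negative \<open>m\<close> the factors cancel one at a time by unitarity, until one
  of the two powers is used up.\<close>

lemma powi_entry_add:
  assumes A: "A \<in> unitary_group n" and ab: "a < n" "b < n"
  shows "(\<Sum>c<n. pow_entry n A k a c * powi_entry n A m c b) = powi_entry n A (int k + m) a b"
proof -
  have step: "(\<Sum>c<n. pow_entry n A (Suc k) a c * cnj (pow_entry n A (Suc l) b c)) = (\<Sum>c<n. pow_entry n A k a c * cnj (pow_entry n A l b c))"
    if ab: "a < n" "b < n" for k l a b
  proof -
    have "(\<Sum>c<n. pow_entry n A (Suc k) a c * cnj (pow_entry n A (Suc l) b c))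
        = (\<Sum>c<n. \<Sum>e<n. \<Sum>f<n. pow_entry n A k a e * cnj (pow_entry n A l b f) * (A $$ (e, c) * cnj (A $$ (f, c))))"
      by (intro sum.cong refl) (simp add: sum_product mult_ac)
    also have "\<dots> = (\<Sum>e<n. \<Sum>f<n. pow_entry n A k a e * cnj (pow_entry n A l b f) * (\<Sum>c<n. A $$ (e, c) * cnj (A $$ (f, c))))"
      unfolding sum_distrib_left by (subst sum.swap, rule sum.cong[OF refl], rule sum.swap)
    also have "\<dots> = (\<Sum>e<n. \<Sum>f<n. if e = f then pow_entry n A k a e * cnj (pow_entry n A l b f) else 0)"
      by (intro sum.cong refl) (simp add: unitary_rows(1)[OF A])
    finally show ?thesis by simp
  qed
  show ?thesis
  proof (cases "m \<ge> 0")
    case True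
    then have "nat (int k + m) = k + nat m" by simp
    then show ?thesis using True pow_entry_add[OF ab, of A k "nat m"] by (simp add: powi_entry_def)
  next
    case False
    define l where "l = nat (- m)"
    have "(\<Sum>c<n. pow_entry n A k a c * cnj (pow_entry n A l b c)) = powi_entry n A (int k - int l) a b"
    proof (induction k arbitrary: l)
      case 0
      then show ?case using ab by (cases "l = 0") (simp_all add: powi_entry_def if_distrib[of "\<lambda>x. x * _"] cong: if_cong)
    next
      case (Suc k)
      show ?case
      proof (cases l)
        case 0
        then show ?thesis using ab by (simp add: powi_entry_def if_distrib[of cnj] if_distrib[of "\<lambda>x. _ * x"] nat_add_distrib del: pow_entry.simps(2) cong: if_cong)
      next
        case (Suc l')
        then show ?thesis using step[OF ab, of k l'] Suc.IH[of l'] by (simp del: pow_entry.simps)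
      qed
    qed
    then show ?thesis using False by (simp add: powi_entry_def l_def)
  qed
qed

text \<open>The exponential of \<open>\<i> t v v\<^sup>*\<close>, for a unit vector \<open>v\<close>.\<close>
definition refl_mat :: "nat \<Rightarrow> (nat \<Rightarrow> complex) \<Rightarrow> real \<Rightarrow> complex mat" where
  "refl_mat n v t = mat n n (\<lambda>(a, b). (if a = b then 1 else 0) + (cis t - 1) * (v a * cnj (v b)))"

section \<open>One-parameter groups of unitary matrices and calculus of gradients\<close>

lemma unitary_groupI:
  assumes "A \<in> carrier_mat n n"
    "\<And>a b. a < n \<Longrightarrow> b < n \<Longrightarrow> (\<Sum>c<n. A $$ (a, c) * cnj (A $$ (b, c))) = (if a = b then 1 else 0)"
    "\<And>a b. a < n \<Longrightarrow> b < n \<Longrightarrow> (\<Sum>c<n. cnj (A $$ (c, a)) * A $$ (c, b)) = (if a = b then 1 else 0)"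
  shows "A \<in> unitary_group n"
proof -
  have adj: "mat_adjoint A \<in> carrier_mat n n" "\<And>i j. i < n \<Longrightarrow> j < n \<Longrightarrow> mat_adjoint A $$ (i, j) = cnj (A $$ (j, i))"
    using assms(1) by (auto simp: mat_adjoint_def mat_of_rows_def conjugate_vec_def)
  have "A * mat_adjoint A = 1\<^sub>m n" "mat_adjoint A * A = 1\<^sub>m n"
    by (rule eq_matI; use assms adj in \<open>simp add: scalar_prod_def lessThan_atLeast0\<close>)+
  then show ?thesis using assms(1) by (simp add: unitary_group_def)
qed

text \<open>With \<open>s = cis t - 1\<close>, unimodularity of \<open>1 + s\<close> reads
  \<open>s * cnj s = - s - cnj s\<close>, and for a unit vector \<open>v\<close> this cancels the
  cross terms. Columns are treated as rows with \<open>cnj s\<close> in place of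
  \<open>s\<close>.\<close>

lemma refl_mat_unitary:
  assumes v: "(\<Sum>c<n. v c * cnj (v c)) = 1"
  shows "refl_mat n v t \<in> unitary_group n"
proof (rule unitary_groupI)
  define s where "s = cis t - 1"
  have s: "s * cnj s = - s - cnj s" by (simp add: s_def cis_cnj algebra_simps cis_mult)
  have main: "(\<Sum>c<n. ((if a = c then 1 else 0) + s * (v a * cnj (v c))) * ((if b = c then 1 else 0) + cnj s * (cnj (v b) * v c)))
      = (if a = b then 1 else 0)"
    if ab: "a < n" "b < n" and v: "(\<Sum>c<n. v c * cnj (v c)) = 1" and s: "s * cnj s = - s - cnj s"
    for a b and v :: "nat \<Rightarrow> complex" and s
  proof -
    have "(\<Sum>c<n. ((if a = c then 1 else 0) + s * (v a * cnj (v c))) * ((if b = c then 1 else 0) + cnj s * (cnj (v b) * v c)))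
       = (\<Sum>c<n. (if a = c then (if a = b then 1 else 0) + cnj s * (cnj (v b) * v a) else 0) + (if b = c then s * (v a * cnj (v b)) else 0)
             + s * cnj s * (v a * cnj (v b)) * (v c * cnj (v c)))"
      by (intro sum.cong refl) (auto simp: algebra_simps)
    also have "\<dots> = (if a = b then 1 else 0) + cnj s * (cnj (v b) * v a) + s * (v a * cnj (v b)) + s * cnj s * (v a * cnj (v b)) * (\<Sum>c<n. v c * cnj (v c))"
      using ab by (simp add: sum.distrib sum_distrib_left)
    also have "\<dots> = (if a = b then 1 else 0)" unfolding v s by (simp add: algebra_simps)
    finally show ?thesis .
  qed
  show "refl_mat n v t \<in> carrier_mat n n" by (simp add: refl_mat_def)
  fix a b assume ab: "a < n" "b < n"
  show "(\<Sum>c<n. refl_mat n v t $$ (a, c) * cnj (refl_mat n v t $$ (b, c))) = (if a = b then 1 else 0)"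
    using main[OF ab v s] ab by (simp add: refl_mat_def s_def if_distrib[of cnj] cong: if_cong)
  have s': "cnj s * cnj (cnj s) = - cnj s - cnj (cnj s)" using s by (simp add: mult.commute)
  have "(\<Sum>c<n. cnj (refl_mat n v t $$ (c, a)) * refl_mat n v t $$ (c, b))
      = (\<Sum>c<n. ((if a = c then 1 else 0) + cnj s * (v a * cnj (v c))) * ((if b = c then 1 else 0) + cnj (cnj s) * (cnj (v b) * v c)))"
  proof (rule sum.cong[OF refl])
    fix c assume "c \<in> {..<n}"
    then show "cnj (refl_mat n v t $$ (c, a)) * refl_mat n v t $$ (c, b)
      = ((if a = c then 1 else 0) + cnj s * (v a * cnj (v c))) * ((if b = c then 1 else 0) + cnj (cnj s) * (cnj (v b) * v c))"
      using ab by (simp add: refl_mat_def s_def[symmetric] mult.commute)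
  qed
  then show "(\<Sum>c<n. cnj (refl_mat n v t $$ (c, a)) * refl_mat n v t $$ (c, b)) = (if a = b then 1 else 0)"
    using main[OF ab v s'] by simp
qed

lemma unitary_entry_bound:
  assumes A: "A \<in> unitary_group n" and ab: "a < n" "b < n"
  shows "norm (A $$ (a, b)) \<le> 1"
proof -
  have "complex_of_real (\<Sum>c<n. (norm (A $$ (a, c)))\<^sup>2) = 1"
    using unitary_rows(1)[OF A ab(1) ab(1)] unfolding of_real_sum complex_norm_square by simp
  then have "(\<Sum>c<n. (norm (A $$ (a, c)))\<^sup>2) = 1" by (simp only: of_real_eq_1_iff)
  moreover have "(norm (A $$ (a, b)))\<^sup>2 \<le> (\<Sum>c<n. (norm (A $$ (a, c)))\<^sup>2)"
    using ab by (intro member_le_sum) auto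
  ultimately show ?thesis by (simp add: power_le_one_iff)
qed

lemma unitary_mult:
  assumes "A \<in> unitary_group n" "B \<in> unitary_group n"
  shows "A * B \<in> unitary_group n"
proof (rule unitary_groupI)
  have c: "A \<in> carrier_mat n n" "B \<in> carrier_mat n n" using assms by (auto simp: unitary_group_def)
  then show "A * B \<in> carrier_mat n n" by simp
  have AB: "(A * B) $$ (a, b) = (\<Sum>c<n. A $$ (a, c) * B $$ (c, b))" if "a < n" "b < n" for a b
    using c that by (simp add: scalar_prod_def lessThan_atLeast0)
  fix a b assume ab: "a < n" "b < n"
  have "(\<Sum>c<n. (A * B) $$ (a, c) * cnj ((A * B) $$ (b, c)))
      = (\<Sum>c<n. \<Sum>e<n. \<Sum>f<n. A $$ (a, e) * cnj (A $$ (b, f)) * (B $$ (e, c) * cnj (B $$ (f, c))))"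
  proof (rule sum.cong[OF refl])
    fix c assume "c \<in> {..<n}"
    then have c: "c < n" by simp
    show "(A * B) $$ (a, c) * cnj ((A * B) $$ (b, c))
      = (\<Sum>e<n. \<Sum>f<n. A $$ (a, e) * cnj (A $$ (b, f)) * (B $$ (e, c) * cnj (B $$ (f, c))))"
      unfolding AB[OF ab(1) c] AB[OF ab(2) c] cnj_sum sum_product complex_cnj_mult
      by (intro sum.cong refl) (simp only: mult_ac)
  qed
  also have "\<dots> = (\<Sum>e<n. \<Sum>f<n. A $$ (a, e) * cnj (A $$ (b, f)) * (\<Sum>c<n. B $$ (e, c) * cnj (B $$ (f, c))))"
    unfolding sum_distrib_left by (subst sum.swap, rule sum.cong[OF refl], rule sum.swap)
  also have "\<dots> = (\<Sum>e<n. \<Sum>f<n. if e = f then A $$ (a, e) * cnj (A $$ (b, f)) else 0)"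
    by (intro sum.cong refl) (simp add: unitary_rows(1)[OF assms(2)])
  also have "\<dots> = (if a = b then 1 else 0)" using unitary_rows(1)[OF assms(1) ab] by simp
  finally show "(\<Sum>c<n. (A * B) $$ (a, c) * cnj ((A * B) $$ (b, c))) = (if a = b then 1 else 0)" .
  have "(\<Sum>c<n. cnj ((A * B) $$ (c, a)) * (A * B) $$ (c, b))
      = (\<Sum>c<n. \<Sum>e<n. \<Sum>f<n. cnj (B $$ (e, a)) * B $$ (f, b) * (cnj (A $$ (c, e)) * A $$ (c, f)))"
  proof (rule sum.cong[OF refl])
    fix c assume "c \<in> {..<n}"
    then have c: "c < n" by simp
    show "cnj ((A * B) $$ (c, a)) * (A * B) $$ (c, b)
      = (\<Sum>e<n. \<Sum>f<n. cnj (B $$ (e, a)) * B $$ (f, b) * (cnj (A $$ (c, e)) * A $$ (c, f)))"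
      unfolding AB[OF c ab(1)] AB[OF c ab(2)] cnj_sum sum_product complex_cnj_mult
      by (intro sum.cong refl) (simp only: mult_ac)
  qed
  also have "\<dots> = (\<Sum>e<n. \<Sum>f<n. cnj (B $$ (e, a)) * B $$ (f, b) * (\<Sum>c<n. cnj (A $$ (c, e)) * A $$ (c, f)))"
    unfolding sum_distrib_left by (subst sum.swap, rule sum.cong[OF refl], rule sum.swap)
  also have "\<dots> = (\<Sum>e<n. \<Sum>f<n. if e = f then cnj (B $$ (e, a)) * B $$ (f, b) else 0)"
    by (intro sum.cong refl) (simp add: unitary_rows(2)[OF assms(1)])
  also have "\<dots> = (if a = b then 1 else 0)" using unitary_rows(2)[OF assms(2) ab] by simp
  finally show "(\<Sum>c<n. cnj ((A * B) $$ (c, a)) * (A * B) $$ (c, b)) = (if a = b then 1 else 0)" .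
qed

text \<open>The entry changes by \<open>cis t - 1\<close> times a fixed linear form in one column of
  \<open>A\<close>. Entries of unitary matrices are bounded by 1, so the constant depends on
  \<open>v\<close> but not on \<open>A\<close>.\<close>

lemma refl_mat_entry_expansion:
  assumes v: "(\<Sum>c<n. v c * cnj (v c)) = 1" and ab: "a < n" "b < n"
  shows "unif_expansion (unitary_group n) (\<lambda>t A. refl_mat n v t * A) (\<lambda>A. A $$ (a, b))
    (\<lambda>A. \<i> * (\<Sum>d<n. v a * cnj (v d) * A $$ (d, b)))"
proof -
  define C where "C = 1 + (\<Sum>d<n. norm (v a * cnj (v d)))"
  have C: "C \<ge> 1" unfolding C_def by (simp add: sum_nonneg)
  have bd: "norm (\<Sum>d<n. v a * cnj (v d) * A $$ (d, b)) \<le> C" if A: "A \<in> unitary_group n" for A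
  proof -
    have "norm (\<Sum>d<n. v a * cnj (v d) * A $$ (d, b)) \<le> (\<Sum>d<n. norm (v a * cnj (v d)) * 1)"
      by (intro sum_norm_le) (metis norm_mult mult_left_mono norm_ge_zero unitary_entry_bound[OF A _ ab(2)] lessThan_iff)
    then show ?thesis by (simp add: C_def)
  qed
  show ?thesis
  proof (rule unif_expansionI[of C])
    fix A t assume A: "A \<in> unitary_group n" and t: "\<bar>t::real\<bar> \<le> 1"
    have c: "A \<in> carrier_mat n n" using A by (simp add: unitary_group_def)
    define q where "q = (\<Sum>d<n. v a * cnj (v d) * A $$ (d, b))"
    have "(refl_mat n v t * A) $$ (a, b) = (\<Sum>d<n. ((if a = d then 1 else 0) + (cis t - 1) * (v a * cnj (v d))) * A $$ (d, b))"
      using c ab by (simp add: refl_mat_def scalar_prod_def lessThan_atLeast0)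
    also have "\<dots> = (\<Sum>d<n. (if a = d then A $$ (a, b) else 0) + (cis t - 1) * (v a * cnj (v d) * A $$ (d, b)))"
      by (intro sum.cong refl) (auto simp: algebra_simps)
    also have "\<dots> = A $$ (a, b) + (cis t - 1) * q"
      using ab by (simp add: sum.distrib q_def sum_distrib_left)
    finally have eq: "(refl_mat n v t * A) $$ (a, b) - A $$ (a, b) - of_real t * (\<i> * q) = (cis t - 1 - \<i> * of_real t) * q"
      by (simp add: algebra_simps)
    have "norm (cis t - 1 - \<i> * of_real t) \<le> t * t / 2"
      using iexp_approx1[of t 1] by (simp add: cis_conv_exp diff_diff_eq)
    then have "norm (cis t - 1 - \<i> * of_real t) \<le> t\<^sup>2"
      unfolding power2_eq_square using zero_le_square[of t] by linarith
    then show "norm ((refl_mat n v t * A) $$ (a, b) - A $$ (a, b) - of_real t * (\<i> * (\<Sum>d<n. v a * cnj (v d) * A $$ (d, b)))) \<le> C * t\<^sup>2"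
      unfolding q_def[symmetric] eq norm_mult using bd[OF A] by (subst mult.commute) (intro mult_mono, auto simp: q_def)
  next
    fix A assume A: "A \<in> unitary_group n"
    show "norm (A $$ (a, b)) \<le> C" using unitary_entry_bound[OF A ab] C by linarith
    show "norm (\<i> * (\<Sum>d<n. v a * cnj (v d) * A $$ (d, b))) \<le> C" using bd[OF A] by (simp add: norm_mult)
  qed (use C in simp)
qed

text \<open>The first variation of \<open>F\<close> as \<open>A\<close> changes to
  \<open>A + X * A\<close> is the sum of \<open>X $$ (c, d) * Y A c d\<close>. It is required for
  \<open>X\<close> equal to \<i> times the projection onto a unit vector \<open>v\<close>; these
  directions span all matrices over the complex numbers.\<close>

definition gradient :: "nat \<Rightarrow> (complex mat \<Rightarrow> complex) \<Rightarrow> (complex mat \<Rightarrow> nat \<Rightarrow> nat \<Rightarrow> complex) \<Rightarrow> bool" where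
  "gradient n F Y \<longleftrightarrow> (\<forall>v. (\<Sum>c<n. v c * cnj (v c)) = 1 \<longrightarrow>
     unif_expansion (unitary_group n) (\<lambda>t A. refl_mat n v t * A) F
       (\<lambda>A. \<i> * (\<Sum>c<n. \<Sum>d<n. v c * cnj (v d) * Y A c d)))"

lemma gradient_const: "gradient n (\<lambda>_. c) (\<lambda>_ _ _. 0)"
  unfolding gradient_def by (simp add: unif_expansion_const)

lemma gradient_add:
  assumes "gradient n F Y" "gradient n G Z"
  shows "gradient n (\<lambda>A. F A + G A) (\<lambda>A c d. Y A c d + Z A c d)"
  unfolding gradient_def
proof (intro allI impI)
  fix v :: "nat \<Rightarrow> complex" assume v: "(\<Sum>c<n. v c * cnj (v c)) = 1"
  show "unif_expansion (unitary_group n) (\<lambda>t A. refl_mat n v t * A) (\<lambda>A. F A + G A)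
       (\<lambda>A. \<i> * (\<Sum>c<n. \<Sum>d<n. v c * cnj (v d) * (Y A c d + Z A c d)))"
    using unif_expansion_add[OF assms[unfolded gradient_def, rule_format, OF v]]
    by (simp only: distrib_left sum.distrib)
qed

lemma gradient_sum:
  assumes "finite S" "\<And>i. i \<in> S \<Longrightarrow> gradient n (F i) (Y i)"
  shows "gradient n (\<lambda>A. \<Sum>i\<in>S. F i A) (\<lambda>A c d. \<Sum>i\<in>S. Y i A c d)"
  using assms
proof (induction S rule: finite_induct)
  case empty
  then show ?case using gradient_const[of n 0] by simp
next
  case (insert i S)
  then show ?case using gradient_add[of n "F i" "Y i" "\<lambda>A. \<Sum>i\<in>S. F i A" "\<lambda>A c d. \<Sum>i\<in>S. Y i A c d"] by simp
qed

lemma gradient_mult: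
  assumes "gradient n F Y" "gradient n G Z"
  shows "gradient n (\<lambda>A. F A * G A) (\<lambda>A c d. Y A c d * G A + F A * Z A c d)"
  unfolding gradient_def
proof (intro allI impI)
  fix v :: "nat \<Rightarrow> complex" assume v: "(\<Sum>c<n. v c * cnj (v c)) = 1"
  have eq: "\<i> * (\<Sum>c<n. \<Sum>d<n. v c * cnj (v d) * Y A c d) * G A + F A * (\<i> * (\<Sum>c<n. \<Sum>d<n. v c * cnj (v d) * Z A c d))
     = \<i> * (\<Sum>c<n. \<Sum>d<n. v c * cnj (v d) * (Y A c d * G A + F A * Z A c d))" for A
    unfolding distrib_left sum.distrib
    by (simp add: sum_distrib_left sum_distrib_right mult_ac)
  show "unif_expansion (unitary_group n) (\<lambda>t A. refl_mat n v t * A) (\<lambda>A. F A * G A)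
       (\<lambda>A. \<i> * (\<Sum>c<n. \<Sum>d<n. v c * cnj (v d) * (Y A c d * G A + F A * Z A c d)))"
    using unif_expansion_mult[OF assms[unfolded gradient_def, rule_format, OF v]]
      unitary_mult[OF refl_mat_unitary[OF v]] unfolding eq by blast
qed

lemma gradient_cnj:
  assumes "gradient n F Y"
  shows "gradient n (\<lambda>A. cnj (F A)) (\<lambda>A c d. - cnj (Y A d c))"
  unfolding gradient_def
proof (intro allI impI)
  fix v :: "nat \<Rightarrow> complex" assume v: "(\<Sum>c<n. v c * cnj (v c)) = 1"
  have eq: "cnj (\<i> * (\<Sum>c<n. \<Sum>d<n. v c * cnj (v d) * Y A c d)) = \<i> * (\<Sum>c<n. \<Sum>d<n. v c * cnj (v d) * - cnj (Y A d c))" for A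
    by (subst sum.swap) (simp add: sum_negf mult_ac)
  show "unif_expansion (unitary_group n) (\<lambda>t A. refl_mat n v t * A) (\<lambda>A. cnj (F A))
       (\<lambda>A. \<i> * (\<Sum>c<n. \<Sum>d<n. v c * cnj (v d) * - cnj (Y A d c)))"
    using unif_expansion_cnj[OF assms[unfolded gradient_def, rule_format, OF v]] unfolding eq .
qed

lemma gradient_entry:
  assumes "a < n" "b < n"
  shows "gradient n (\<lambda>A. A $$ (a, b)) (\<lambda>A c d. if c = a then A $$ (d, b) else 0)"
  unfolding gradient_def
proof (intro allI impI)
  fix v :: "nat \<Rightarrow> complex" assume v: "(\<Sum>c<n. v c * cnj (v c)) = 1"
  have eq: "(\<Sum>c<n. \<Sum>d<n. v c * cnj (v d) * (if c = a then A $$ (d, b) else 0)) = (\<Sum>d<n. v a * cnj (v d) * A $$ (d, b))" for A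
  proof -
    have "(\<Sum>c<n. \<Sum>d<n. v c * cnj (v d) * (if c = a then A $$ (d, b) else 0))
        = (\<Sum>c<n. if c = a then \<Sum>d<n. v a * cnj (v d) * A $$ (d, b) else 0)"
      by (intro sum.cong refl) auto
    then show ?thesis using assms by simp
  qed
  show "unif_expansion (unitary_group n) (\<lambda>t A. refl_mat n v t * A) (\<lambda>A. A $$ (a, b))
       (\<lambda>A. \<i> * (\<Sum>c<n. \<Sum>d<n. v c * cnj (v d) * (if c = a then A $$ (d, b) else 0)))"
    unfolding eq by (rule refl_mat_entry_expansion[OF v assms])
qed

lemma gradient_cong:
  assumes "gradient n F Y" "\<And>A c d. c < n \<Longrightarrow> d < n \<Longrightarrow> Y A c d = Z A c d"
  shows "gradient n F Z"
proof -
  have "(\<Sum>c<n. \<Sum>d<n. v c * cnj (v d) * Y A c d) = (\<Sum>c<n. \<Sum>d<n. v c * cnj (v d) * Z A c d)" for v A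
    using assms(2) by (intro sum.cong refl) auto
  then show ?thesis using assms(1) unfolding gradient_def by simp
qed

lemma gradient_pow_entry:
  assumes "a < n" "b < n"
  shows "gradient n (\<lambda>A. pow_entry n A k a b) (\<lambda>A c d. pow_entry_grad n A k a b c d)"
  using assms
proof (induction k arbitrary: b)
  case 0
  then show ?case by (simp add: gradient_const)
next
  case (Suc k)
  have *: "gradient n (\<lambda>A. \<Sum>e<n. pow_entry n A k a e * A $$ (e, b))
     (\<lambda>A c d. \<Sum>e<n. pow_entry_grad n A k a e c d * A $$ (e, b) + pow_entry n A k a e * (if c = e then A $$ (d, b) else 0))"
    by (intro gradient_sum gradient_mult Suc.IH gradient_entry) (use Suc.prems in auto)
  show ?case unfolding pow_entry.simps
    by (rule gradient_cong[OF *]) (simp add: sum.distrib if_distrib[of "\<lambda>x. _ * x"] cong: if_cong)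
qed

text \<open>By cyclicity of the trace each of the \<open>k\<close> positions of the varied factor
  contributes the same entry of the \<open>k\<close>-th power. For negative \<open>m\<close> the
  sign from conjugation is the sign of the factor \<open>m\<close>.\<close>

lemma gradient_powi_trace: "gradient n (\<lambda>A. powi_trace n A m) (\<lambda>A c d. of_int m * powi_entry n A m d c)"
proof -
  have pos: "gradient n (\<lambda>A. \<Sum>a<n. pow_entry n A k a a) (\<lambda>A c d. of_nat k * pow_entry n A k d c)" for k
  proof (rule gradient_cong[OF gradient_sum[OF finite_lessThan gradient_pow_entry]])
    fix A c d assume cd: "c < n" "d < n"
    have "(\<Sum>a<n. pow_entry_grad n A k a a c d) = (\<Sum>a<n. \<Sum>l<k. pow_entry n A l a c * pow_entry n A (k - l) d a)"
      using cd by (intro sum.cong refl pow_entry_grad_eq) auto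
    also have "\<dots> = (\<Sum>l<k. \<Sum>a<n. pow_entry n A (k - l) d a * pow_entry n A l a c)"
      by (subst sum.swap) (simp only: mult.commute)
    also have "\<dots> = (\<Sum>l<k. pow_entry n A k d c)"
      using cd by (intro sum.cong refl) (simp add: pow_entry_add)
    finally show "(\<Sum>a<n. pow_entry_grad n A k a a c d) = of_nat k * pow_entry n A k d c" by simp
  qed auto
  show ?thesis
  proof (cases "m \<ge> 0")
    case True
    then show ?thesis using pos[of "nat m"] by (simp add: powi_trace_def powi_entry_def)
  next
    case False
    then show ?thesis using gradient_cnj[OF pos[of "nat (- m)"]] by (simp add: powi_trace_def powi_entry_def)
  qed
qed

lemma gradient_prod_powi_trace:
  "gradient n (\<lambda>A. prod_list (map (powi_trace n A) ms)) (\<lambda>A c d. dprod (powi_trace n A) (\<lambda>m. powi_entry n A m d c) ms)"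
proof (induction ms)
  case Nil
  then show ?case using gradient_const[of n 1] by simp
next
  case (Cons m ms)
  show ?case using gradient_mult[OF gradient_powi_trace[of n m] Cons.IH] by simp
qed

section \<open>Measurability and bounds on the unitary group\<close>

lemma space_unitary_borel: "space (unitary_borel n) = unitary_group n"
  by (simp add: unitary_borel_def)

lemma entry_measurable:
  assumes "a < n" "b < n"
  shows "(\<lambda>A. A $$ (a, b)) \<in> borel_measurable (unitary_borel n)"
proof -
  let ?f = "\<lambda>A::complex mat. restrict (\<lambda>ij. A $$ ij) ({..<n} \<times> {..<n})"
  have "?f \<in> unitary_borel n \<rightarrow>\<^sub>M PiM ({..<n} \<times> {..<n}) (\<lambda>_. borel)"
    unfolding unitary_borel_def by (rule measurable_vimage_algebra1) (auto simp: space_PiM)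
  from measurable_compose[OF this measurable_component_singleton[of "(a, b)"]]
  show ?thesis using assms by simp
qed

lemma measurable_unitary_borelI:
  assumes "\<And>x. x \<in> space M \<Longrightarrow> f x \<in> unitary_group n"
    "\<And>a b. a < n \<Longrightarrow> b < n \<Longrightarrow> (\<lambda>x. f x $$ (a, b)) \<in> borel_measurable M"
  shows "f \<in> M \<rightarrow>\<^sub>M unitary_borel n"
  unfolding unitary_borel_def
  by (rule measurable_vimage_algebra2) (use assms in \<open>auto intro!: measurable_restrict\<close>)

lemma mult_measurable:
  assumes g: "g \<in> unitary_group n"
  shows "(\<lambda>A. g * A) \<in> unitary_borel n \<rightarrow>\<^sub>M unitary_borel n"
proof (rule measurable_unitary_borelI)
  fix A assume "A \<in> space (unitary_borel n)"
  then show "g * A \<in> unitary_group n" using unitary_mult[OF g] by (simp add: space_unitary_borel)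
next
  fix a b assume ab: "a < n" "b < n"
  have "(\<lambda>A. \<Sum>c<n. g $$ (a, c) * A $$ (c, b)) \<in> borel_measurable (unitary_borel n)"
    by (intro borel_measurable_sum borel_measurable_times borel_measurable_const entry_measurable) (use ab in auto)
  also have "?this \<longleftrightarrow> (\<lambda>A. (g * A) $$ (a, b)) \<in> borel_measurable (unitary_borel n)"
  proof (rule measurable_cong)
    fix A assume "A \<in> space (unitary_borel n)"
    then have "A \<in> carrier_mat n n" "g \<in> carrier_mat n n" using g by (auto simp: space_unitary_borel unitary_group_def)
    then show "(\<Sum>c<n. g $$ (a, c) * A $$ (c, b)) = (g * A) $$ (a, b)"
      using ab by (simp add: scalar_prod_def lessThan_atLeast0)
  qed
  finally show "(\<lambda>A. (g * A) $$ (a, b)) \<in> borel_measurable (unitary_borel n)" .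
qed

lemma pow_entry_measurable: "a < n \<Longrightarrow> b < n \<Longrightarrow> (\<lambda>A. pow_entry n A k a b) \<in> borel_measurable (unitary_borel n)"
proof (induction k arbitrary: b)
  case (Suc k)
  show ?case unfolding pow_entry.simps
    by (intro borel_measurable_sum borel_measurable_times Suc.IH entry_measurable) (use Suc.prems in auto)
qed simp

lemma powi_entry_measurable: "a < n \<Longrightarrow> b < n \<Longrightarrow> (\<lambda>A. powi_entry n A m a b) \<in> borel_measurable (unitary_borel n)"
  unfolding powi_entry_def using pow_entry_measurable[of a n b]
    measurable_compose[OF pow_entry_measurable[of b n a] borel_measurable_continuous_onI[OF continuous_on_cnj[OF continuous_on_id]]]
  by (cases "m \<ge> 0") simp_all

lemma powi_trace_measurable: "(\<lambda>A. powi_trace n A m) \<in> borel_measurable (unitary_borel n)"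
  unfolding powi_trace_def by (intro borel_measurable_sum powi_entry_measurable) auto

lemma prod_powi_trace_measurable: "(\<lambda>A. prod_list (map (powi_trace n A) ms)) \<in> borel_measurable (unitary_borel n)"
  by (induction ms) (auto intro!: borel_measurable_times powi_trace_measurable)

lemma dprod_measurable:
  assumes "\<And>m. (\<lambda>A. f A m) \<in> borel_measurable (unitary_borel n)"
  shows "(\<lambda>A. dprod (powi_trace n A) (f A) ms) \<in> borel_measurable (unitary_borel n)"
  by (induction ms) (auto intro!: borel_measurable_add borel_measurable_times powi_trace_measurable prod_powi_trace_measurable assms)

definition ubounded :: "nat \<Rightarrow> (complex mat \<Rightarrow> complex) \<Rightarrow> bool" where
  "ubounded n F \<longleftrightarrow> (\<exists>B. \<forall>A\<in>unitary_group n. norm (F A) \<le> B)"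

lemma ubounded_const: "ubounded n (\<lambda>_. c)"
  unfolding ubounded_def by blast

lemma ubounded_add: "ubounded n F \<Longrightarrow> ubounded n G \<Longrightarrow> ubounded n (\<lambda>A. F A + G A)"
  unfolding ubounded_def by (metis norm_triangle_mono)

lemma ubounded_mult:
  assumes "ubounded n F" "ubounded n G"
  shows "ubounded n (\<lambda>A. F A * G A)"
proof -
  obtain B C where B: "\<forall>A\<in>unitary_group n. norm (F A) \<le> B" and C: "\<forall>A\<in>unitary_group n. norm (G A) \<le> C"
    using assms unfolding ubounded_def by blast
  have "norm (F A * G A) \<le> B * C" if "A \<in> unitary_group n" for A
    unfolding norm_mult using B C that by (intro mult_mono') auto
  then show ?thesis unfolding ubounded_def by blast
qed

lemma ubounded_sum:
  assumes "finite S" "\<And>i. i \<in> S \<Longrightarrow> ubounded n (F i)"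
  shows "ubounded n (\<lambda>A. \<Sum>i\<in>S. F i A)"
  using assms by (induction S rule: finite_induct) (simp_all add: ubounded_const ubounded_add)

lemma ubounded_cnj: "ubounded n F \<Longrightarrow> ubounded n (\<lambda>A. cnj (F A))"
  unfolding ubounded_def by simp

lemma ubounded_pow_entry: "a < n \<Longrightarrow> b < n \<Longrightarrow> ubounded n (\<lambda>A. pow_entry n A k a b)"
proof (induction k arbitrary: b)
  case 0
  show ?case unfolding pow_entry.simps by (rule ubounded_const)
next
  case (Suc k)
  have "ubounded n (\<lambda>A. A $$ (c, b))" if "c < n" for c
    unfolding ubounded_def using unitary_entry_bound[of _ n c b] that Suc.prems by blast
  then show ?case
    unfolding pow_entry.simps using Suc by (intro ubounded_sum ubounded_mult) auto
qed

lemma ubounded_powi_entry: "a < n \<Longrightarrow> b < n \<Longrightarrow> ubounded n (\<lambda>A. powi_entry n A m a b)"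
  unfolding powi_entry_def by (cases "m \<ge> 0") (simp_all add: ubounded_pow_entry ubounded_cnj)

lemma ubounded_powi_trace: "ubounded n (\<lambda>A. powi_trace n A m)"
  unfolding powi_trace_def by (intro ubounded_sum ubounded_powi_entry) auto

lemma ubounded_prod_powi_trace: "ubounded n (\<lambda>A. prod_list (map (powi_trace n A) ms))"
  by (induction ms) (simp_all add: ubounded_const ubounded_mult ubounded_powi_trace)

lemma ubounded_dprod:
  assumes "\<And>m. ubounded n (\<lambda>A. f A m)"
  shows "ubounded n (\<lambda>A. dprod (powi_trace n A) (f A) ms)"
proof (induction ms)
  case Nil
  then show ?case by (simp add: ubounded_const)
next
  case (Cons m ms)
  show ?case unfolding dprod.simps
    by (intro ubounded_add ubounded_mult ubounded_const assms ubounded_prod_powi_trace ubounded_powi_trace Cons.IH)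
qed

text \<open>Polarisation: basis vectors give the diagonal entries. The normalised sum of one basis
  vector and \<open>w\<close> times another, for \<open>w = 1\<close> and \<open>w = \<i>\<close>,
  gives two equations that force the off-diagonal entries to vanish.\<close>

lemma quadratic_form_zero:
  fixes y :: "nat \<Rightarrow> nat \<Rightarrow> complex"
  assumes Q: "\<And>v. (\<Sum>c<n. v c * cnj (v c)) = 1 \<Longrightarrow> (\<Sum>c<n. \<Sum>d<n. v c * cnj (v d) * y c d) = 0"
    and cd: "c < n" "d < n"
  shows "y c d = 0"
proof -
  have diag: "y a a = 0" if a: "a < n" for a
  proof -
    define v :: "nat \<Rightarrow> complex" where "v i = (if i = a then 1 else 0)" for i
    have "(\<Sum>i<n. v i * cnj (v i)) = (\<Sum>i<n. if i = a then 1 else 0)" by (intro sum.cong) (auto simp: v_def)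
    then have "(\<Sum>c<n. \<Sum>d<n. v c * cnj (v d) * y c d) = 0" using a by (intro Q) simp
    moreover have "(\<Sum>c<n. \<Sum>d<n. v c * cnj (v d) * y c d) = (\<Sum>c<n. \<Sum>d<n. if d = a then if c = a then y a a else 0 else 0)"
      by (intro sum.cong refl) (auto simp: v_def)
    ultimately show ?thesis using a by simp
  qed
  show ?thesis
  proof (cases "c = d")
    case True
    then show ?thesis using diag cd by simp
  next
    case False
    have key: "w * y d c + cnj w * y c d = 0" if w: "w * cnj w = 1" for w
    proof -
      define r :: complex where "r = of_real (1 / sqrt 2)"
      have r: "r * r = 1 / 2" "cnj r = r" by (simp_all add: r_def flip: of_real_mult)
      define v where "v i = (if i = c then r else if i = d then w * r else 0)" for i
      have one: "(\<Sum>i<n. f i) = f c + f d" if "\<And>i. i \<noteq> c \<Longrightarrow> i \<noteq> d \<Longrightarrow> f i = 0" for f :: "nat \<Rightarrow> complex"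
      proof -
        have "(\<Sum>i<n. f i) = (\<Sum>i\<in>{c, d}. f i)" by (rule sum.mono_neutral_right) (use cd that in auto)
        then show ?thesis using False by simp
      qed
      have v: "v c = r" "v d = w * r" "\<And>i. i \<noteq> c \<Longrightarrow> i \<noteq> d \<Longrightarrow> v i = 0" using False by (auto simp: v_def)
      have "(\<Sum>i<n. v i * cnj (v i)) = r * r + (w * cnj w) * (r * r)"
        by (subst one) (simp_all add: v r(2) mult_ac)
      also have "\<dots> = 1" unfolding w r(1) by simp
      finally have "(\<Sum>i<n. v i * cnj (v i)) = 1" .
      from Q[OF this] have "(\<Sum>i<n. \<Sum>j<n. v i * cnj (v j) * y i j) = 0" .
      moreover have "(\<Sum>j<n. v i * cnj (v j) * y i j) = v i * r * y i c + v i * (cnj w * r) * y i d" for i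
        by (subst one) (simp_all add: v r)
      ultimately have "(\<Sum>i<n. v i * r * y i c + v i * (cnj w * r) * y i d) = 0" by (simp only:)
      then have "(r * r * y c c + r * (cnj w * r) * y c d) + (w * r * r * y d c + w * r * (cnj w * r) * y d d) = 0"
        by (subst (asm) one) (simp_all add: v)
      then have "(r * r) * (w * y d c + cnj w * y c d) = 0"
        using diag cd by (simp add: algebra_simps)
      then show ?thesis by (simp add: r)
    qed
    have "y d c + y c d = 0" "\<i> * y d c - \<i> * y c d = 0" using key[of 1] key[of \<i>] by simp_all
    then have "y d c = - y c d" "y d c = y c d" by (simp_all add: eq_neg_iff_add_eq_0)
    then show ?thesis by simp
  qed
qed

text \<open>Left invariance kills the mean derivative of \<open>pow_entry n A k a b * \<Prod>m\<leftarrow>ms. powi_trace n A m\<close> in the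
  directions \<open>v v\<^sup>*\<close>, hence by polarisation in the direction of every matrix unit; choose the one with
  row \<open>a\<close> and column \<open>b\<close> and sum over \<open>a\<close> and \<open>b\<close>.\<close>
lemma haar_schwinger_dyson:
  assumes haar: "haar_unitary n \<mu>"
  shows "(\<integral>A. (\<Sum>l<k. powi_trace n A (int l) * powi_trace n A (int (k - l))) * prod_list (map (powi_trace n A) ms)
      + dprod (powi_trace n A) (\<lambda>m. powi_trace n A (int k + m)) ms \<partial>\<mu>) = 0"
proof -
  interpret prob_space \<mu> using haar by (simp add: haar_unitary_def)
  have sets: "sets \<mu> = sets (unitary_borel n)" using haar by (simp add: haar_unitary_def)
  have sp: "space \<mu> = unitary_group n" using sets_eq_imp_space_eq[OF sets] by (simp add: space_unitary_borel)
  have meas: "f \<in> borel_measurable \<mu> \<longleftrightarrow> f \<in> borel_measurable (unitary_borel n)" for f :: "complex mat \<Rightarrow> complex"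
    by (rule measurable_cong_sets[OF sets refl, THEN arg_cong])
  define P where "P A = prod_list (map (powi_trace n A) ms)" for A
  define Y where "Y a b A c d = pow_entry_grad n A k a b c d * P A + pow_entry n A k a b * dprod (powi_trace n A) (\<lambda>m. powi_entry n A m d c) ms" for a b A c d
  have grad: "gradient n (\<lambda>A. pow_entry n A k a b * P A) (Y a b)" if "a < n" "b < n" for a b
    unfolding Y_def P_def using gradient_mult[OF gradient_pow_entry[OF that] gradient_prod_powi_trace] .
  have Fm: "(\<lambda>A. pow_entry n A k a b * P A) \<in> borel_measurable (unitary_borel n)" if "a < n" "b < n" for a b
    unfolding P_def by (intro borel_measurable_times pow_entry_measurable prod_powi_trace_measurable that)
  have Ym: "(\<lambda>A. Y a b A c d) \<in> borel_measurable (unitary_borel n)" if "a < n" "b < n" "c < n" "d < n" for a b c d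
  proof -
    have "(\<lambda>A. pow_entry_grad n A k a b c d) \<in> borel_measurable (unitary_borel n)"
      unfolding pow_entry_grad_eq[OF that(1,2,4)] by (intro borel_measurable_sum borel_measurable_times pow_entry_measurable that)
    then show ?thesis
      unfolding Y_def P_def by (intro borel_measurable_add borel_measurable_times pow_entry_measurable prod_powi_trace_measurable dprod_measurable powi_entry_measurable that)
  qed
  have Yb: "\<exists>B. \<forall>A\<in>unitary_group n. norm (Y a b A c d) \<le> B" if "a < n" "b < n" "c < n" "d < n" for a b c d
  proof -
    have "ubounded n (\<lambda>A. pow_entry_grad n A k a b c d)"
      unfolding pow_entry_grad_eq[OF that(1,2,4)] by (intro ubounded_sum ubounded_mult ubounded_pow_entry that finite_lessThan)
    then have "ubounded n (\<lambda>A. Y a b A c d)"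
      unfolding Y_def P_def
      by (intro ubounded_add ubounded_mult ubounded_pow_entry ubounded_prod_powi_trace ubounded_dprod ubounded_powi_entry that)
    then show ?thesis unfolding ubounded_def .
  qed
  have Yint: "integrable \<mu> (\<lambda>A. Y a b A c d)" if abcd: "a < n" "b < n" "c < n" "d < n" for a b c d
  proof -
    obtain B where "\<forall>A\<in>unitary_group n. norm (Y a b A c d) \<le> B" using Yb[OF abcd] by blast
    then show ?thesis
      using Ym[OF abcd] by (intro integrable_const_bound[of _ B]) (auto simp: meas sp)
  qed
  have I2: "(\<integral>A. (\<Sum>c<n. \<Sum>d<n. f c d A) \<partial>\<mu>) = (\<Sum>c<n. \<Sum>d<n. \<integral>A. f c d A \<partial>\<mu>)"
    if "\<And>c d. c < n \<Longrightarrow> d < n \<Longrightarrow> integrable \<mu> (f c d)" for f :: "nat \<Rightarrow> nat \<Rightarrow> complex mat \<Rightarrow> complex"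
  proof -
    have "(\<integral>A. (\<Sum>c<n. \<Sum>d<n. f c d A) \<partial>\<mu>) = (\<Sum>c<n. \<integral>A. (\<Sum>d<n. f c d A) \<partial>\<mu>)"
      by (rule Bochner_Integration.integral_sum) (use that in \<open>auto intro!: Bochner_Integration.integrable_sum\<close>)
    also have "\<dots> = (\<Sum>c<n. \<Sum>d<n. \<integral>A. f c d A \<partial>\<mu>)"
      by (intro sum.cong refl Bochner_Integration.integral_sum) (use that in auto)
    finally show ?thesis .
  qed
  have zero: "(\<integral>A. Y a b A c d \<partial>\<mu>) = 0" if abcd: "a < n" "b < n" "c < n" "d < n" for a b c d
  proof (rule quadratic_form_zero[of n "\<lambda>c d. \<integral>A. Y a b A c d \<partial>\<mu>", OF _ abcd(3,4)])
    fix v :: "nat \<Rightarrow> complex" assume v: "(\<Sum>c<n. v c * cnj (v c)) = 1"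
    let ?T = "\<lambda>t A. refl_mat n v t * A"
    let ?F = "\<lambda>A. pow_entry n A k a b * P A"
    have Tm: "(\<lambda>A. ?T t A) \<in> unitary_borel n \<rightarrow>\<^sub>M unitary_borel n" for t
      by (rule mult_measurable[OF refl_mat_unitary[OF v]])
    have "(\<integral>A. \<i> * (\<Sum>c<n. \<Sum>d<n. v c * cnj (v d) * Y a b A c d) \<partial>\<mu>) = 0"
    proof (rule unif_expansion_integral_0[where T = ?T and F = ?F])
      show "prob_space \<mu>" by (rule prob_space_axioms)
      show "unif_expansion (space \<mu>) ?T ?F (\<lambda>A. \<i> * (\<Sum>c<n. \<Sum>d<n. v c * cnj (v d) * Y a b A c d))"
        using grad[OF abcd(1,2)] v unfolding gradient_def sp by blast
      show "?T t A \<in> space \<mu>" if "A \<in> space \<mu>" for t A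
        using that unitary_mult[OF refl_mat_unitary[OF v]] unfolding sp by blast
      show "?F \<in> borel_measurable \<mu>" using Fm abcd unfolding meas by blast
      show "(\<lambda>A. \<i> * (\<Sum>c<n. \<Sum>d<n. v c * cnj (v d) * Y a b A c d)) \<in> borel_measurable \<mu>"
        unfolding meas by (intro borel_measurable_times borel_measurable_sum borel_measurable_const Ym) (use abcd in auto)
      show "(\<lambda>A. ?F (?T t A)) \<in> borel_measurable \<mu>" for t
        unfolding meas by (rule measurable_compose[OF Tm Fm[OF abcd(1,2)]])
      show "(\<integral>A. ?F (?T t A) \<partial>\<mu>) = (\<integral>A. ?F A \<partial>\<mu>)" for t
      proof -
        have "distr \<mu> (unitary_borel n) (\<lambda>A. ?T t A) = \<mu>"
          using haar refl_mat_unitary[OF v] by (simp add: haar_unitary_def)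
        then have "(\<integral>A. ?F A \<partial>\<mu>) = (\<integral>A. ?F A \<partial>(distr \<mu> (unitary_borel n) (\<lambda>A. ?T t A)))" by simp
        also have "\<dots> = (\<integral>A. ?F (?T t A) \<partial>\<mu>)"
          by (rule integral_distr) (use Tm Fm[OF abcd(1,2)] in \<open>auto simp: measurable_cong_sets[OF sets refl]\<close>)
        finally show ?thesis by simp
      qed
    qed
    then show "(\<Sum>c<n. \<Sum>d<n. v c * cnj (v d) * (\<integral>A. Y a b A c d \<partial>\<mu>)) = 0"
      using Yint[OF abcd(1,2)] by (simp add: I2)
  qed
  have "(\<integral>A. (\<Sum>a<n. \<Sum>b<n. Y a b A a b) \<partial>\<mu>) = 0"
    by (subst I2) (auto intro!: Yint sum.neutral simp: zero)
  also have "(\<integral>A. (\<Sum>a<n. \<Sum>b<n. Y a b A a b) \<partial>\<mu>) = (\<integral>A. (\<Sum>l<k. powi_trace n A (int l) * powi_trace n A (int (k - l))) * P A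
      + dprod (powi_trace n A) (\<lambda>m. powi_trace n A (int k + m)) ms \<partial>\<mu>)"
  proof (rule Bochner_Integration.integral_cong[OF refl])
    fix A assume "A \<in> space \<mu>"
    then have A: "A \<in> unitary_group n" by (simp add: sp)
    \<comment> \<open>The matrix unit cuts the power into two pieces; summing over \<open>a\<close>
      and over \<open>b\<close> closes each piece separately into a trace.\<close>
    have "(\<Sum>a<n. \<Sum>b<n. pow_entry_grad n A k a b a b) = (\<Sum>a<n. \<Sum>b<n. \<Sum>l<k. pow_entry n A l a a * pow_entry n A (k - l) b b)"
      by (intro sum.cong refl pow_entry_grad_eq) auto
    also have "\<dots> = (\<Sum>l<k. \<Sum>a<n. \<Sum>b<n. pow_entry n A l a a * pow_entry n A (k - l) b b)"
      by (simp only: sum.swap[of _ "{..<n}" "{..<k}"])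
    also have "\<dots> = (\<Sum>l<k. powi_trace n A (int l) * powi_trace n A (int (k - l)))"
      by (simp add: powi_trace_def powi_entry_def sum_product del: of_nat_diff)
    finally have 1: "(\<Sum>a<n. \<Sum>b<n. pow_entry_grad n A k a b a b) = (\<Sum>l<k. powi_trace n A (int l) * powi_trace n A (int (k - l)))" .
    have "(\<Sum>a<n. \<Sum>b<n. pow_entry n A k a b * dprod (powi_trace n A) (\<lambda>m. powi_entry n A m b a) ms)
        = dprod (powi_trace n A) (\<lambda>m. \<Sum>a<n. \<Sum>b<n. pow_entry n A k a b * powi_entry n A m b a) ms"
    proof -
      have "(\<Sum>a<n. dprod (powi_trace n A) (\<lambda>m. \<Sum>b<n. pow_entry n A k a b * powi_entry n A m b a) ms)
          = dprod (powi_trace n A) (\<lambda>m. \<Sum>a<n. \<Sum>b<n. pow_entry n A k a b * powi_entry n A m b a) ms"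
        using dprod_sum[of "\<lambda>_. 1" "powi_trace n A" "\<lambda>a m. \<Sum>b<n. pow_entry n A k a b * powi_entry n A m b a" ms "{..<n}"] by simp
      then show ?thesis unfolding dprod_sum .
    qed
    \<comment> \<open>Here the two free indices instead join the powers \<open>k\<close> and
      \<open>m\<close> into a single trace.\<close>
    also have "(\<lambda>m. \<Sum>a<n. \<Sum>b<n. pow_entry n A k a b * powi_entry n A m b a) = (\<lambda>m. powi_trace n A (int k + m))"
      by (simp add: powi_trace_def powi_entry_add[OF A])
    finally show "(\<Sum>a<n. \<Sum>b<n. Y a b A a b) = (\<Sum>l<k. powi_trace n A (int l) * powi_trace n A (int (k - l))) * P A
      + dprod (powi_trace n A) (\<lambda>m. powi_trace n A (int k + m)) ms"
      unfolding Y_def sum.distrib 1[symmetric] sum_distrib_right by simp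
  qed
  finally show ?thesis by (simp add: P_def)
qed

subsection \<open>Eigenvalues of unitary matrices\<close>

lemma pow_mat_entry: "A \<in> carrier_mat n n \<Longrightarrow> a < n \<Longrightarrow> b < n \<Longrightarrow> (A ^\<^sub>m k) $$ (a, b) = pow_entry n A k a b"
proof (induction k arbitrary: b)
  case (Suc k)
  have c: "A ^\<^sub>m k \<in> carrier_mat n n" using Suc.prems by simp
  have "(A ^\<^sub>m Suc k) $$ (a, b) = (\<Sum>c<n. (A ^\<^sub>m k) $$ (a, c) * A $$ (c, b))"
    using Suc.prems c by (simp add: scalar_prod_def lessThan_atLeast0)
  also have "\<dots> = (\<Sum>c<n. pow_entry n A k a c * A $$ (c, b))"
    using Suc by (intro sum.cong refl) simp
  finally show ?case by simp
qed simp

lemma upper_triangular_pow: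
  fixes B :: "complex mat"
  assumes B: "B \<in> carrier_mat n n" and ut: "upper_triangular B"
  shows "a < n \<Longrightarrow> b \<le> a \<Longrightarrow> pow_entry n B k a b = (if a = b then B $$ (a, a) ^ k else 0)"
proof (induction k arbitrary: b)
  case (Suc k)
  have "pow_entry n B (Suc k) a b = (\<Sum>c<n. if c = a then pow_entry n B k a a * B $$ (a, b) else 0)"
    unfolding pow_entry.simps
  proof (rule sum.cong[OF refl])
    fix c assume c: "c \<in> {..<n}"
    consider "c < a" | "c = a" | "a < c" by linarith
    then show "pow_entry n B k a c * B $$ (c, b) = (if c = a then pow_entry n B k a a * B $$ (a, b) else 0)"
    proof cases
      case 1
      then show ?thesis using Suc.IH[OF Suc.prems(1), of c] by simp
    next
      case 3
      then have "B $$ (c, b) = 0" using ut B c Suc.prems by (auto simp: upper_triangular_def)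
      then show ?thesis using 3 by simp
    qed simp
  qed
  also have "\<dots> = pow_entry n B k a a * B $$ (a, b)" using Suc.prems by simp
  also have "\<dots> = (if a = b then B $$ (a, a) ^ Suc k else 0)"
  proof (cases "a = b")
    case False
    then have "B $$ (a, b) = 0" using ut B Suc.prems by (auto simp: upper_triangular_def)
    then show ?thesis using False by simp
  qed (use Suc.IH[OF Suc.prems(1), of a] in simp)
  finally show ?case .
qed simp

lemma trace_similar:
  fixes M P Q :: "complex mat"
  assumes c: "M \<in> carrier_mat n n" "P \<in> carrier_mat n n" "Q \<in> carrier_mat n n" and QP: "Q * P = 1\<^sub>m n"
  shows "(\<Sum>a<n. (P * M * Q) $$ (a, a)) = (\<Sum>a<n. M $$ (a, a))"
proof -
  have "(\<Sum>a<n. (P * M * Q) $$ (a, a)) = (\<Sum>a<n. \<Sum>c<n. \<Sum>b<n. M $$ (b, c) * (Q $$ (c, a) * P $$ (a, b)))"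
  proof (rule sum.cong[OF refl])
    fix a assume a: "a \<in> {..<n}"
    have "(R * Q) $$ (a, a) = (\<Sum>c<n. R $$ (a, c) * Q $$ (c, a))" if "R \<in> carrier_mat n n" for R
      using c a that by (simp add: scalar_prod_def lessThan_atLeast0)
    from this[of "P * M"] have "(P * M * Q) $$ (a, a) = (\<Sum>c<n. (P * M) $$ (a, c) * Q $$ (c, a))"
      using c by simp
    also have "\<dots> = (\<Sum>c<n. (\<Sum>b<n. P $$ (a, b) * M $$ (b, c)) * Q $$ (c, a))"
      using c a by (intro sum.cong refl) (simp add: scalar_prod_def lessThan_atLeast0)
    finally show "(P * M * Q) $$ (a, a) = (\<Sum>c<n. \<Sum>b<n. M $$ (b, c) * (Q $$ (c, a) * P $$ (a, b)))"
      by (simp add: sum_distrib_left sum_distrib_right mult_ac)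
  qed
  also have "\<dots> = (\<Sum>c<n. \<Sum>b<n. M $$ (b, c) * (\<Sum>a<n. Q $$ (c, a) * P $$ (a, b)))"
    unfolding sum_distrib_left by (subst sum.swap, rule sum.cong[OF refl], rule sum.swap)
  also have "\<dots> = (\<Sum>c<n. \<Sum>b<n. if b = c then M $$ (c, c) else 0)"
  proof (intro sum.cong refl)
    fix c' b assume "c' \<in> {..<n}" "b \<in> {..<n}"
    then have "(\<Sum>a<n. Q $$ (c', a) * P $$ (a, b)) = (Q * P) $$ (c', b)"
      using c by (simp add: scalar_prod_def lessThan_atLeast0)
    then show "M $$ (b, c') * (\<Sum>a<n. Q $$ (c', a) * P $$ (a, b)) = (if b = c' then M $$ (c', c') else 0)"
      unfolding QP using \<open>c' \<in> {..<n}\<close> \<open>b \<in> {..<n}\<close> by simp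
  qed
  finally show ?thesis by simp
qed

lemma unitary_eigenvalue_norm:
  assumes A: "A \<in> unitary_group n" and k: "eigenvalue A k"
  shows "norm k = 1"
proof -
  have c: "A \<in> carrier_mat n n" using A by (simp add: unitary_group_def)
  obtain v where v: "v \<in> carrier_vec n" "v \<noteq> 0\<^sub>v n" "A *\<^sub>v v = k \<cdot>\<^sub>v v"
    using k c unfolding eigenvalue_def eigenvector_def by auto
  have Av: "(\<Sum>b<n. A $$ (a, b) * v $ b) = k * v $ a" if "a < n" for a
  proof -
    have "(A *\<^sub>v v) $ a = (\<Sum>b<n. A $$ (a, b) * v $ b)"
      using that c v(1) by (simp add: scalar_prod_def lessThan_atLeast0)
    then show ?thesis unfolding v(3) using that v(1) by simp
  qed
  define S where "S = (\<Sum>a<n. v $ a * cnj (v $ a))"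
  have "k * cnj k * S = (\<Sum>a<n. (\<Sum>b<n. A $$ (a, b) * v $ b) * cnj (\<Sum>b<n. A $$ (a, b) * v $ b))"
    unfolding S_def sum_distrib_left by (intro sum.cong refl) (simp add: Av del: cnj_sum)
  also have "\<dots> = (\<Sum>a<n. \<Sum>b<n. \<Sum>c<n. v $ b * cnj (v $ c) * (cnj (A $$ (a, c)) * A $$ (a, b)))"
    unfolding cnj_sum sum_product by (intro sum.cong refl) simp
  also have "\<dots> = (\<Sum>b<n. \<Sum>c<n. v $ b * cnj (v $ c) * (\<Sum>a<n. cnj (A $$ (a, c)) * A $$ (a, b)))"
    unfolding sum_distrib_left by (subst sum.swap, rule sum.cong[OF refl], rule sum.swap)
  also have "\<dots> = (\<Sum>b<n. \<Sum>c<n. if c = b then v $ b * cnj (v $ b) else 0)"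
    by (intro sum.cong refl) (simp add: unitary_rows(2)[OF A])
  also have "\<dots> = S" by (simp add: S_def)
  finally have eq: "k * cnj k * S = S" .
  have "S \<noteq> 0"
  proof
    assume "S = 0"
    have "complex_of_real (\<Sum>a<n. (norm (v $ a))\<^sup>2) = S"
      unfolding S_def of_real_sum complex_norm_square ..
    then have "(\<Sum>a<n. (norm (v $ a))\<^sup>2) = 0" using \<open>S = 0\<close> by (simp only: of_real_eq_0_iff)
    then have "\<forall>a<n. v $ a = 0" by (simp add: sum_nonneg_eq_0_iff)
    then have "v = 0\<^sub>v n" using v(1) by (intro eq_vecI) auto
    then show False using v(2) by simp
  qed
  then have "k * cnj k = 1" using eq by simp
  then have "complex_of_real ((norm k)\<^sup>2) = of_real 1" unfolding complex_norm_square by simp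
  then have "(norm k)\<^sup>2 = 1" by (simp only: of_real_eq_iff)
  then show ?thesis using abs_square_eq_1[of "norm k"] by simp
qed

lemma proots_linear_prod: "proots (\<Prod>a\<leftarrow>as. [:- a, 1 :: complex:]) = mset as"
proof (induction as)
  case (Cons a as)
  have "(\<Prod>a\<leftarrow>as. [:- a, 1 :: complex:]) \<noteq> 0" by (auto simp: prod_list_zero_iff)
  then have "proots ([:- a, 1:] * (\<Prod>a\<leftarrow>as. [:- a, 1:])) = proots [:- a, 1:] + proots (\<Prod>a\<leftarrow>as. [:- a, 1:])"
    by (intro proots_mult) auto
  then show ?case using Cons.IH by (simp del: mult_pCons_left)
qed simp

text \<open>Schur triangularisation: powers of a triangular matrix are triangular, with powers of
  the diagonal entries on the diagonal, so traces and characteristic polynomials of all powers are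
  read off one list. Negative powers use that these entries have modulus 1.\<close>

lemma unitary_eigenvalues:
  assumes A: "A \<in> unitary_group n"
  shows "\<exists>z. (\<forall>i<n. norm (z i) = 1) \<and> eig A = image_mset z (mset_set {..<n}) \<and> (\<forall>m. powi_trace n A m = psum n z m)
    \<and> (\<forall>p. eig (A ^\<^sub>m p) = image_mset (\<lambda>x. x ^ p) (eig A))"
proof -
  have c: "A \<in> carrier_mat n n" using A by (simp add: unitary_group_def)
  obtain es where es: "char_poly A = (\<Prod>a\<leftarrow>es. [:- a, 1:])" "length es = n"
    using char_poly_factorized[OF c] by blast
  obtain B P Q where BPQ: "schur_decomposition A es = (B, P, Q)" by (cases "schur_decomposition A es")
  from schur_decomposition[OF c es(1) BPQ]
  have wit: "similar_mat_wit A B P Q" and ut: "upper_triangular B" and diag: "diag_mat B = es" by auto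
  from similar_mat_witD2[OF c wit]
  have B: "B \<in> carrier_mat n n" and P: "P \<in> carrier_mat n n" and Q: "Q \<in> carrier_mat n n" and QP: "Q * P = 1\<^sub>m n" by auto
  define z where "z i = B $$ (i, i)" for i
  have es_z: "es = map z [0..<n]" using diag B by (simp add: diag_mat_def z_def[abs_def])
  have mset_z: "mset (map f [0..<n]) = image_mset f (mset_set {..<n})" for f :: "nat \<Rightarrow> complex"
    by (simp add: lessThan_atLeast0)
  have eigA: "eig A = image_mset z (mset_set {..<n})"
    unfolding eig_def es(1) proots_linear_prod es_z mset_z ..
  have norm_z: "norm (z i) = 1" if "i < n" for i
  proof -
    have "poly (char_poly A) (z i) = 0"
      unfolding es(1) es_z using that by (auto simp: poly_prod_list o_def prod_list_zero_iff image_iff)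
    then have "eigenvalue A (z i)" using eigenvalue_root_char_poly[OF c] by blast
    then show ?thesis by (rule unitary_eigenvalue_norm[OF A])
  qed
  have psum_nat: "(\<Sum>a<n. pow_entry n A k a a) = (\<Sum>i<n. z i ^ k)" for k
  proof -
    have "(\<Sum>a<n. pow_entry n A k a a) = (\<Sum>a<n. (P * B ^\<^sub>m k * Q) $$ (a, a))"
      by (intro sum.cong refl) (simp add: pow_mat_entry[OF c, symmetric] similar_mat_wit_pow_id[OF wit])
    also have "\<dots> = (\<Sum>a<n. (B ^\<^sub>m k) $$ (a, a))"
      using B P Q QP by (intro trace_similar) auto
    also have "\<dots> = (\<Sum>i<n. z i ^ k)"
      using pow_mat_entry[OF B] upper_triangular_pow[OF B ut] by (intro sum.cong refl) (simp add: z_def)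
    finally show ?thesis .
  qed
  have "powi_trace n A m = psum n z m" for m
  proof (cases "m \<ge> 0")
    case True
    then show ?thesis using psum_nat[of "nat m"] by (simp add: powi_trace_def powi_entry_def psum_def power_int_def)
  next
    case False
    have "cnj (z i ^ nat (- m)) = z i powi m" if "i < n" for i
      using cnj_powi[OF norm_z[OF that], of "- m"] False by (simp add: power_int_def)
    then have "cnj (\<Sum>i<n. z i ^ nat (- m)) = psum n z m"
      unfolding cnj_sum psum_def by (intro sum.cong refl) simp
    then show ?thesis using psum_nat[of "nat (- m)"] False by (simp add: powi_trace_def powi_entry_def flip: cnj_sum)
  qed
  moreover have "eig (A ^\<^sub>m p) = image_mset (\<lambda>x. x ^ p) (eig A)" for p
  proof -
    have "similar_mat (A ^\<^sub>m p) (B ^\<^sub>m p)"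
      using similar_mat_wit_pow[OF wit, of p] unfolding similar_mat_def by blast
    then have "char_poly (A ^\<^sub>m p) = char_poly (B ^\<^sub>m p)" by (rule char_poly_similar)
    also have "\<dots> = (\<Prod>a\<leftarrow>diag_mat (B ^\<^sub>m p). [:- a, 1:])"
    proof (rule char_poly_upper_triangular)
      show "B ^\<^sub>m p \<in> carrier_mat n n" using B by simp
      show "upper_triangular (B ^\<^sub>m p)"
        using pow_mat_entry[OF B] upper_triangular_pow[OF B ut] B by (auto simp: upper_triangular_def)
    qed
    also have "diag_mat (B ^\<^sub>m p) = map (\<lambda>i. z i ^ p) [0..<n]"
      using B pow_mat_entry[OF B] upper_triangular_pow[OF B ut] by (auto simp: diag_mat_def z_def)
    finally have "char_poly (A ^\<^sub>m p) = (\<Prod>a\<leftarrow>map (\<lambda>i. z i ^ p) [0..<n]. [:- a, 1:])" .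
    then have "eig (A ^\<^sub>m p) = mset (map (\<lambda>i. z i ^ p) [0..<n])"
      by (simp only: eig_def proots_linear_prod)
    then show ?thesis by (simp add: mset_z eigA o_def multiset.map_comp lessThan_atLeast0)
  qed
  ultimately show ?thesis using norm_z eigA by blast
qed

text \<open>The order is an arbitrary choice, with no claim that it depends measurably on
  \<open>A\<close>. Only symmetric functions of \<open>eigvals\<close> are integrated.\<close>

definition eigvals :: "nat \<Rightarrow> complex mat \<Rightarrow> nat \<Rightarrow> complex" where
  "eigvals n A = (SOME z. (\<forall>i<n. norm (z i) = 1) \<and> eig A = image_mset z (mset_set {..<n}) \<and> (\<forall>m. powi_trace n A m = psum n z m))"

lemma eigvals:
  assumes "A \<in> unitary_group n"
  shows "i < n \<Longrightarrow> norm (eigvals n A i) = 1" "eig A = image_mset (eigvals n A) (mset_set {..<n})"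
    "psum n (eigvals n A) m = powi_trace n A m"
proof -
  have "\<exists>z. (\<forall>i<n. norm (z i) = 1) \<and> eig A = image_mset z (mset_set {..<n}) \<and> (\<forall>m. powi_trace n A m = psum n z m)"
    using unitary_eigenvalues[OF assms] by blast
  then have "(\<forall>i<n. norm (eigvals n A i) = 1) \<and> eig A = image_mset (eigvals n A) (mset_set {..<n}) \<and> (\<forall>m. powi_trace n A m = psum n (eigvals n A) m)"
    unfolding eigvals_def by (rule someI_ex)
  then show "i < n \<Longrightarrow> norm (eigvals n A i) = 1" "eig A = image_mset (eigvals n A) (mset_set {..<n})"
    "psum n (eigvals n A) m = powi_trace n A m" by auto
qed

lemma eig_pow:
  assumes "A \<in> unitary_group n"
  shows "eig (A ^\<^sub>m p) = image_mset (\<lambda>x. x ^ p) (eig A)"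
  using unitary_eigenvalues[OF assms] by blast

subsection \<open>The Heine--Szego identity\<close>

lemma raise_sum_comp: "raise_sum n (\<lambda>k w. \<rho> k (g w)) k ms w = raise_sum n \<rho> k ms (g w)"
  by (induction ms arbitrary: k) (simp_all del: fun_upd_apply)

lemma raise_sum_zmon_sym:
  assumes nz: "\<And>i. i < n \<Longrightarrow> z i \<noteq> 0" and n: "n \<ge> 1"
  shows "raise_sum n (zmon_sym n) ((\<lambda>_. 0)(0 := a)) ms z = fact (n - 1) * (psum n z a * prod_list (map (psum n z) ms))"
proof -
  define k where "k = (\<lambda>_::nat. 0 :: int)(0 := a)"
  have "raise_sum n (zmon_sym n) k ms z = (\<Sum>\<sigma> | \<sigma> permutes {..<n}. raise_sum n (zmon n) k ms (z \<circ> \<sigma>))"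
    unfolding zmon_sym_def[abs_def] by (rule raise_sum_sum)
  also have "\<dots> = (\<Sum>\<sigma> | \<sigma> permutes {..<n}. z (\<sigma> 0) powi a * prod_list (map (psum n z) ms))"
  proof (rule sum.cong[OF refl])
    fix \<sigma> assume "\<sigma> \<in> {\<sigma>. \<sigma> permutes {..<n}}"
    then have \<sigma>: "\<sigma> permutes {..<n}" by simp
    have psum: "psum n (z \<circ> \<sigma>) = psum n z"
      using sum.permute[OF \<sigma>, of "\<lambda>i. z i powi _"] by (auto simp: psum_def o_def fun_eq_iff)
    have mon: "zmon n k (z \<circ> \<sigma>) = z (\<sigma> 0) powi a"
    proof -
      have "zmon n k (z \<circ> \<sigma>) = (\<Prod>i<n. if i = 0 then z (\<sigma> 0) powi a else 1)"
        unfolding zmon_def k_def by (intro prod.cong) auto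
      then show ?thesis using n by simp
    qed
    have "raise_sum n (zmon n) k ms (z \<circ> \<sigma>) = zmon n k (z \<circ> \<sigma>) * prod_list (map (psum n (z \<circ> \<sigma>)) ms)"
      by (rule raise_sum_zmon) (use n nz permutes_in_image[OF \<sigma>] in auto)
    then show "raise_sum n (zmon n) k ms (z \<circ> \<sigma>) = z (\<sigma> 0) powi a * prod_list (map (psum n z) ms)"
      unfolding psum mon .
  qed
  also have "\<dots> = fact (n - 1) * (\<Sum>i<n. z i powi a * prod_list (map (psum n z) ms))"
    by (rule sum_permutes_apply[OF n])
  finally show ?thesis by (simp add: k_def psum_def sum_distrib_right)
qed

text \<open>Integrable functions with mean zero form a linear space, so by
  \<open>raise_sum_descent\<close> it suffices to treat a single exponent raised along a list, which
  is the Schwinger--Dyson equation. Integrability is carried along because mean zero alone is not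
  preserved by sums.\<close>

lemma haar_dunkl_mon_sym:
  assumes haar: "haar_unitary n \<mu>" and n: "n \<ge> 1"
  shows "integrable \<mu> (\<lambda>A. dunkl_mon_sym n k (eigvals n A)) \<and> (\<integral>A. dunkl_mon_sym n k (eigvals n A) \<partial>\<mu>) = 0"
proof -
  interpret prob_space \<mu> using haar by (simp add: haar_unitary_def)
  have sets: "sets \<mu> = sets (unitary_borel n)" using haar by (simp add: haar_unitary_def)
  have sp: "space \<mu> = unitary_group n" using sets_eq_imp_space_eq[OF sets] by (simp add: space_unitary_borel)
  have meas: "f \<in> borel_measurable \<mu> \<longleftrightarrow> f \<in> borel_measurable (unitary_borel n)" for f :: "complex mat \<Rightarrow> complex"
    by (rule measurable_cong_sets[OF sets refl, THEN arg_cong])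
  define \<rho> where "\<rho> k A = dunkl_mon_sym n k (eigvals n A)" for k A
  have nz: "eigvals n A i \<noteq> 0" if "A \<in> unitary_group n" "i < n" for A i
    using eigvals(1)[OF that] by auto
  have base_nat: "integrable \<mu> (raise_sum n \<rho> ((\<lambda>_. 0)(0 := int a)) ms)
      \<and> (\<integral>A. raise_sum n \<rho> ((\<lambda>_. 0)(0 := int a)) ms A \<partial>\<mu>) = 0" for a ms
  proof -
    define F where "F A = (\<Sum>l<a. powi_trace n A (int l) * powi_trace n A (int (a - l))) * prod_list (map (powi_trace n A) ms)
      + dprod (powi_trace n A) (\<lambda>m. powi_trace n A (int a + m)) ms" for A
    have eq: "raise_sum n \<rho> ((\<lambda>_. 0)(0 := int a)) ms A = fact (n - 1) * F A" if "A \<in> space \<mu>" for A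
    proof -
      have A: "A \<in> unitary_group n" using that by (simp add: sp)
      have psum: "psum n (eigvals n A) = powi_trace n A" using eigvals(3)[OF A] by (intro ext)
      show ?thesis unfolding \<rho>_def raise_sum_comp F_def psum[symmetric]
        by (rule raise_sum_dunkl_mon_sym) (use nz[OF A] n in auto)
    qed
    have "F \<in> borel_measurable \<mu>" unfolding meas F_def
      by (intro borel_measurable_add borel_measurable_times borel_measurable_sum powi_trace_measurable prod_powi_trace_measurable dprod_measurable)
    moreover have "ubounded n F" unfolding F_def
      by (intro ubounded_add ubounded_mult ubounded_sum ubounded_powi_trace ubounded_prod_powi_trace ubounded_dprod finite_lessThan)
    then obtain B where "\<forall>A\<in>unitary_group n. norm (F A) \<le> B" unfolding ubounded_def by blast
    ultimately have "integrable \<mu> F"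
      by (intro integrable_const_bound[of _ B]) (auto simp: sp)
    then have "integrable \<mu> (\<lambda>A. fact (n - 1) * F A)" by simp
    moreover have "(\<integral>A. fact (n - 1) * F A \<partial>\<mu>) = 0"
      using haar_schwinger_dyson[OF haar, of a ms] unfolding F_def[symmetric] by simp
    moreover have "integrable \<mu> (raise_sum n \<rho> ((\<lambda>_. 0)(0 := int a)) ms) \<longleftrightarrow> integrable \<mu> (\<lambda>A. fact (n - 1) * F A)"
      by (rule Bochner_Integration.integrable_cong[OF refl eq])
    moreover have "(\<integral>A. raise_sum n \<rho> ((\<lambda>_. 0)(0 := int a)) ms A \<partial>\<mu>) = (\<integral>A. fact (n - 1) * F A \<partial>\<mu>)"
      by (rule Bochner_Integration.integral_cong[OF refl eq])
    ultimately show ?thesis by (simp only:)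
  qed
  have base: "integrable \<mu> (raise_sum n \<rho> ((\<lambda>_. 0)(0 := a)) ms)
      \<and> (\<integral>A. raise_sum n \<rho> ((\<lambda>_. 0)(0 := a)) ms A \<partial>\<mu>) = 0" for a ms
  proof (cases "a \<ge> 0")
    case True
    then show ?thesis using base_nat[of "nat a" ms] by simp
  next
    case False
    define b where "b = nat (- a)"
    \<comment> \<open>The Schwinger--Dyson equation is stated for a nonnegative power; conjugation,
      which negates all exponents, supplies the negative ones.\<close>
    have eq: "raise_sum n \<rho> ((\<lambda>_. 0)(0 := a)) ms A = - cnj (raise_sum n \<rho> ((\<lambda>_. 0)(0 := int b)) (map uminus ms) A)"
      if "A \<in> space \<mu>" for A
    proof -
      have A: "A \<in> unitary_group n" using that by (simp add: sp)
      have "cnj (\<rho> k A) = - \<rho> (\<lambda>i. - k i) A" for k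
        unfolding \<rho>_def by (rule cnj_dunkl_mon_sym) (use eigvals(1)[OF A] n in auto)
      from raise_sum_cnj[of \<rho> A, OF this]
      have "cnj (raise_sum n \<rho> ((\<lambda>_. 0)(0 := int b)) (map uminus ms) A)
          = - raise_sum n \<rho> (\<lambda>i. - ((\<lambda>_. 0)(0 := int b)) i) (map uminus (map uminus ms)) A" .
      moreover have "(\<lambda>i. - ((\<lambda>_. 0)(0 := int b)) i) = (\<lambda>_::nat. 0)(0 := a)"
        using False by (auto simp: b_def)
      ultimately show ?thesis by (simp add: o_def)
    qed
    define G where "G A = - cnj (raise_sum n \<rho> ((\<lambda>_. 0)(0 := int b)) (map uminus ms) A)" for A
    have "integrable \<mu> G" "(\<integral>A. G A \<partial>\<mu>) = 0"
      unfolding G_def using base_nat[of b "map uminus ms"] by simp_all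
    moreover have "integrable \<mu> (raise_sum n \<rho> ((\<lambda>_. 0)(0 := a)) ms) \<longleftrightarrow> integrable \<mu> G"
      unfolding G_def[abs_def] by (rule Bochner_Integration.integrable_cong[OF refl eq])
    moreover have "(\<integral>A. raise_sum n \<rho> ((\<lambda>_. 0)(0 := a)) ms A \<partial>\<mu>) = (\<integral>A. G A \<partial>\<mu>)"
      unfolding G_def by (rule Bochner_Integration.integral_cong[OF refl eq])
    ultimately show ?thesis by (simp only:)
  qed
  have "integrable \<mu> (\<rho> k) \<and> (\<integral>A. \<rho> k A \<partial>\<mu>) = 0"
  proof (rule raise_sum_descent[of n \<rho> "\<lambda>f. integrable \<mu> f \<and> (\<integral>A. f A \<partial>\<mu>) = 0", OF n])
    fix k k' :: "nat \<Rightarrow> int" assume "\<And>i. i < n \<Longrightarrow> k i = k' i"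
    then show "\<rho> k = \<rho> k'" unfolding \<rho>_def dunkl_mon_sym_def using dunkl_mon_cong[OF n, of k k'] by simp
  next
    fix k :: "nat \<Rightarrow> int" and i j assume "i \<in> {1..<n}" "j \<in> {1..<n}"
    then show "\<rho> (k \<circ> transposition i j) = \<rho> k" unfolding \<rho>_def by (simp add: dunkl_mon_sym_transpose)
  qed (use base in auto)
  then show ?thesis unfolding \<rho>_def[abs_def] .
qed

text \<open>The same descent, now in the linear space of measurable functions, expresses symmetrised
  monomials through traces of powers and so bypasses the arbitrary order in
  \<open>eigvals\<close>.\<close>

lemma zmon_sym_measurable:
  assumes n: "n \<ge> 1"
  shows "(\<lambda>A. zmon_sym n k (eigvals n A)) \<in> borel_measurable (unitary_borel n)"
proof -
  define \<rho> where "\<rho> k A = zmon_sym n k (eigvals n A)" for k A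
  have base: "raise_sum n \<rho> ((\<lambda>_. 0)(0 := a)) ms \<in> borel_measurable (unitary_borel n)" for a ms
  proof -
    have "raise_sum n \<rho> ((\<lambda>_. 0)(0 := a)) ms A = fact (n - 1) * (powi_trace n A a * prod_list (map (powi_trace n A) ms))"
      if "A \<in> space (unitary_borel n)" for A
    proof -
      have A: "A \<in> unitary_group n" using that by (simp add: space_unitary_borel)
      have psum: "psum n (eigvals n A) = powi_trace n A" using eigvals(3)[OF A] by (intro ext)
      have nz: "eigvals n A i \<noteq> 0" if "i < n" for i using eigvals(1)[OF A that] by auto
      show ?thesis unfolding \<rho>_def raise_sum_comp psum[symmetric]
        by (rule raise_sum_zmon_sym) (use nz n in auto)
    qed
    then have "raise_sum n \<rho> ((\<lambda>_. 0)(0 := a)) ms \<in> borel_measurable (unitary_borel n) \<longleftrightarrow>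
      (\<lambda>A. fact (n - 1) * (powi_trace n A a * prod_list (map (powi_trace n A) ms))) \<in> borel_measurable (unitary_borel n)"
      by (rule measurable_cong)
    moreover have "(\<lambda>A. fact (n - 1) * (powi_trace n A a * prod_list (map (powi_trace n A) ms))) \<in> borel_measurable (unitary_borel n)"
      by (intro borel_measurable_times borel_measurable_const powi_trace_measurable prod_powi_trace_measurable)
    ultimately show ?thesis by blast
  qed
  have "\<rho> k \<in> borel_measurable (unitary_borel n)"
  proof (rule raise_sum_descent[of n \<rho> "\<lambda>f. f \<in> borel_measurable (unitary_borel n)", OF n])
    fix k k' :: "nat \<Rightarrow> int" assume "\<And>i. i < n \<Longrightarrow> k i = k' i"
    then show "\<rho> k = \<rho> k'" unfolding \<rho>_def zmon_sym_def using zmon_cong[of n k k'] by simp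
  next
    fix k :: "nat \<Rightarrow> int" and i j assume "i \<in> {1..<n}" "j \<in> {1..<n}"
    then show "\<rho> (k \<circ> transposition i j) = \<rho> k" unfolding \<rho>_def by (simp add: zmon_sym_transpose)
  qed (use base in \<open>auto intro: borel_measurable_add borel_measurable_times\<close>)
  then show ?thesis by (simp add: \<rho>_def[abs_def])
qed

lemma norm_zmon_sym:
  assumes "\<And>i. i < n \<Longrightarrow> norm (z i) = 1"
  shows "norm (zmon_sym n k z) \<le> fact n"
proof -
  have "norm (zmon n k (z \<circ> \<sigma>)) = 1" if "\<sigma> permutes {..<n}" for \<sigma>
    unfolding zmon_def prod_norm[symmetric] norm_power_int
    using permutes_unit[of n z, OF assms that] by (intro prod.neutral) simp
  then have "norm (zmon_sym n k z) \<le> (\<Sum>\<sigma> | \<sigma> permutes {..<n}. 1)"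
    unfolding zmon_sym_def by (intro sum_norm_le) simp
  then show ?thesis by (simp add: card_permutations)
qed

text \<open>The division by \<open>of_nat N ^ n\<close> alone leaves the value \<open>fact n\<close>
  at exponent zero. This matches \<open>zmon_sym\<close>, a sum over \<open>fact n\<close>
  orderings.\<close>

definition grid_mean :: "nat \<Rightarrow> nat \<Rightarrow> (nat \<Rightarrow> int) \<Rightarrow> complex" where
  "grid_mean n N k = (\<Sum>z\<in>grid n N. weyl n z * zmon n k z) / of_nat N ^ n"

lemma cnj_weyl:
  assumes "\<And>i. i < n \<Longrightarrow> norm (z i) = 1"
  shows "cnj (weyl n z) = weyl n z"
proof -
  have nz: "z i \<noteq> 0" if "i < n" for i using assms[OF that] by auto
  have "cnj (vander_prod n z) = vander_prod n (\<lambda>i. inverse (z i))"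
    unfolding vander_prod_def cnj_prod complex_cnj_diff
    by (intro prod.cong refl) (use assms in \<open>simp add: cnj_unit\<close>)
  then have "vander_prod n (\<lambda>i. inverse (z i)) = cnj (vander_prod n z)" by simp
  moreover have "weyl n z = vander_prod n z * vander_prod n (\<lambda>i. inverse (z i))" by (rule weyl_vander_prod) (rule nz)
  ultimately show ?thesis by (simp add: mult.commute)
qed

lemma grid_unit:
  assumes "N > 0" "z \<in> grid n N" "i < n"
  shows "norm (z i) = 1"
proof -
  have "z i \<in> unity_roots N"
    using PiE_mem[OF assms(2)[unfolded grid_def], of i] assms(3) by simp
  then have zN: "z i ^ N = 1" by (simp only: unity_roots_def mem_Collect_eq)
  have "norm (z i) ^ N = norm (z i ^ N)" by (rule norm_power[symmetric])
  also have "\<dots> = 1 ^ N" unfolding zN by simp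
  finally show ?thesis by (rule power_eq_imp_eq_base[OF _ norm_ge_zero zero_le_one assms(1)])
qed

lemma toeplitz_det_delta: "toeplitz_det n (\<lambda>k. if k = 0 then 1 else 0) = 1"
proof -
  have "toeplitz_det n (\<lambda>k. if k = 0 then 1 else 0) = (\<Sum>\<pi> | \<pi> permutes {..<n}. if \<pi> = id then 1 else 0)"
    unfolding toeplitz_det_def
  proof (rule sum.cong[OF refl])
    fix \<pi> assume "\<pi> \<in> {\<pi>. \<pi> permutes {..<n}}"
    then have \<pi>: "\<pi> permutes {..<n}" by simp
    show "of_int (sign \<pi>) * (\<Prod>i<n. if int (\<pi> i) - int i = 0 then 1 else 0) = (if \<pi> = id then 1 else (0::complex))"
    proof (cases "\<pi> = id")
      case False
      then obtain i where "\<pi> i \<noteq> i" by (auto simp: fun_eq_iff)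
      then have "i < n" using permutes_not_in[OF \<pi>, of i] by auto
      with \<open>\<pi> i \<noteq> i\<close> have "\<exists>i\<in>{..<n}. (if int (\<pi> i) - int i = 0 then 1 else (0::complex)) = 0" by (intro bexI[of _ i]) auto
      then have "(\<Prod>i<n. if int (\<pi> i) - int i = 0 then 1 else (0::complex)) = 0" by (rule prod_zero[OF finite_lessThan])
      then show ?thesis using False by simp
    qed simp
  qed
  then show ?thesis by (simp add: permutes_id finite_permutations)
qed

text \<open>Both sides satisfy the recursion of \<open>monomial_recursion_unique\<close>: the left one by the Schwinger--Dyson
  equations, the right one by summation by parts on the grid.\<close>
lemma haar_moment:
  assumes haar: "haar_unitary n \<mu>" and n: "n \<ge> 1" and N: "int n + B < int N" and B: "B \<ge> 0"
    and k: "\<And>i. i < n \<Longrightarrow> \<bar>k i\<bar> \<le> B"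
  shows "(\<integral>A. zmon_sym n k (eigvals n A) \<partial>\<mu>) = grid_mean n N k"
proof -
  interpret prob_space \<mu> using haar by (simp add: haar_unitary_def)
  have sets: "sets \<mu> = sets (unitary_borel n)" using haar by (simp add: haar_unitary_def)
  have sp: "space \<mu> = unitary_group n" using sets_eq_imp_space_eq[OF sets] by (simp add: space_unitary_borel)
  have N0: "N > 0" using N n B by linarith
  have int: "integrable \<mu> (\<lambda>A. zmon_sym n k (eigvals n A))" for k
    using zmon_sym_measurable[OF n, of k] norm_zmon_sym[of n "eigvals n _" k, OF eigvals(1)]
    by (intro integrable_const_bound[of _ "fact n"]) (auto simp: sp measurable_cong_sets[OF sets refl])
  define M where "M k = (\<integral>A. zmon_sym n k (eigvals n A) \<partial>\<mu>)" for k
  define D where "D k = M k - grid_mean n N k" for k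
  have "D k = 0"
  proof (rule monomial_recursion_unique[of n D B, OF _ _ _ _ _ k])
    fix k k' :: "nat \<Rightarrow> int" assume "\<And>i. i < n \<Longrightarrow> k i = k' i"
    then have "zmon n k = zmon n k'" by (rule zmon_cong)
    then show "D k = D k'" by (simp add: D_def M_def grid_mean_def zmon_sym_def)
  next
    fix k :: "nat \<Rightarrow> int" and i j assume ij: "i < n" "j < n"
    let ?t = "transposition i j"
    have t: "?t permutes {..<n}" using ij by (intro permutes_swap_id) auto
    have "(\<Sum>z\<in>grid n N. weyl n z * zmon n (k \<circ> ?t) z) = (\<Sum>z\<in>grid n N. weyl n (z \<circ> ?t) * zmon n k (z \<circ> ?t))"
      by (simp add: zmon_transpose[OF ij] weyl_permute[OF t])
    also have "\<dots> = (\<Sum>z\<in>grid n N. weyl n z * zmon n k z)" by (rule sum_grid_transpose[OF ij])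
    finally show "D (k \<circ> ?t) = D k" by (simp add: D_def M_def grid_mean_def zmon_sym_transpose[OF ij])
  next
    fix k :: "nat \<Rightarrow> int"
    have "cnj (M k) = (\<integral>A. cnj (zmon_sym n k (eigvals n A)) \<partial>\<mu>)" by (simp add: M_def)
    also have "\<dots> = M (\<lambda>i. - k i)"
      unfolding M_def by (intro Bochner_Integration.integral_cong refl cnj_zmon_sym eigvals(1)) (auto simp: sp)
    finally have 1: "cnj (M k) = M (\<lambda>i. - k i)" .
    have "cnj (\<Sum>z\<in>grid n N. weyl n z * zmon n k z) = (\<Sum>z\<in>grid n N. weyl n z * zmon n (\<lambda>i. - k i) z)"
      unfolding cnj_sum
    proof (rule sum.cong[OF refl])
      fix z assume z: "z \<in> grid n N"
      show "cnj (weyl n z * zmon n k z) = weyl n z * zmon n (\<lambda>i. - k i) z"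
        unfolding complex_cnj_mult using cnj_weyl[of n z, OF grid_unit[OF N0 z]] cnj_zmon[of n z, OF grid_unit[OF N0 z]] by simp
    qed
    then show "D (\<lambda>i. - k i) = cnj (D k)" using 1 by (simp add: D_def grid_mean_def del: cnj_sum)
  next
    have "M (\<lambda>_. 0) = fact n" by (simp add: M_def zmon_sym_def zmon_def card_permutations prob_space)
    moreover have "grid_mean n N (\<lambda>_. 0) = fact n"
    proof -
      \<comment> \<open>The total mass of the density on the grid is Heine's identity for the
        constant symbol 1.\<close>
      define c :: "int \<Rightarrow> complex" where "c k = (if k = 0 then 1 else 0)" for k
      have nN: "int n + int 0 < int N" using N B by simp
      have "(\<Sum>z\<in>grid n N. weyl n z * (\<Prod>i<n. \<Sum>k\<in>{- int 0..int 0}. c k * z i powi k)) = of_nat N ^ n * fact n * toeplitz_det n c"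
        by (rule heine_grid[OF nN]) (simp add: c_def)
      moreover have "toeplitz_det n c = 1"
        using toeplitz_det_delta[of n] unfolding c_def[symmetric] .
      ultimately have "(\<Sum>z\<in>grid n N. weyl n z) = of_nat N ^ n * fact n"
        by (simp add: c_def[of 0])
      then show ?thesis using N0 by (simp add: grid_mean_def zmon_def)
    qed
    ultimately show "D (\<lambda>_. 0) = 0" by (simp add: D_def)
  next
    fix k :: "nat \<Rightarrow> int" assume kB: "\<And>i. i < n \<Longrightarrow> \<bar>k i\<bar> \<le> B" and mx: "\<And>j. j \<in> {1..<n} \<Longrightarrow> k j \<le> k 0"
    \<comment> \<open>Since \<open>E\<close> is linear in the family \<open>F\<close>, it can be
      applied pointwise before taking either mean, and afterwards to the difference
      \<open>D\<close>.\<close>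
    define E where "E F = of_int (k 0) * F k + (\<Sum>j\<in>{1..<n}. (\<Sum>l<nat (k 0 - k j). F (move k j l) + F (move k j (Suc l))) / 2)" for F :: "(nat \<Rightarrow> int) \<Rightarrow> complex"
    have "E M = (\<integral>A. E (\<lambda>k. zmon_sym n k (eigvals n A)) \<partial>\<mu>)"
      unfolding E_def M_def by (simp add: int Bochner_Integration.integral_sum Bochner_Integration.integrable_sum)
    also have "\<dots> = (\<integral>A. dunkl_mon_sym n k (eigvals n A) \<partial>\<mu>)"
    proof (rule Bochner_Integration.integral_cong[OF refl])
      fix A assume "A \<in> space \<mu>"
      then have "eigvals n A i \<noteq> 0" if "i < n" for i using eigvals(1)[of A n i] that sp by auto
      from dunkl_mon_sym_expand[of n "eigvals n A" k, OF this mx]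
      show "E (\<lambda>k. zmon_sym n k (eigvals n A)) = dunkl_mon_sym n k (eigvals n A)" by (simp add: E_def)
    qed
    also have "\<dots> = 0" using haar_dunkl_mon_sym[OF haar n] by blast
    finally have EM: "E M = 0" .
    define S where "S f = (\<Sum>z\<in>grid n N. weyl n z * f z) / of_nat N ^ n" for f
    have S_add: "S (\<lambda>z. f z + g z) = S f + S g" for f g
      by (simp add: S_def distrib_left sum.distrib add_divide_distrib)
    have S_cmult: "S (\<lambda>z. c * f z) = c * S f" for c f
      by (simp add: S_def sum_distrib_left mult_ac)
    have S_half: "S (\<lambda>z. f z / 2) = S f / 2" for f
      using S_cmult[of "1 / 2" f] by simp
    have S_0: "S (\<lambda>z. 0) = 0" by (simp add: S_def)
    have S_sum: "S (\<lambda>z. \<Sum>i\<in>I. f i z) = (\<Sum>i\<in>I. S (f i))" if "finite I" for f and I :: "nat set"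
      using that by (induction I rule: finite_induct) (simp_all add: S_0 S_add)
    have "E (grid_mean n N) = E (\<lambda>k. S (zmon n k))" by (simp add: E_def S_def grid_mean_def)
    also have "\<dots> = S (\<lambda>z. E (\<lambda>k. zmon n k z))"
      unfolding E_def by (simp add: S_add S_cmult S_half S_sum)
    also have "\<dots> = (\<Sum>z\<in>grid n N. weyl n z * E (\<lambda>k. zmon n k z)) / of_nat N ^ n" by (simp add: S_def)
    also have "(\<Sum>z\<in>grid n N. weyl n z * E (\<lambda>k. zmon n k z)) = (\<Sum>z\<in>grid n N. weyl n z * dunkl_mon n k z)"
    proof (rule sum.cong[OF refl])
      fix z assume z: "z \<in> grid n N"
      from dunkl_mon_expand[of n z k, OF grid_nz[OF N0 z] mx]
      show "weyl n z * E (\<lambda>k. zmon n k z) = weyl n z * dunkl_mon n k z" by (simp add: E_def)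
    qed
    also have "\<dots> = 0" by (rule grid_dunkl_mon[OF n]) (use kB[of 0] n N in auto)
    finally have EG: "E (grid_mean n N) = 0" by simp
    have "E D = E M - E (grid_mean n N)"
      unfolding E_def D_def by (simp add: sum_subtractf sum.distrib algebra_simps add_divide_distrib diff_divide_distrib)
    then show "of_int (k 0) * D k + (\<Sum>j\<in>{1..<n}. (\<Sum>l<nat (k 0 - k j). D (move k j l) + D (move k j (Suc l))) / 2) = 0"
      using EM EG by (simp add: E_def)
  qed
  then show ?thesis by (simp add: D_def M_def)
qed

text \<open>Both sides are linear combinations of moments: expand the product over eigenvalues into
  monomials, exchange Haar moments for grid means, and resum. Dimension 0 is separate, as there is
  no first variable to differentiate in.\<close>

lemma haar_heine:
  assumes haar: "haar_unitary n \<mu>" and c: "\<And>k. \<bar>k\<bar> > int d \<Longrightarrow> c k = 0"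
  shows "(\<integral>A. (\<Prod>x\<in>#eig A. \<Sum>k\<in>{- int d..int d}. c k * x powi k) \<partial>\<mu>) = toeplitz_det n c"
proof -
  interpret prob_space \<mu> using haar by (simp add: haar_unitary_def)
  have sets: "sets \<mu> = sets (unitary_borel n)" using haar by (simp add: haar_unitary_def)
  have sp: "space \<mu> = unitary_group n" using sets_eq_imp_space_eq[OF sets] by (simp add: space_unitary_borel)
  define g where "g x = (\<Sum>k\<in>{- int d..int d}. c k * x powi k)" for x
  have prod_eig: "(\<Prod>x\<in>#eig A. g x) = (\<Prod>i<n. g (eigvals n A i))" if "A \<in> space \<mu>" for A
    using eigvals(2)[of A n] that sp by (simp add: o_def multiset.map_comp prod_unfold_prod_mset)
  show ?thesis
  proof (cases "n = 0")
    case True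
    have "(\<integral>A. (\<Prod>x\<in>#eig A. g x) \<partial>\<mu>) = (\<integral>A. 1 \<partial>\<mu>)"
      by (rule Bochner_Integration.integral_cong[OF refl]) (simp add: prod_eig True)
    then show ?thesis using True by (simp add: prob_space toeplitz_det_def g_def)
  next
    case False
    then have n: "n \<ge> 1" by simp
    \<comment> \<open>The smallest grid that satisfies both \<open>haar_moment\<close> with bound
      \<open>d\<close> and \<open>heine_grid\<close>.\<close>
    define N where "N = n + d + 1"
    have N: "int n + int d < int N" "N > 0" by (auto simp: N_def)
    let ?K = "PiE {..<n} (\<lambda>_. {- int d..int d})"
    have expand: "(\<Prod>i<n. g (z i)) = (\<Sum>k\<in>?K. (\<Prod>i<n. c (k i)) * zmon n k z)" for z
    proof -
      have "(\<Prod>i<n. g (z i)) = (\<Sum>k\<in>?K. \<Prod>i<n. c (k i) * z i powi k i)"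
        unfolding g_def by (rule prod_sum_PiE) auto
      then show ?thesis by (simp add: zmon_def prod.distrib)
    qed
    have sym: "fact n * (\<Prod>i<n. g (z i)) = (\<Sum>k\<in>?K. (\<Prod>i<n. c (k i)) * zmon_sym n k z)" for z
    proof -
      have "(\<Sum>k\<in>?K. (\<Prod>i<n. c (k i)) * zmon_sym n k z) = (\<Sum>\<sigma> | \<sigma> permutes {..<n}. \<Prod>i<n. g ((z \<circ> \<sigma>) i))"
        unfolding expand zmon_sym_def sum_distrib_left by (rule sum.swap)
      also have "\<dots> = (\<Sum>\<sigma> | \<sigma> permutes {..<n}. \<Prod>i<n. g (z i))"
      proof (rule sum.cong[OF refl])
        fix \<sigma> assume "\<sigma> \<in> {\<sigma>. \<sigma> permutes {..<n}}"
        then show "(\<Prod>i<n. g ((z \<circ> \<sigma>) i)) = (\<Prod>i<n. g (z i))"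
          using prod.permute[of \<sigma> "{..<n}" "\<lambda>i. g (z i)"] by (simp add: o_def)
      qed
      finally show ?thesis by (simp add: card_permutations)
    qed
    have int: "integrable \<mu> (\<lambda>A. zmon_sym n k (eigvals n A))" for k
      using zmon_sym_measurable[OF n, of k] norm_zmon_sym[of n "eigvals n _" k, OF eigvals(1)]
      by (intro integrable_const_bound[of _ "fact n"]) (auto simp: sp measurable_cong_sets[OF sets refl])
    have "fact n * (\<integral>A. (\<Prod>x\<in>#eig A. g x) \<partial>\<mu>) = (\<integral>A. fact n * (\<Prod>i<n. g (eigvals n A i)) \<partial>\<mu>)"
      by (subst integral_mult_right_zero[symmetric], rule Bochner_Integration.integral_cong[OF refl]) (simp add: prod_eig)
    also have "\<dots> = (\<Sum>k\<in>?K. (\<Prod>i<n. c (k i)) * (\<integral>A. zmon_sym n k (eigvals n A) \<partial>\<mu>))"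
      unfolding sym by (simp add: Bochner_Integration.integral_sum int)
    also have "\<dots> = (\<Sum>k\<in>?K. (\<Prod>i<n. c (k i)) * grid_mean n N k)"
    proof (rule sum.cong[OF refl])
      fix k assume k: "k \<in> ?K"
      have "\<bar>k i\<bar> \<le> int d" if "i < n" for i using PiE_mem[OF k, of i] that by auto
      from haar_moment[OF haar n N(1) _ this]
      show "(\<Prod>i<n. c (k i)) * (\<integral>A. zmon_sym n k (eigvals n A) \<partial>\<mu>) = (\<Prod>i<n. c (k i)) * grid_mean n N k" by simp
    qed
    also have "\<dots> = (\<Sum>z\<in>grid n N. weyl n z * (\<Prod>i<n. g (z i))) / of_nat N ^ n"
      unfolding expand grid_mean_def times_divide_eq_right sum_divide_distrib[symmetric] sum_distrib_left
      by (subst sum.swap) (simp only: mult_ac)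
    also have "\<dots> = fact n * toeplitz_det n c"
    proof -
      have "(\<Sum>z\<in>grid n N. weyl n z * (\<Prod>i<n. g (z i))) = of_nat N ^ n * fact n * toeplitz_det n c"
        unfolding g_def by (rule heine_grid[OF N(1)]) (rule c)
      then show ?thesis using N(2) by simp
    qed
    finally show ?thesis by (simp add: g_def)
  qed
qed

subsection \<open>Laws of random multisets on the circle\<close>

definition mcount :: "complex set \<Rightarrow> complex multiset \<Rightarrow> nat" where
  "mcount B X = size {#z \<in># X. z \<in> B#}"

lemma mcount_simps [simp]:
  "mcount B {#} = 0"
  "mcount B (add_mset x X) = mcount B X + (if x \<in> B then 1 else 0)"
  "mcount B (X + Y) = mcount B X + mcount B Y"
  by (simp_all add: mcount_def)

lemma space_multiset_borel [simp]: "space multiset_borel = UNIV"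
  by (simp add: multiset_borel_def)

lemma mcount_vimage_sets: "B \<in> sets borel \<Longrightarrow> {X. mcount B X = k} \<in> sets multiset_borel"
  unfolding multiset_borel_def mcount_def by (auto intro!: sigma_sets.Basic)

lemma mcount_measurable: "B \<in> sets borel \<Longrightarrow> mcount B \<in> multiset_borel \<rightarrow>\<^sub>M count_space UNIV"
  unfolding measurable_count_space_eq2_countable
  using mcount_vimage_sets[of B] by (auto simp: vimage_def)

lemma real_mcount_sums:
  assumes "disjoint_family A"
  shows "(\<lambda>i. real (mcount (A i) X)) sums real (mcount (\<Union>i. A i) X)"
proof (induction X)
  case (add x X)
  have "(\<lambda>i. indicator (A i) x :: real) sums indicator (\<Union>i. A i) x"
    by (rule indicator_sums) (use assms in \<open>auto simp: disjoint_family_on_def\<close>)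
  moreover have "real (mcount B (add_mset x X)) = real (mcount B X) + indicator B x" for B by simp
  ultimately show ?case using sums_add[OF add.IH] by (simp only:)
qed simp

text \<open>Closed sets form a generator of the Borel sets that is stable under intersection, and
  counts are additive over disjoint unions. Complements use the count of the whole plane, which is
  itself closed.\<close>

lemma measurable_multiset_borelI:
  assumes "\<And>C. closed C \<Longrightarrow> (\<lambda>\<omega>. real (mcount C (Q \<omega>))) \<in> borel_measurable M"
  shows "Q \<in> M \<rightarrow>\<^sub>M multiset_borel"
proof -
  have real: "(\<lambda>\<omega>. real (mcount B (Q \<omega>))) \<in> borel_measurable M" if "B \<in> sets borel" for B
  proof -
    have "Int_stable (Collect closed :: complex set set)" by (auto simp: Int_stable_def)
    moreover have "(Collect closed :: complex set set) \<subseteq> Pow UNIV" by simp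
    moreover have "B \<in> sigma_sets UNIV (Collect closed)"
      using that borel_eq_closed by (metis Pow_UNIV sets_measure_of subset_UNIV)
    ultimately show ?thesis
    proof (induction rule: sigma_sets_induct_disjoint)
      case (basic A)
      then show ?case using assms by simp
    next
      case empty
      show ?case by (simp add: mcount_def)
    next
      case (compl A)
      have "real (mcount (UNIV - A) X) = real (mcount UNIV X) - real (mcount A X)" for X
        by (induction X) auto
      then show ?case using compl assms[of UNIV] by simp
    next
      case (union A)
      have "(\<lambda>\<omega>. \<Sum>i. real (mcount (A i) (Q \<omega>))) \<in> borel_measurable M"
        using union by (intro borel_measurable_suminf) auto
      then show ?case using real_mcount_sums[OF union(1), THEN sums_unique] by simp
    qed
  qed
  show ?thesis
    unfolding multiset_borel_def
  proof (rule measurable_measure_of)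
    fix y assume "y \<in> {{X. size {#z \<in># X. z \<in> B#} = k} |B k. B \<in> sets (borel :: complex measure)}"
    then obtain B k where y: "y = {X. mcount B X = k}" and B: "B \<in> sets borel" by (auto simp: mcount_def)
    have "(\<lambda>\<omega>. real (mcount B (Q \<omega>))) -` {real k} \<inter> space M \<in> sets M"
      by (rule measurable_sets[OF real[OF B]]) simp
    then show "Q -` y \<inter> space M \<in> sets M" by (simp add: y vimage_def)
  qed auto
qed

text \<open>For a simple function the product is a finite product of its values raised to counts; a
  general \<open>g\<close> is a pointwise limit of simple functions.\<close>

lemma prod_mset_measurable:
  fixes g :: "complex \<Rightarrow> complex"
  assumes g: "g \<in> borel_measurable borel"
  shows "(\<lambda>X. \<Prod>x\<in>#X. g x) \<in> borel_measurable multiset_borel"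
proof -
  obtain F :: "nat \<Rightarrow> complex \<Rightarrow> complex" where F: "\<And>i. simple_function borel (F i)" "\<And>x. (\<lambda>i. F i x) \<longlonglongrightarrow> g x"
    using borel_measurable_implies_sequence_metric[OF g, of 0] by auto
  have "(\<lambda>X. \<Prod>x\<in>#X. F i x) \<in> borel_measurable multiset_borel" for i
  proof -
    have fin: "finite (range (F i))" using F(1)[of i] by (simp add: simple_function_def)
    have B: "F i -` {v} \<in> sets borel" for v
      using measurable_sets[OF borel_measurable_simple_function[OF F(1)[of i]], of "{v}"] by simp
    have "(\<Prod>x\<in>#X. F i x) = (\<Prod>v\<in>range (F i). v ^ mcount (F i -` {v}) X)" for X
    proof (induction X)
      case (add x X)
      have "(\<Prod>v\<in>range (F i). v ^ mcount (F i -` {v}) (add_mset x X))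
          = (\<Prod>v\<in>range (F i). (if v = F i x then F i x else 1) * v ^ mcount (F i -` {v}) X)"
        by (intro prod.cong) auto
      then show ?case using add fin by (simp add: prod.distrib)
    qed simp
    moreover have "(\<lambda>X. \<Prod>v\<in>range (F i). v ^ mcount (F i -` {v}) X) \<in> borel_measurable multiset_borel"
      by (intro borel_measurable_prod measurable_compose[OF mcount_measurable[OF B]]) simp
    ultimately show ?thesis by simp
  qed
  moreover have "(\<lambda>i. \<Prod>x\<in>#X. F i x) \<longlonglongrightarrow> (\<Prod>x\<in>#X. g x)" for X
    by (induction X) (auto intro!: tendsto_mult F(2))
  ultimately show ?thesis by (rule borel_measurable_LIMSEQ_metric)
qed

section \<open>Laurent polynomials on the circle and approximation\<close>

definition circle_laurent :: "(complex \<Rightarrow> complex) \<Rightarrow> bool" where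
  "circle_laurent f \<longleftrightarrow> (\<exists>d P. \<forall>z. norm z = 1 \<longrightarrow> f z = inverse z ^ d * poly P z)"

lemma circle_laurent_const: "circle_laurent (\<lambda>_. c)"
  unfolding circle_laurent_def by (intro exI[of _ 0] exI[of _ "[:c:]"]) simp

lemma circle_laurent_mult:
  assumes "circle_laurent f" "circle_laurent g"
  shows "circle_laurent (\<lambda>z. f z * g z)"
proof -
  obtain d P e Q where "\<And>z. norm z = 1 \<Longrightarrow> f z = inverse z ^ d * poly P z" "\<And>z. norm z = 1 \<Longrightarrow> g z = inverse z ^ e * poly Q z"
    using assms unfolding circle_laurent_def by blast
  then show ?thesis unfolding circle_laurent_def
    by (intro exI[of _ "d + e"] exI[of _ "P * Q"]) (simp add: power_add)
qed

lemma circle_laurent_add: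
  assumes "circle_laurent f" "circle_laurent g"
  shows "circle_laurent (\<lambda>z. f z + g z)"
proof -
  obtain d P e Q where f: "\<And>z. norm z = 1 \<Longrightarrow> f z = inverse z ^ d * poly P z" and g: "\<And>z. norm z = 1 \<Longrightarrow> g z = inverse z ^ e * poly Q z"
    using assms unfolding circle_laurent_def by blast
  have "f z + g z = inverse z ^ (d + e) * poly (monom 1 e * P + monom 1 d * Q) z" if "norm z = 1" for z
  proof -
    have "z \<noteq> 0" using that by auto
    then have "inverse z ^ k * z ^ k = 1" for k by (simp add: power_mult_distrib[symmetric])
    moreover have "inverse z ^ (d + e) * poly (monom 1 e * P + monom 1 d * Q) z
        = inverse z ^ d * poly P z * (inverse z ^ e * z ^ e) + inverse z ^ e * poly Q z * (inverse z ^ d * z ^ d)"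
      by (simp add: poly_monom power_add algebra_simps)
    ultimately show ?thesis by (simp add: f g that)
  qed
  then show ?thesis unfolding circle_laurent_def by blast
qed

lemma circle_laurent_Re: "circle_laurent (\<lambda>z. of_real (Re z))"
proof -
  have "of_real (Re z) = inverse z ^ 1 * poly [:1 / 2, 0, 1 / 2:] z" if "norm z = 1" for z
  proof -
    have "z \<noteq> 0" using that by auto
    have "of_real (Re z) = (z + cnj z) / 2" by (simp add: complex_add_cnj)
    also have "\<dots> = inverse z ^ 1 * poly [:1 / 2, 0, 1 / 2:] z"
      using cnj_unit[OF that] \<open>z \<noteq> 0\<close> by (simp add: field_simps)
    finally show ?thesis .
  qed
  then show ?thesis unfolding circle_laurent_def by blast
qed

lemma circle_laurent_Im: "circle_laurent (\<lambda>z. of_real (Im z))"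
proof -
  have "of_real (Im z) = inverse z ^ 1 * poly [:\<i> / 2, 0, - \<i> / 2:] z" if "norm z = 1" for z
  proof -
    have "z \<noteq> 0" using that by auto
    have "of_real (Im z) = (z - cnj z) / (2 * \<i>)" by (simp add: complex_diff_cnj) (simp add: complex_eq_iff)
    also have "\<dots> = inverse z ^ 1 * poly [:\<i> / 2, 0, - \<i> / 2:] z"
      using cnj_unit[OF that] \<open>z \<noteq> 0\<close> by (simp add: field_simps)
    finally show ?thesis .
  qed
  then show ?thesis unfolding circle_laurent_def by blast
qed

text \<open>Conjugation on the circle is inversion, so real and imaginary parts, and with them all
  real polynomials in two real variables, restrict to Laurent polynomials. This is how
  Stone--Weierstrass becomes applicable.\<close>

lemma circle_laurent_real_polynomial:
  "real_polynomial_function p \<Longrightarrow> circle_laurent (\<lambda>z. of_real (p z))"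
proof (induction rule: real_polynomial_function.induct)
  case (linear f)
  then interpret bounded_linear f .
  have "f z = Re z * f 1 + Im z * f \<i>" for z
  proof -
    have "z = Re z *\<^sub>R 1 + Im z *\<^sub>R \<i>" by (simp add: complex_eq_iff)
    then have "f z = f (Re z *\<^sub>R 1 + Im z *\<^sub>R \<i>)" by simp
    then show ?thesis unfolding add scaleR by simp
  qed
  then have "(\<lambda>z. complex_of_real (f z)) = (\<lambda>z. of_real (Re z) * of_real (f 1) + of_real (Im z) * of_real (f \<i>))"
    by (metis of_real_add of_real_mult)
  then show ?case
    by (simp only:) (intro circle_laurent_add circle_laurent_mult circle_laurent_Re circle_laurent_Im circle_laurent_const)
next
  case (const c)
  then show ?case by (rule circle_laurent_const)
next
  case (add f g)
  then show ?case using circle_laurent_add by simp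
next
  case (mult f g)
  then show ?case using circle_laurent_mult by simp
qed

definition laurent :: "nat \<Rightarrow> (int \<Rightarrow> complex) \<Rightarrow> complex \<Rightarrow> complex" where
  "laurent d c z = (\<Sum>k\<in>{- int d..int d}. c k * z powi k)"

lemma circle_laurentE:
  assumes "circle_laurent f"
  obtains d c where "\<And>k. \<bar>k\<bar> > int d \<Longrightarrow> c k = 0" "\<And>z. norm z = 1 \<Longrightarrow> f z = laurent d c z"
proof -
  obtain d P where f: "\<And>z. norm z = 1 \<Longrightarrow> f z = inverse z ^ d * poly P z"
    using assms unfolding circle_laurent_def by blast
  define D where "D = d + degree P"
  define c where "c k = (if - int d \<le> k \<and> k \<le> int (degree P) - int d then coeff P (nat (k + int d)) else 0)" for k
  have "f z = laurent D c z" if z: "norm z = 1" for z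
  proof -
    have nz: "z \<noteq> 0" using z by auto
    have "laurent D c z = (\<Sum>k\<in>{- int d..int (degree P) - int d}. c k * z powi k)"
      unfolding laurent_def by (rule sum.mono_neutral_right) (auto simp: c_def D_def)
    also have "\<dots> = (\<Sum>l\<le>degree P. coeff P l * z powi (int l - int d))"
      by (rule sum.reindex_bij_witness[of _ "\<lambda>l. int l - int d" "\<lambda>k. nat (k + int d)"]) (auto simp: c_def)
    also have "\<dots> = inverse z ^ d * poly P z"
      unfolding poly_altdef sum_distrib_left
      by (intro sum.cong refl) (use nz in \<open>simp add: power_int_diff field_simps\<close>)
    finally show ?thesis by (simp add: f z)
  qed
  moreover have "c k = 0" if "\<bar>k\<bar> > int D" for k using that by (auto simp: c_def D_def)
  ultimately show ?thesis using that by blast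
qed

lemma laurent_approximation:
  fixes h :: "complex \<Rightarrow> real"
  assumes "continuous_on (sphere 0 1) h" "e > 0"
  obtains d c where "\<And>k. \<bar>k\<bar> > int d \<Longrightarrow> c k = 0" "\<And>z. norm z = 1 \<Longrightarrow> norm (laurent d c z - of_real (h z)) < e"
proof -
  obtain p where p: "real_polynomial_function p" "\<And>x. x \<in> sphere 0 1 \<Longrightarrow> \<bar>h x - p x\<bar> < e"
    using Stone_Weierstrass_real_polynomial_function[OF compact_sphere assms] by blast
  obtain d c where c: "\<And>k. \<bar>k\<bar> > int d \<Longrightarrow> c k = 0" "\<And>z. norm z = 1 \<Longrightarrow> of_real (p z) = laurent d c z"
    using circle_laurentE[OF circle_laurent_real_polynomial[OF p(1)]] by metis
  have "norm (laurent d c z - of_real (h z)) < e" if "norm z = 1" for z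
  proof -
    have "norm (laurent d c z - of_real (h z)) = \<bar>p z - h z\<bar>"
      using c(2)[OF that] by (metis norm_of_real of_real_diff)
    then show ?thesis using p(2)[of z] that by (simp add: abs_minus_commute)
  qed
  with c(1) that show ?thesis by blast
qed

lemma laurent_measurable: "laurent d c \<in> borel_measurable borel"
proof -
  have "(\<lambda>z::complex. z powi k) \<in> borel_measurable borel" for k
    unfolding power_int_def by measurable
  then show ?thesis unfolding laurent_def[abs_def] by (intro borel_measurable_sum borel_measurable_times) auto
qed

text \<open>Continuous approximations of the indicator of a closed set. The empty set needs its own
  case because \<open>infdist\<close> to it is 0 by convention.\<close>

definition bump :: "complex set \<Rightarrow> nat \<Rightarrow> complex \<Rightarrow> real" where
  "bump C m z = (if C = {} then 0 else max 0 (1 - real m * infdist z C))"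

lemma bump_bounds: "0 \<le> bump C m z" "bump C m z \<le> 1"
  unfolding bump_def using infdist_nonneg[of z C] by (auto simp: max_def)

lemma continuous_on_bump: "continuous_on S (bump C m)"
  unfolding bump_def[abs_def]
  by (cases "C = {}") (auto intro!: continuous_intros)

lemma bump_tendsto:
  assumes "closed C"
  shows "(\<lambda>m. bump C m z) \<longlonglongrightarrow> indicator C z"
proof (cases "z \<in> C")
  case True
  then have "bump C m z = 1" for m using infdist_zero[OF True] by (auto simp: bump_def)
  then show ?thesis using True by simp
next
  case False
  show ?thesis
  proof (cases "C = {}")
    case True
    then show ?thesis by (simp add: bump_def)
  next
    case ne: False
    then have pos: "infdist z C > 0" using False assms in_closed_iff_infdist_zero[OF assms ne, of z] infdist_nonneg[of z C] by linarith
    obtain m0 where m0: "1 < real m0 * infdist z C" using reals_Archimedean3[OF pos] by blast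
    have "bump C m z = 0" if "m \<ge> m0" for m
    proof -
      have "real m0 * infdist z C \<le> real m * infdist z C" using that pos by (intro mult_right_mono) auto
      then show ?thesis using m0 by (simp add: bump_def)
    qed
    then have "eventually (\<lambda>m. bump C m z = indicator C z) sequentially"
      using False unfolding eventually_sequentially by (intro exI[of _ m0]) auto
    then show ?thesis by (rule tendsto_eventually)
  qed
qed

text \<open>For bounded variables the generating functions are polynomials with the probabilities as
  coefficients, and agreement on the positive reals, an infinite set, makes them equal.\<close>

lemma pgf_unique:
  fixes Y :: "'a \<Rightarrow> nat" and Y' :: "'b \<Rightarrow> nat"
  assumes "prob_space M" "prob_space M'"
    and Y: "Y \<in> M \<rightarrow>\<^sub>M count_space UNIV" and Y': "Y' \<in> M' \<rightarrow>\<^sub>M count_space UNIV"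
    and K: "\<And>\<omega>. \<omega> \<in> space M \<Longrightarrow> Y \<omega> \<le> K" "\<And>\<omega>. \<omega> \<in> space M' \<Longrightarrow> Y' \<omega> \<le> K"
    and eq: "\<And>x::real. x > 0 \<Longrightarrow> (\<integral>\<omega>. x ^ Y \<omega> \<partial>M) = (\<integral>\<omega>. x ^ Y' \<omega> \<partial>M')"
  shows "measure M {\<omega>\<in>space M. Y \<omega> = y} = measure M' {\<omega>\<in>space M'. Y' \<omega> = y}"
proof -
  have pgf: "(\<integral>\<omega>. x ^ Z \<omega> \<partial>N) = poly (\<Sum>y\<le>K. monom (measure N {\<omega>\<in>space N. Z \<omega> = y}) y) x"
    if N: "prob_space N" and Z: "Z \<in> N \<rightarrow>\<^sub>M count_space UNIV" and ZK: "\<And>\<omega>. \<omega> \<in> space N \<Longrightarrow> Z \<omega> \<le> K"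
    for N :: "'c measure" and Z :: "'c \<Rightarrow> nat" and x :: real
  proof -
    interpret N: prob_space N by (rule N)
    have meas: "{\<omega>\<in>space N. Z \<omega> = y} \<in> sets N" for y
      using measurable_sets[OF Z, of "{y}"] by (simp add: vimage_def Int_def conj_commute)
    have "(\<integral>\<omega>. x ^ Z \<omega> \<partial>N) = (\<integral>\<omega>. (\<Sum>y\<le>K. indicator {\<omega>\<in>space N. Z \<omega> = y} \<omega> * x ^ y) \<partial>N)"
    proof (rule Bochner_Integration.integral_cong[OF refl])
      fix \<omega> assume \<omega>: "\<omega> \<in> space N"
      have "(\<Sum>y\<le>K. indicator {\<omega>\<in>space N. Z \<omega> = y} \<omega> * x ^ y) = (\<Sum>y\<le>K. if y = Z \<omega> then x ^ y else 0)"
        using \<omega> by (intro sum.cong refl) (auto simp: indicator_def)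
      then show "x ^ Z \<omega> = (\<Sum>y\<le>K. indicator {\<omega>\<in>space N. Z \<omega> = y} \<omega> * x ^ y)" using ZK[OF \<omega>] by simp
    qed
    also have "\<dots> = (\<Sum>y\<le>K. measure N {\<omega>\<in>space N. Z \<omega> = y} * x ^ y)"
      using meas by (subst Bochner_Integration.integral_sum) (auto simp: N.emeasure_eq_measure)
    finally show ?thesis by (simp add: poly_sum poly_monom)
  qed
  define p where "p = (\<Sum>y\<le>K. monom (measure M {\<omega>\<in>space M. Y \<omega> = y}) y)"
  define q where "q = (\<Sum>y\<le>K. monom (measure M' {\<omega>\<in>space M'. Y' \<omega> = y}) y)"
  have "poly p x = poly q x" if "x > 0" for x
    using eq[OF that] pgf[OF assms(1) Y K(1)] pgf[OF assms(2) Y' K(2)] by (simp add: p_def q_def)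
  then have "{0<..} \<subseteq> {x. poly (p - q) x = 0}" by auto
  moreover have "infinite {0::real<..}" by (simp add: infinite_Ioi)
  ultimately have "p - q = 0" using poly_roots_finite[of "p - q"] finite_subset by blast
  then have pq: "coeff p y = coeff q y" for y by simp
  show ?thesis
  proof (cases "y \<le> K")
    case True
    then show ?thesis using pq[of y] by (simp add: p_def q_def coeff_sum)
  next
    case False
    then have e: "{\<omega>\<in>space M. Y \<omega> = y} = {}" "{\<omega>\<in>space M'. Y' \<omega> = y} = {}" using K by auto
    show ?thesis unfolding e by simp
  qed
qed

lemma digits_unique:
  fixes a b :: "nat \<Rightarrow> nat"
  assumes "\<And>j. j < r \<Longrightarrow> a j \<le> n" "\<And>j. j < r \<Longrightarrow> b j \<le> n"
    and "(\<Sum>j<r. (n + 1) ^ j * a j) = (\<Sum>j<r. (n + 1) ^ j * b j)"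
  shows "j < r \<Longrightarrow> a j = b j"
  using assms
proof (induction r arbitrary: a b j)
  case (Suc r)
  have shift: "(\<Sum>j<Suc r. (n + 1) ^ j * a j) = a 0 + (n + 1) * (\<Sum>j<r. (n + 1) ^ j * a (Suc j))" for a
    unfolding sum.lessThan_Suc_shift sum_distrib_left by (simp only: power_0 power_Suc mult.assoc mult_1_left)
  have eq: "a 0 + (n + 1) * (\<Sum>j<r. (n + 1) ^ j * a (Suc j)) = b 0 + (n + 1) * (\<Sum>j<r. (n + 1) ^ j * b (Suc j))"
    using Suc.prems(4) unfolding shift .
  have "a 0 < n + 1" "b 0 < n + 1" using Suc.prems(2,3)[of 0] by auto
  then have 0: "a 0 = b 0"
    using arg_cong[OF eq, of "\<lambda>x. x mod (n + 1)"] by (simp only: mod_mult_self2 mod_less)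
  then have "(n + 1) * (\<Sum>j<r. (n + 1) ^ j * a (Suc j)) = (n + 1) * (\<Sum>j<r. (n + 1) ^ j * b (Suc j))"
    using eq by (simp only: add_left_cancel)
  then have "(\<Sum>j<r. (n + 1) ^ j * a (Suc j)) = (\<Sum>j<r. (n + 1) ^ j * b (Suc j))"
    by (rule mult_left_cancel[THEN iffD1, rotated]) simp
  then have "a (Suc i) = b (Suc i)" if "i < r" for i
    using Suc.IH[of i "\<lambda>j. a (Suc j)" "\<lambda>j. b (Suc j)"] Suc.prems(2,3) that by simp
  then show ?case using 0 Suc.prems(1) by (cases j) auto
qed simp

section \<open>Laws of configurations of fixed size on the circle\<close>

definition circle_multisets :: "nat \<Rightarrow> complex multiset set" where
  "circle_multisets n = {X. size X = n \<and> (\<forall>x\<in>#X. norm x = 1)}"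

lemma norm_prod_mset_le:
  assumes "X \<in> circle_multisets n" "\<And>x. norm x = 1 \<Longrightarrow> norm (g x :: complex) \<le> B"
  shows "norm (\<Prod>x\<in>#X. g x) \<le> B ^ n"
proof -
  have B: "B \<ge> 0" using assms(2)[of 1] norm_ge_zero[of "g 1"] by (simp del: norm_ge_zero)
  have "(\<forall>x\<in>#X. norm x = 1) \<Longrightarrow> norm (\<Prod>x\<in>#X. g x) \<le> B ^ size X"
  proof (induction X)
    case (add x X)
    then show ?case using assms(2)[of x] B by (auto simp: norm_mult intro!: mult_mono)
  qed simp
  then show ?thesis using assms(1) by (auto simp: circle_multisets_def)
qed

text \<open>Dominated convergence; the fixed number \<open>n\<close> of points turns the bound
  \<open>B\<close> for the factors into the constant bound \<open>B ^ n\<close>.\<close>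

lemma integral_prod_limit:
  fixes g :: "complex \<Rightarrow> complex" and f :: "nat \<Rightarrow> complex \<Rightarrow> complex"
  assumes "prob_space M" and X: "X \<in> M \<rightarrow>\<^sub>M multiset_borel" and n: "\<And>\<omega>. \<omega> \<in> space M \<Longrightarrow> X \<omega> \<in> circle_multisets n"
    and f: "\<And>m. f m \<in> borel_measurable borel" and g: "g \<in> borel_measurable borel"
    and bound: "\<And>m x. norm x = 1 \<Longrightarrow> norm (f m x) \<le> B"
    and lim: "\<And>x. norm x = 1 \<Longrightarrow> (\<lambda>m. f m x) \<longlonglongrightarrow> g x"
  shows "(\<lambda>m. \<integral>\<omega>. (\<Prod>x\<in>#X \<omega>. f m x) \<partial>M) \<longlonglongrightarrow> (\<integral>\<omega>. (\<Prod>x\<in>#X \<omega>. g x) \<partial>M)"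
proof (rule integral_dominated_convergence[where w = "\<lambda>_. B ^ n"])
  interpret prob_space M by fact
  show "(\<lambda>\<omega>. \<Prod>x\<in>#X \<omega>. g x) \<in> borel_measurable M"
    by (rule measurable_compose[OF X prod_mset_measurable[OF g]])
  show "(\<lambda>\<omega>. \<Prod>x\<in>#X \<omega>. f m x) \<in> borel_measurable M" for m
    by (rule measurable_compose[OF X prod_mset_measurable[OF f]])
  show "integrable M (\<lambda>_. B ^ n)" by simp
  show "AE \<omega> in M. norm (\<Prod>x\<in>#X \<omega>. f m x) \<le> B ^ n" for m
    using n bound by (intro AE_I2 norm_prod_mset_le) auto
  show "AE \<omega> in M. (\<lambda>m. \<Prod>x\<in>#X \<omega>. f m x) \<longlonglongrightarrow> (\<Prod>x\<in>#X \<omega>. g x)"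
  proof (rule AE_I2)
    fix \<omega> assume "\<omega> \<in> space M"
    then have "\<forall>x\<in>#X \<omega>. norm x = 1" using n by (auto simp: circle_multisets_def)
    moreover have "(\<forall>x\<in>#Z. norm x = 1) \<Longrightarrow> (\<lambda>m. \<Prod>x\<in>#Z. f m x) \<longlonglongrightarrow> (\<Prod>x\<in>#Z. g x)" for Z
    proof (induction Z)
      case (add x Z)
      then show ?case using tendsto_mult[OF lim[of x] add.IH] by simp
    qed simp
    ultimately show "(\<lambda>m. \<Prod>x\<in>#X \<omega>. f m x) \<longlonglongrightarrow> (\<Prod>x\<in>#X \<omega>. g x)" by blast
  qed
qed

text \<open>Collects what is known about the two sides of the theorem: both have \<open>n\<close>
  points on the circle, and products of a Laurent polynomial over the points have the same mean.
  Equality in law is derived from this alone.\<close>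

locale multiset_pair =
  M: prob_space M + M': prob_space M' for M :: "'a measure" and M' :: "'b measure" +
  fixes X :: "'a \<Rightarrow> complex multiset" and Y :: "'b \<Rightarrow> complex multiset" and n :: nat
  assumes X: "X \<in> M \<rightarrow>\<^sub>M multiset_borel" and Y: "Y \<in> M' \<rightarrow>\<^sub>M multiset_borel"
    and Xn: "\<And>\<omega>. \<omega> \<in> space M \<Longrightarrow> X \<omega> \<in> circle_multisets n"
    and Yn: "\<And>\<omega>. \<omega> \<in> space M' \<Longrightarrow> Y \<omega> \<in> circle_multisets n"
    and laurent_eq: "\<And>d c. (\<And>k. \<bar>k\<bar> > int d \<Longrightarrow> c k = 0) \<Longrightarrow>
      (\<integral>\<omega>. (\<Prod>x\<in>#X \<omega>. laurent d c x) \<partial>M) = (\<integral>\<omega>. (\<Prod>x\<in>#Y \<omega>. laurent d c x) \<partial>M')"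
begin

lemma limit_eq:
  fixes g :: "complex \<Rightarrow> complex" and f :: "nat \<Rightarrow> complex \<Rightarrow> complex"
  assumes f: "\<And>m. f m \<in> borel_measurable borel" and g: "g \<in> borel_measurable borel"
    and bound: "\<And>m x. norm x = 1 \<Longrightarrow> norm (f m x) \<le> B"
    and lim: "\<And>x. norm x = 1 \<Longrightarrow> (\<lambda>m. f m x) \<longlonglongrightarrow> g x"
    and eq: "\<And>m. (\<integral>\<omega>. (\<Prod>x\<in>#X \<omega>. f m x) \<partial>M) = (\<integral>\<omega>. (\<Prod>x\<in>#Y \<omega>. f m x) \<partial>M')"
  shows "(\<integral>\<omega>. (\<Prod>x\<in>#X \<omega>. g x) \<partial>M) = (\<integral>\<omega>. (\<Prod>x\<in>#Y \<omega>. g x) \<partial>M')"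
proof (rule LIMSEQ_unique)
  show "(\<lambda>m. \<integral>\<omega>. (\<Prod>x\<in>#X \<omega>. f m x) \<partial>M) \<longlonglongrightarrow> (\<integral>\<omega>. (\<Prod>x\<in>#X \<omega>. g x) \<partial>M)"
    by (rule integral_prod_limit[OF M.prob_space_axioms X Xn f g bound lim])
  show "(\<lambda>m. \<integral>\<omega>. (\<Prod>x\<in>#X \<omega>. f m x) \<partial>M) \<longlonglongrightarrow> (\<integral>\<omega>. (\<Prod>x\<in>#Y \<omega>. g x) \<partial>M')"
    unfolding eq by (rule integral_prod_limit[OF M'.prob_space_axioms Y Yn f g bound lim])
qed

text \<open>Uniform approximation of \<open>h\<close> on the circle by Laurent polynomials, with
  error below \<open>1 / (m + 1)\<close>, keeps the factors bounded by \<open>B + 1\<close>, so the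
  limit passes through the means of products.\<close>

lemma continuous_eq:
  fixes h :: "complex \<Rightarrow> real"
  assumes h: "continuous_on UNIV h"
  shows "(\<integral>\<omega>. (\<Prod>x\<in>#X \<omega>. of_real (h x)) \<partial>M) = (\<integral>\<omega>. (\<Prod>x\<in>#Y \<omega>. complex_of_real (h x)) \<partial>M')"
proof -
  define approx where "approx m d c \<longleftrightarrow> (\<forall>k. \<bar>k\<bar> > int d \<longrightarrow> c k = 0) \<and>
    (\<forall>z. norm z = 1 \<longrightarrow> norm (laurent d c z - of_real (h z)) < inverse (real (Suc m)))" for m d c
  have "\<exists>d c. approx m d c" for m
  proof -
    have "inverse (real (Suc m)) > 0" by simp
    from laurent_approximation[OF continuous_on_subset[OF h subset_UNIV] this]
    obtain d c where "\<And>k. \<bar>k\<bar> > int d \<Longrightarrow> c k = 0" "\<And>z. norm z = 1 \<Longrightarrow> norm (laurent d c z - of_real (h z)) < inverse (real (Suc m))"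
      by blast
    then show ?thesis unfolding approx_def by blast
  qed
  then obtain d c where "\<And>m. approx m (d m) (c m)" by metis
  then have dc: "\<And>m k. \<bar>k\<bar> > int (d m) \<Longrightarrow> c m k = 0"
    "\<And>m z. norm z = 1 \<Longrightarrow> norm (laurent (d m) (c m) z - of_real (h z)) < inverse (real (Suc m))"
    unfolding approx_def by blast+
  obtain B where B: "\<And>z. norm z = 1 \<Longrightarrow> norm (h z) \<le> B"
  proof -
    have "compact (h ` sphere 0 1)"
      by (rule compact_continuous_image[OF continuous_on_subset[OF h] compact_sphere]) simp
    then obtain B where "\<forall>y\<in>h ` sphere 0 1. norm y \<le> B" using compact_imp_bounded bounded_iff by blast
    then show ?thesis by (intro that[of B]) (simp add: mem_sphere_0)
  qed
  show ?thesis
  proof (rule limit_eq[where f = "\<lambda>m. laurent (d m) (c m)" and B = "B + 1"])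
    show "laurent (d m) (c m) \<in> borel_measurable borel" for m by (rule laurent_measurable)
    show "(\<lambda>x. complex_of_real (h x)) \<in> borel_measurable borel"
      using borel_measurable_continuous_onI[OF h] by simp
    show "norm (laurent (d m) (c m) x) \<le> B + 1" if x: "norm x = 1" for m x
    proof -
      have "inverse (real (Suc m)) \<le> 1" by (simp add: field_simps)
      moreover have "norm (laurent (d m) (c m) x) \<le> norm (laurent (d m) (c m) x - of_real (h x)) + norm (complex_of_real (h x))"
        by (metis diff_add_cancel norm_triangle_ineq)
      ultimately show ?thesis using dc(2)[OF x, of m] B[OF x] by simp
    qed
    show "(\<lambda>m. laurent (d m) (c m) x) \<longlonglongrightarrow> complex_of_real (h x)" if x: "norm x = 1" for x
    proof -
      have "(\<lambda>m. laurent (d m) (c m) x - of_real (h x)) \<longlonglongrightarrow> 0"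
        by (rule Lim_null_comparison[OF _ LIMSEQ_inverse_real_of_nat]) (use dc(2)[OF x] in \<open>auto intro!: always_eventually less_imp_le\<close>)
      then show ?thesis by (rule LIM_zero_cancel)
    qed
    show "(\<integral>\<omega>. (\<Prod>x\<in>#X \<omega>. laurent (d m) (c m) x) \<partial>M) = (\<integral>\<omega>. (\<Prod>x\<in>#Y \<omega>. laurent (d m) (c m) x) \<partial>M')" for m
      by (rule laurent_eq[OF dc(1)])
  qed
qed

text \<open>Since no count exceeds \<open>n\<close>, the number \<open>w Z\<close> with base \<open>n + 1\<close> digits \<open>mcount (C j) Z\<close> encodes all
  counts at once.\<close>
lemma mcount_closed_eq:
  fixes C :: "nat \<Rightarrow> complex set" and x :: real
  assumes C: "\<And>j. j < r \<Longrightarrow> closed (C j)" and x: "x > 0"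
  defines "w \<equiv> \<lambda>Z. \<Sum>j<r. (n + 1) ^ j * mcount (C j) Z"
  shows "(\<integral>\<omega>. x ^ w (X \<omega>) \<partial>M) = (\<integral>\<omega>. x ^ w (Y \<omega>) \<partial>M')"
proof -
  define s where "s = ln x"
  have ex: "exp s = x" using x by (simp add: s_def)
  \<comment> \<open>An exponential of a weighted sum of indicators, multiplied over all points,
    becomes \<open>x\<close> to the weighted sum of counts; \<open>h m\<close> is its continuous
    approximation and \<open>g\<close> the limit.\<close>
  define h where "h m z = exp (s * (\<Sum>j<r. real ((n + 1) ^ j) * bump (C j) m z))" for m z
  define g where "g z = exp (s * (\<Sum>j<r. real ((n + 1) ^ j) * indicator (C j) z))" for z
  define B where "B = exp (\<bar>s\<bar> * (\<Sum>j<r. real ((n + 1) ^ j)))"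
  have prod_g: "(\<Prod>z\<in>#Z. complex_of_real (g z)) = complex_of_real (x ^ w Z)" for Z
  proof (induction Z)
    case (add z Z)
    have "w (add_mset z Z) = w Z + (\<Sum>j<r. (n + 1) ^ j * (if z \<in> C j then 1 else 0))"
      unfolding w_def by (simp add: distrib_left sum.distrib)
    moreover have "g z = x ^ (\<Sum>j<r. (n + 1) ^ j * (if z \<in> C j then 1 else 0))"
    proof -
      have "(\<Sum>j<r. real ((n + 1) ^ j) * indicator (C j) z) = real (\<Sum>j<r. (n + 1) ^ j * (if z \<in> C j then 1 else 0))"
        unfolding of_nat_sum by (intro sum.cong refl) (auto simp: indicator_def)
      then show ?thesis unfolding g_def ex[symmetric] by (simp add: exp_of_nat_mult[symmetric] mult.commute)
    qed
    ultimately show ?case using add by (simp add: power_add)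
  qed (simp add: w_def)
  have "(\<integral>\<omega>. (\<Prod>z\<in>#X \<omega>. complex_of_real (g z)) \<partial>M) = (\<integral>\<omega>. (\<Prod>z\<in>#Y \<omega>. complex_of_real (g z)) \<partial>M')"
  proof (rule limit_eq[where f = "\<lambda>m z. complex_of_real (h m z)" and B = B])
    have cont: "continuous_on UNIV (h m)" for m
      unfolding h_def[abs_def] by (intro continuous_intros continuous_on_bump)
    show "(\<lambda>z. complex_of_real (h m z)) \<in> borel_measurable borel" for m
      using borel_measurable_continuous_onI[OF cont[of m]] by simp
    have "indicator (C j) \<in> borel_measurable (borel :: complex measure)" if "j < r" for j
      using C[OF that] by (intro borel_measurable_indicator) auto
    then have "(\<lambda>z. s * (\<Sum>j<r. real ((n + 1) ^ j) * indicator (C j) z)) \<in> borel_measurable (borel :: complex measure)"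
      by (intro borel_measurable_times borel_measurable_sum borel_measurable_const) auto
    from measurable_compose[OF this borel_measurable_exp]
    have "g \<in> borel_measurable borel" by (simp only: g_def[abs_def])
    then show "(\<lambda>z. complex_of_real (g z)) \<in> borel_measurable borel" by simp
    show "norm (complex_of_real (h m z)) \<le> B" for m z
    proof -
      have b: "0 \<le> (\<Sum>j<r. real ((n + 1) ^ j) * bump (C j) m z)" "(\<Sum>j<r. real ((n + 1) ^ j) * bump (C j) m z) \<le> (\<Sum>j<r. real ((n + 1) ^ j))"
        using bump_bounds by (auto intro!: sum_nonneg sum_mono mult_left_le)
      have "s * (\<Sum>j<r. real ((n + 1) ^ j) * bump (C j) m z) \<le> \<bar>s\<bar> * (\<Sum>j<r. real ((n + 1) ^ j))"
        using b by (intro mult_mono) auto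
      then show ?thesis by (simp add: h_def B_def)
    qed
    show "(\<lambda>m. complex_of_real (h m z)) \<longlonglongrightarrow> complex_of_real (g z)" for z
      unfolding h_def g_def using C
      by (intro tendsto_of_real tendsto_exp tendsto_mult tendsto_const tendsto_sum bump_tendsto) auto
    show "(\<integral>\<omega>. (\<Prod>z\<in>#X \<omega>. complex_of_real (h m z)) \<partial>M) = (\<integral>\<omega>. (\<Prod>z\<in>#Y \<omega>. complex_of_real (h m z)) \<partial>M')" for m
      by (rule continuous_eq[OF cont])
  qed
  then have "complex_of_real (\<integral>\<omega>. x ^ w (X \<omega>) \<partial>M) = complex_of_real (\<integral>\<omega>. x ^ w (Y \<omega>) \<partial>M')"
    unfolding prod_g integral_complex_of_real .
  then show ?thesis by (simp only: of_real_eq_iff)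
qed

lemma mcount_le: "Z \<in> circle_multisets n \<Longrightarrow> mcount B Z \<le> n"
  unfolding mcount_def circle_multisets_def using size_mset_mono[OF multiset_filter_subset] by auto

text \<open>The generating function of the encoded number \<open>w\<close> determines its law, and
  \<open>w\<close> determines every count as a digit. If some \<open>k j\<close> exceeds
  \<open>n\<close>, both events are empty.\<close>

lemma joint_count_eq:
  fixes C :: "nat \<Rightarrow> complex set"
  assumes C: "\<And>j. j < r \<Longrightarrow> closed (C j)"
  shows "measure M {\<omega>\<in>space M. \<forall>j<r. mcount (C j) (X \<omega>) = k j} = measure M' {\<omega>\<in>space M'. \<forall>j<r. mcount (C j) (Y \<omega>) = k j}"
proof (cases "\<forall>j<r. k j \<le> n")
  case False
  then obtain j where j: "j < r" "\<not> k j \<le> n" by blast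
  have "mcount (C j) (X \<omega>) \<noteq> k j" if "\<omega> \<in> space M" for \<omega>
    using mcount_le[OF Xn[OF that], of "C j"] j by auto
  moreover have "mcount (C j) (Y \<omega>) \<noteq> k j" if "\<omega> \<in> space M'" for \<omega>
    using mcount_le[OF Yn[OF that], of "C j"] j by auto
  ultimately have e: "{\<omega>\<in>space M. \<forall>j<r. mcount (C j) (X \<omega>) = k j} = {}" "{\<omega>\<in>space M'. \<forall>j<r. mcount (C j) (Y \<omega>) = k j} = {}"
    using j(1) by blast+
  show ?thesis unfolding e by simp
next
  case True
  define w where "w Z = (\<Sum>j<r. (n + 1) ^ j * mcount (C j) Z)" for Z
  define y where "y = (\<Sum>j<r. (n + 1) ^ j * k j)"
  have iff: "(\<forall>j<r. mcount (C j) Z = k j) \<longleftrightarrow> w Z = y" if Z: "Z \<in> circle_multisets n" for Z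
  proof
    assume "w Z = y"
    then have eq: "(\<Sum>j<r. (n + 1) ^ j * mcount (C j) Z) = (\<Sum>j<r. (n + 1) ^ j * k j)"
      by (simp only: w_def y_def)
    show "\<forall>j<r. mcount (C j) Z = k j"
    proof (intro allI impI)
      fix j assume "j < r"
      then show "mcount (C j) Z = k j"
        using digits_unique[of r "\<lambda>j. mcount (C j) Z" n k j, OF mcount_le[OF Z] _ eq] True by blast
    qed
  qed (simp add: w_def y_def)
  define K where "K = (\<Sum>j<r. (n + 1) ^ j * n)"
  have wK: "w Z \<le> K" if "Z \<in> circle_multisets n" for Z
    unfolding w_def K_def using mcount_le[OF that] by (intro sum_mono mult_left_mono) auto
  have wm: "w \<in> multiset_borel \<rightarrow>\<^sub>M count_space UNIV"
  proof -
    have "(\<lambda>Z. real (w Z)) \<in> borel_measurable multiset_borel"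
      unfolding w_def of_nat_sum of_nat_mult
      by (intro borel_measurable_sum borel_measurable_times borel_measurable_const measurable_compose[OF mcount_measurable])
        (use C in auto)
    then have "(\<lambda>Z. real (w Z)) -` {real y} \<inter> space multiset_borel \<in> sets multiset_borel" for y
      by (rule measurable_sets) simp
    then show ?thesis unfolding measurable_count_space_eq2_countable by (auto simp: vimage_def)
  qed
  have "measure M {\<omega>\<in>space M. w (X \<omega>) = y} = measure M' {\<omega>\<in>space M'. w (Y \<omega>) = y}"
  proof (rule pgf_unique[of M M' "\<lambda>\<omega>. w (X \<omega>)" "\<lambda>\<omega>. w (Y \<omega>)" K])
    show "(\<integral>\<omega>. x ^ w (X \<omega>) \<partial>M) = (\<integral>\<omega>. x ^ w (Y \<omega>) \<partial>M')" if "x > 0" for x :: real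
      unfolding w_def by (rule mcount_closed_eq[OF C that])
    show "w (X \<omega>) \<le> K" if "\<omega> \<in> space M" for \<omega> by (rule wK[OF Xn[OF that]])
    show "w (Y \<omega>) \<le> K" if "\<omega> \<in> space M'" for \<omega> by (rule wK[OF Yn[OF that]])
  qed (fact M.prob_space_axioms M'.prob_space_axioms measurable_compose[OF X wm] measurable_compose[OF Y wm])+
  also have "{\<omega>\<in>space M. w (X \<omega>) = y} = {\<omega>\<in>space M. \<forall>j<r. mcount (C j) (X \<omega>) = k j}" using iff Xn by blast
  also have "{\<omega>\<in>space M'. w (Y \<omega>) = y} = {\<omega>\<in>space M'. \<forall>j<r. mcount (C j) (Y \<omega>) = k j}" using iff Yn by blast
  finally show ?thesis .
qed

text \<open>Joint count events over finitely many closed sets form a generator. It is stable under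
  intersection because two finite families can be concatenated, and the empty family gives the whole
  space.\<close>

lemma distr_eq: "distr M multiset_borel X = distr M' multiset_borel Y"
proof -
  define E where "E = {{Z. \<forall>j<r. mcount (C j) Z = k j} | r C k. \<forall>j<(r::nat). closed (C j :: complex set)}"
  have Int: "Int_stable E"
  proof (rule Int_stableI)
    fix a b assume "a \<in> E" "b \<in> E"
    then obtain r C k r' C' k' where a: "a = {Z. \<forall>j<r. mcount (C j) Z = k j}" "\<forall>j<(r::nat). closed (C j :: complex set)"
      and b: "b = {Z. \<forall>j<r'. mcount (C' j) Z = k' j}" "\<forall>j<(r'::nat). closed (C' j :: complex set)"
      unfolding E_def by blast
    define D where "D j = (if j < r then C j else C' (j - r))" for j
    define l where "l j = (if j < r then k j else k' (j - r))" for j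
    have "a \<inter> b = {Z. \<forall>j<r + r'. mcount (D j) Z = l j}"
    proof (rule equalityI; rule subsetI)
      fix Z assume "Z \<in> a \<inter> b"
      then show "Z \<in> {Z. \<forall>j<r + r'. mcount (D j) Z = l j}" by (auto simp: a b D_def l_def)
    next
      fix Z assume "Z \<in> {Z. \<forall>j<r + r'. mcount (D j) Z = l j}"
      then have Z: "j < r + r' \<Longrightarrow> mcount (D j) Z = l j" for j by simp
      have "mcount (C j) Z = k j" if "j < r" for j using Z[of j] that by (simp add: D_def l_def)
      moreover have "mcount (C' j) Z = k' j" if "j < r'" for j using Z[of "r + j"] that by (simp add: D_def l_def)
      ultimately show "Z \<in> a \<inter> b" by (simp add: a b)
    qed
    moreover have "\<forall>j<r + r'. closed (D j)" using a(2) b(2) by (auto simp: D_def)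
    ultimately show "a \<inter> b \<in> E" unfolding E_def by blast
  qed
  have E_sets: "E \<subseteq> sets multiset_borel"
  proof
    fix a assume "a \<in> E"
    then obtain r C k where a: "a = {Z. \<forall>j<r. mcount (C j) Z = k j}" "\<forall>j<(r::nat). closed (C j :: complex set)"
      unfolding E_def by blast
    have "a = (\<Inter>j\<in>{..<r}. {Z. mcount (C j) Z = k j}) \<inter> space multiset_borel" by (auto simp: a)
    also have "\<dots> \<in> sets multiset_borel"
    proof (cases "r = 0")
      case False
      then show ?thesis
        using a(2) by (intro sets.Int sets.finite_INT sets.top mcount_vimage_sets) auto
    qed (use sets.top[of multiset_borel] in simp)
    finally show "a \<in> sets multiset_borel" .
  qed
  have gen: "sets multiset_borel = sigma_sets UNIV E"
  proof
    show "sigma_sets UNIV E \<subseteq> sets multiset_borel"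
      using sets.sigma_sets_subset[OF E_sets] by simp
    \<comment> \<open>That counts in closed sets generate the whole sigma-algebra is obtained as
      measurability of the identity map.\<close>
    have id: "(\<lambda>Z. Z) \<in> sigma UNIV E \<rightarrow>\<^sub>M multiset_borel"
    proof (rule measurable_multiset_borelI)
      fix C :: "complex set" assume C: "closed C"
      have "{Z. mcount C Z = k} \<in> sets (sigma UNIV E)" for k
      proof -
        have "{Z. mcount C Z = k} \<in> E"
          unfolding E_def using C by (auto intro!: exI[of _ "1::nat"] exI[of _ "\<lambda>_. C"] exI[of _ "\<lambda>_. k"])
        then show ?thesis by auto
      qed
      then have "mcount C \<in> sigma UNIV E \<rightarrow>\<^sub>M count_space UNIV"
        unfolding measurable_count_space_eq2_countable by (auto simp: vimage_def space_measure_of_conv)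
      then show "(\<lambda>Z. real (mcount C Z)) \<in> borel_measurable (sigma UNIV E)"
        by (rule measurable_compose) simp
    qed
    show "sets multiset_borel \<subseteq> sigma_sets UNIV E"
    proof
      fix a assume "a \<in> sets multiset_borel"
      from measurable_sets[OF id this] show "a \<in> sigma_sets UNIV E" by (simp add: space_measure_of_conv)
    qed
  qed
  show ?thesis
  proof (rule measure_eqI_generator_eq[OF Int, where \<Omega> = UNIV and A = "\<lambda>_. UNIV"])
    show "E \<subseteq> Pow UNIV" by simp
    show "sets (distr M multiset_borel X) = sigma_sets UNIV E" "sets (distr M' multiset_borel Y) = sigma_sets UNIV E"
      using gen by simp_all
    have "UNIV \<in> E" unfolding E_def by (auto intro!: exI[of _ "0::nat"])
    then show "range (\<lambda>_. UNIV) \<subseteq> E" by auto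
    show "emeasure (distr M multiset_borel X) UNIV \<noteq> \<infinity>" for i :: nat
      using X sets.top[of multiset_borel] by (simp add: emeasure_distr M.emeasure_space_1)
    fix a assume aE: "a \<in> E"
    then obtain r C k where a: "a = {Z. \<forall>j<r. mcount (C j) Z = k j}" "\<forall>j<(r::nat). closed (C j :: complex set)"
      unfolding E_def by blast
    have "a \<in> sets multiset_borel" using aE E_sets by blast
    then have "emeasure (distr M multiset_borel X) a = measure M (X -` a \<inter> space M)" "emeasure (distr M' multiset_borel Y) a = measure M' (Y -` a \<inter> space M')"
      using X Y by (simp_all add: emeasure_distr M.emeasure_eq_measure M'.emeasure_eq_measure)
    moreover have "X -` a \<inter> space M = {\<omega>\<in>space M. \<forall>j<r. mcount (C j) (X \<omega>) = k j}"
      "Y -` a \<inter> space M' = {\<omega>\<in>space M'. \<forall>j<r. mcount (C j) (Y \<omega>) = k j}" by (auto simp: a)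
    ultimately show "emeasure (distr M multiset_borel X) a = emeasure (distr M' multiset_borel Y) a"
      using joint_count_eq[of r C k] a(2) by simp
  qed auto
qed

end

subsection \<open>Toeplitz determinants of dilated symbols\<close>

text \<open>An arbitrary finite index set allows residue classes to serve as blocks without
  reordering rows and columns.\<close>

definition leibniz_det :: "'a set \<Rightarrow> ('a \<Rightarrow> 'a \<Rightarrow> complex) \<Rightarrow> complex" where
  "leibniz_det S A = (\<Sum>\<pi> | \<pi> permutes S. of_int (sign \<pi>) * (\<Prod>i\<in>S. A i (\<pi> i)))"

lemma leibniz_det_reindex:
  assumes S: "finite S" and f: "inj_on f S"
  shows "leibniz_det (f ` S) A = leibniz_det S (\<lambda>i j. A (f i) (f j))"
proof -
  have "map_permutation S f = (\<lambda>\<pi> x. if x \<in> f ` S then f (\<pi> (inv_into S f x)) else x)"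
    by (intro ext) (simp add: map_permutation_def restrict_id_def)
  then have bij: "bij_betw (map_permutation S f) {\<pi>. \<pi> permutes S} {\<pi>. \<pi> permutes f ` S}"
    using bij_betw_permutations[OF inj_on_imp_bij_betw[OF f]] by simp
  have "leibniz_det (f ` S) A = (\<Sum>\<pi> | \<pi> permutes S. of_int (sign (map_permutation S f \<pi>)) * (\<Prod>i\<in>f ` S. A i (map_permutation S f \<pi> i)))"
    unfolding leibniz_det_def by (rule sum.reindex_bij_betw[OF bij, symmetric])
  also have "\<dots> = leibniz_det S (\<lambda>i j. A (f i) (f j))"
    unfolding leibniz_det_def
  proof (rule sum.cong[OF refl])
    fix \<pi> assume "\<pi> \<in> {\<pi>. \<pi> permutes S}"
    then have \<pi>: "\<pi> permutes S" by simp
    have "(\<Prod>i\<in>f ` S. A i (map_permutation S f \<pi> i)) = (\<Prod>i\<in>S. A (f i) (f (\<pi> i)))"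
      unfolding prod.reindex[OF f] o_def
      by (intro prod.cong refl) (simp add: map_permutation_def restrict_id_def inv_into_f_f[OF f])
    then show "of_int (sign (map_permutation S f \<pi>)) * (\<Prod>i\<in>f ` S. A i (map_permutation S f \<pi> i))
        = of_int (sign \<pi>) * (\<Prod>i\<in>S. A (f i) (f (\<pi> i)))"
      using sign_map_permutation[OF f \<pi> S] by simp
  qed
  finally show ?thesis .
qed

text \<open>A permutation that sends some element of \<open>S\<close> into \<open>T\<close>
  contributes 0. Every other one preserves \<open>S\<close>, by finiteness maps it onto itself,
  hence preserves \<open>T\<close> too, and splits uniquely into a permutation of each.\<close>

lemma leibniz_det_block:
  assumes fin: "finite S" "finite T" and disj: "S \<inter> T = {}"
    and zero: "\<And>i j. i \<in> S \<Longrightarrow> j \<in> T \<Longrightarrow> A i j = 0"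
  shows "leibniz_det (S \<union> T) A = leibniz_det S A * leibniz_det T A"
proof -
  let ?P = "{\<pi>. \<pi> permutes S \<union> T}"
  let ?Q = "{\<pi>. \<pi> permutes S \<union> T \<and> \<pi> ` S \<subseteq> S}"
  let ?F = "\<lambda>\<pi>. of_int (sign \<pi>) * (\<Prod>i\<in>S \<union> T. A i (\<pi> i))"
  define r where "r \<pi> U x = (if x \<in> U then \<pi> x else x)" for \<pi> :: "'a \<Rightarrow> 'a" and U x
  have "leibniz_det (S \<union> T) A = (\<Sum>\<pi>\<in>?Q. ?F \<pi>)"
    unfolding leibniz_det_def
  proof (rule sum.mono_neutral_right)
    show "finite ?P" using fin by (intro finite_permutations) auto
    show "?Q \<subseteq> ?P" by auto
    show "\<forall>\<pi>\<in>?P - ?Q. ?F \<pi> = 0"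
    proof
      fix \<pi> assume "\<pi> \<in> ?P - ?Q"
      then obtain i where i: "i \<in> S" "\<pi> i \<notin> S" and \<pi>: "\<pi> permutes S \<union> T" by auto
      then have "\<pi> i \<in> T" using permutes_in_image[OF \<pi>, of i] by auto
      then have "A i (\<pi> i) = 0" using zero i by auto
      then have "(\<Prod>i\<in>S \<union> T. A i (\<pi> i)) = 0" using i(1) fin by (intro prod_zero) auto
      then show "?F \<pi> = 0" by simp
    qed
  qed
  also have "\<dots> = (\<Sum>(\<alpha>, \<beta>)\<in>{\<pi>. \<pi> permutes S} \<times> {\<pi>. \<pi> permutes T}.
      (of_int (sign \<alpha>) * (\<Prod>i\<in>S. A i (\<alpha> i))) * (of_int (sign \<beta>) * (\<Prod>i\<in>T. A i (\<beta> i))))"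
  proof (rule sum.reindex_bij_witness[of _ "\<lambda>(\<alpha>, \<beta>). \<alpha> \<circ> \<beta>" "\<lambda>\<pi>. (r \<pi> S, r \<pi> T)"])
    fix \<pi> assume "\<pi> \<in> ?Q"
    then have \<pi>: "\<pi> permutes S \<union> T" and sub: "\<pi> ` S \<subseteq> S" by auto
    have inj: "inj \<pi>" using permutes_inj[OF \<pi>] .
    have S: "\<pi> ` S = S" using endo_inj_surj[OF fin(1) sub inj_on_subset[OF inj subset_UNIV]] .
    have T: "\<pi> ` T = T"
    proof -
      have "\<pi> ` T = \<pi> ` (S \<union> T) - \<pi> ` S" using disj inj by (auto simp: inj_def)
      then show ?thesis using S permutes_image[OF \<pi>] disj by auto
    qed
    have rS: "r \<pi> S permutes S"
      by (rule bij_imp_permutes) (use S inj in \<open>auto simp: r_def bij_betw_def inj_on_def inj_def image_def\<close>)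
    have rT: "r \<pi> T permutes T"
      by (rule bij_imp_permutes) (use T inj in \<open>auto simp: r_def bij_betw_def inj_on_def inj_def image_def\<close>)
    have outside: "\<pi> x = x" if "x \<notin> S \<union> T" for x using permutes_not_in[OF \<pi> that] .
    have comp: "r \<pi> S \<circ> r \<pi> T = \<pi>"
    proof
      fix x
      show "(r \<pi> S \<circ> r \<pi> T) x = \<pi> x"
      proof (cases "x \<in> T")
        case True
        then have "\<pi> x \<in> T" using T by blast
        then have "\<pi> x \<notin> S" using disj by blast
        then show ?thesis using True by (simp add: r_def)
      next
        case False
        then show ?thesis using outside[of x] by (auto simp: r_def)
      qed
    qed
    show "(case (r \<pi> S, r \<pi> T) of (\<alpha>, \<beta>) \<Rightarrow> \<alpha> \<circ> \<beta>) = \<pi>" using comp by simp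
    show "(r \<pi> S, r \<pi> T) \<in> {\<pi>. \<pi> permutes S} \<times> {\<pi>. \<pi> permutes T}" using rS rT by simp
    have "sign \<pi> = sign (r \<pi> S) * sign (r \<pi> T)"
      using sign_compose[of "r \<pi> S" "r \<pi> T"] rS rT fin permutes_imp_permutation unfolding comp by blast
    moreover have "(\<Prod>i\<in>S \<union> T. A i (\<pi> i)) = (\<Prod>i\<in>S. A i (r \<pi> S i)) * (\<Prod>i\<in>T. A i (r \<pi> T i))"
      using fin disj by (subst prod.union_disjoint) (auto simp: r_def)
    ultimately show "(case (r \<pi> S, r \<pi> T) of (\<alpha>, \<beta>) \<Rightarrow>
        (of_int (sign \<alpha>) * (\<Prod>i\<in>S. A i (\<alpha> i))) * (of_int (sign \<beta>) * (\<Prod>i\<in>T. A i (\<beta> i)))) = ?F \<pi>"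
      by (simp add: mult_ac)
  next
    fix x assume "x \<in> {\<pi>. \<pi> permutes S} \<times> {\<pi>. \<pi> permutes T}"
    then obtain \<alpha> \<beta> where x: "x = (\<alpha>, \<beta>)" and \<alpha>: "\<alpha> permutes S" and \<beta>: "\<beta> permutes T" by auto
    have \<beta>S: "\<beta> i = i" if "i \<in> S" for i using permutes_not_in[OF \<beta>, of i] that disj by auto
    have \<alpha>T: "\<alpha> (\<beta> i) = \<beta> i" if "i \<in> T" for i
      using permutes_not_in[OF \<alpha>, of "\<beta> i"] permutes_in_image[OF \<beta>, of i] that disj by auto
    have "r (\<alpha> \<circ> \<beta>) S = \<alpha>" "r (\<alpha> \<circ> \<beta>) T = \<beta>"
      using permutes_not_in[OF \<alpha>] permutes_not_in[OF \<beta>] by (auto simp: r_def \<beta>S \<alpha>T fun_eq_iff)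
    then show "(\<lambda>\<pi>. (r \<pi> S, r \<pi> T)) (case x of (\<alpha>, \<beta>) \<Rightarrow> \<alpha> \<circ> \<beta>) = x" by (simp add: x)
    have "\<alpha> \<circ> \<beta> permutes S \<union> T"
      by (rule permutes_compose[OF permutes_subset[OF \<beta>] permutes_subset[OF \<alpha>]]) auto
    moreover have "(\<alpha> \<circ> \<beta>) ` S \<subseteq> S" using permutes_in_image[OF \<alpha>] by (auto simp: \<beta>S)
    ultimately show "(case x of (\<alpha>, \<beta>) \<Rightarrow> \<alpha> \<circ> \<beta>) \<in> ?Q" by (simp add: x)
  qed
  also have "\<dots> = leibniz_det S A * leibniz_det T A"
    unfolding leibniz_det_def sum_product sum.cartesian_product ..
  finally show ?thesis .
qed

text \<open>The ceiling counts the \<open>l\<close> for which \<open>q + p * l\<close> is still an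
  index below \<open>n\<close>, that is, the members of one residue class.\<close>

lemma less_block_dim_iff:
  assumes "p \<ge> 1"
  shows "l < block_dim n p q \<longleftrightarrow> q + p * l < n"
proof -
  have "l < block_dim n p q \<longleftrightarrow> int l < \<lceil>(real n - real q) / real p\<rceil>"
    unfolding block_dim_def by auto
  also have "\<dots> \<longleftrightarrow> real l < (real n - real q) / real p" by (simp add: less_ceiling_iff)
  also have "\<dots> \<longleftrightarrow> real l * real p < real n - real q" using assms by (simp add: pos_less_divide_eq)
  also have "\<dots> \<longleftrightarrow> real (q + p * l) < real n" by (simp add: algebra_simps)
  also have "\<dots> \<longleftrightarrow> q + p * l < n" by (rule of_nat_less_iff)
  finally show ?thesis .
qed

lemma residue_class_image:
  assumes p: "p \<ge> 1" and q: "q < p"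
  shows "{i. i < n \<and> i mod p = q} = (\<lambda>l. q + p * l) ` {..<block_dim n p q}"
proof (rule equalityI; rule subsetI)
  fix i assume "i \<in> {i. i < n \<and> i mod p = q}"
  then have i: "i < n" "i = q + p * (i div p)" using mult_div_mod_eq[of p i] by auto
  then have "i div p < block_dim n p q" using less_block_dim_iff[OF p, of "i div p" n q] by simp
  then show "i \<in> (\<lambda>l. q + p * l) ` {..<block_dim n p q}" using i(2) by blast
next
  fix i assume "i \<in> (\<lambda>l. q + p * l) ` {..<block_dim n p q}"
  then show "i \<in> {i. i < n \<and> i mod p = q}" using less_block_dim_iff[OF p] q by auto
qed

lemma toeplitz_det_dilate:
  assumes p: "p \<ge> 1"
  shows "toeplitz_det n (\<lambda>k. if int p dvd k then c (k div int p) else 0) = (\<Prod>q<p. toeplitz_det (block_dim n p q) c)"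
proof -
  define A where "A i j = (if int p dvd (int j - int i) then c ((int j - int i) div int p) else 0)" for i j :: nat
  define R where "R q = {i. i < n \<and> i mod p = q}" for q
  have block: "leibniz_det (R q) A = toeplitz_det (block_dim n p q) c" if q: "q < p" for q
  proof -
    have inj: "inj_on (\<lambda>l. q + p * l) {..<block_dim n p q}" using p by (auto simp: inj_on_def)
    \<comment> \<open>Inside a residue class, differences of indices are multiples of
      \<open>p\<close>, and the division by \<open>p\<close> undoes the dilation.\<close>
    have A: "A (q + p * i) (q + p * j) = c (int j - int i)" for i j
    proof -
      have "int (q + p * j) - int (q + p * i) = int p * (int j - int i)" by (simp add: algebra_simps)
      then show ?thesis using p by (simp add: A_def)
    qed
    show ?thesis
      unfolding R_def residue_class_image[OF p q] leibniz_det_reindex[OF finite_lessThan inj] A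
      by (simp add: leibniz_det_def toeplitz_det_def)
  qed
  have "leibniz_det {i. i < n \<and> i mod p < r} A = (\<Prod>q<r. leibniz_det (R q) A)" for r
  proof (induction r)
    case 0
    then show ?case by (simp add: leibniz_det_def)
  next
    case (Suc r)
    have "{i. i < n \<and> i mod p < Suc r} = {i. i < n \<and> i mod p < r} \<union> R r" by (auto simp: R_def)
    also have "leibniz_det \<dots> A = leibniz_det {i. i < n \<and> i mod p < r} A * leibniz_det (R r) A"
    proof (rule leibniz_det_block)
      fix i j assume "i \<in> {i. i < n \<and> i mod p < r}" "j \<in> R r"
      then have "j mod p \<noteq> i mod p" by (auto simp: R_def)
      then have "int j mod int p \<noteq> int i mod int p" by (simp add: zmod_int[symmetric])
      then have "\<not> int p dvd (int j - int i)" by (simp add: mod_eq_dvd_iff)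
      then show "A i j = 0" by (simp add: A_def)
    qed (auto simp: R_def)
    finally show ?case using Suc by simp
  qed
  from this[of p] have "leibniz_det {i. i < n \<and> i mod p < p} A = (\<Prod>q<p. leibniz_det (R q) A)" .
  moreover have "{i. i < n \<and> i mod p < p} = {..<n}" using p by auto
  ultimately have "leibniz_det {..<n} A = (\<Prod>q<p. toeplitz_det (block_dim n p q) c)" using block by simp
  then show ?thesis by (simp add: leibniz_det_def toeplitz_det_def A_def)
qed

text \<open>The residue classes modulo \<open>p\<close> partition the indices below
  \<open>n\<close>. This gives both multisets in the theorem the same size.\<close>

lemma sum_block_dim:
  assumes p: "p \<ge> 1"
  shows "(\<Sum>q<p. block_dim n p q) = n"
proof -
  have "n = card (\<Union>q\<in>{..<p}. {i. i < n \<and> i mod p = q})"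
  proof -
    have "(\<Union>q\<in>{..<p}. {i. i < n \<and> i mod p = q}) = {..<n}" using p by auto
    then show ?thesis by simp
  qed
  also have "\<dots> = (\<Sum>q<p. card {i. i < n \<and> i mod p = q})"
    by (rule card_UN_disjoint) auto
  also have "\<dots> = (\<Sum>q<p. block_dim n p q)"
  proof (rule sum.cong[OF refl])
    fix q assume "q \<in> {..<p}"
    then have "{i. i < n \<and> i mod p = q} = (\<lambda>l. q + p * l) ` {..<block_dim n p q}"
      using residue_class_image[OF p] by simp
    moreover have "inj_on (\<lambda>l. q + p * l) {..<block_dim n p q}" using p by (auto simp: inj_on_def)
    ultimately show "card {i. i < n \<and> i mod p = q} = block_dim n p q" by (simp add: card_image)
  qed
  finally show ?thesis by simp
qed

subsection \<open>Eigenvalues of powers\<close>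

lemma eig_circle: "A \<in> unitary_group n \<Longrightarrow> eig A \<in> circle_multisets n"
  using eigvals(1,2)[of A n] by (auto simp: circle_multisets_def)

text \<open>Such a linear statistic of the eigenvalues is a linear combination of traces of
  powers.\<close>

lemma sum_mset_laurent_measurable:
  "(\<lambda>A. \<Sum>x\<in>#eig A. laurent d c x) \<in> borel_measurable (unitary_borel n)"
proof -
  have "(\<lambda>A. \<Sum>k\<in>{- int d..int d}. c k * powi_trace n A k) \<in> borel_measurable (unitary_borel n)"
    by (intro borel_measurable_sum borel_measurable_times borel_measurable_const powi_trace_measurable)
  also have "?this \<longleftrightarrow> (\<lambda>A. \<Sum>x\<in>#eig A. laurent d c x) \<in> borel_measurable (unitary_borel n)"
  proof (rule measurable_cong)
    fix A assume "A \<in> space (unitary_borel n)"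
    then have A: "A \<in> unitary_group n" by (simp add: space_unitary_borel)
    have "(\<Sum>x\<in>#eig A. laurent d c x) = (\<Sum>i<n. laurent d c (eigvals n A i))"
      unfolding eigvals(2)[OF A] by (simp add: multiset.map_comp o_def sum_unfold_sum_mset)
    also have "\<dots> = (\<Sum>k\<in>{- int d..int d}. c k * powi_trace n A k)"
      unfolding eigvals(3)[OF A, symmetric] psum_def laurent_def sum_distrib_left by (rule sum.swap)
    finally show "(\<Sum>k\<in>{- int d..int d}. c k * powi_trace n A k) = (\<Sum>x\<in>#eig A. laurent d c x)" ..
  qed
  finally show ?thesis .
qed

text \<open>The number of eigenvalues in a closed set is a pointwise limit of linear statistics: the
  Laurent polynomials stay within \<open>1 / (m + 1)\<close> of bumps that converge to the
  indicator.\<close>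

lemma eig_measurable: "eig \<in> unitary_borel n \<rightarrow>\<^sub>M multiset_borel"
proof (rule measurable_multiset_borelI)
  fix C :: "complex set" assume C: "closed C"
  define approx where "approx m d c \<longleftrightarrow>
    (\<forall>z. norm z = 1 \<longrightarrow> norm (laurent d c z - of_real (bump C m z)) < inverse (real (Suc m)))" for m d c
  have "\<exists>d c. approx m d c" for m
  proof -
    have "inverse (real (Suc m)) > 0" by simp
    from laurent_approximation[OF continuous_on_bump[of "sphere 0 1" C m] this]
    obtain d c where "\<And>k. \<bar>k\<bar> > int d \<Longrightarrow> c k = 0"
      "\<And>z. norm z = 1 \<Longrightarrow> norm (laurent d c z - of_real (bump C m z)) < inverse (real (Suc m))"
      by blast
    then show ?thesis unfolding approx_def by blast
  qed
  then obtain d c where "\<And>m. approx m (d m) (c m)" by metis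
  then have dc: "\<And>m z. norm z = 1 \<Longrightarrow> norm (laurent (d m) (c m) z - of_real (bump C m z)) < inverse (real (Suc m))"
    unfolding approx_def by blast
  have lim: "(\<lambda>m. laurent (d m) (c m) z) \<longlonglongrightarrow> of_real (indicator C z)" if z: "norm z = 1" for z
  proof -
    have "(\<lambda>m. laurent (d m) (c m) z - of_real (bump C m z)) \<longlonglongrightarrow> 0"
      by (rule Lim_null_comparison[OF always_eventually[OF allI[OF less_imp_le[OF dc[OF z]]]] LIMSEQ_inverse_real_of_nat])
    from tendsto_add[OF this tendsto_of_real[OF bump_tendsto[OF C, of z]]] show ?thesis
      unfolding diff_add_cancel add_0 .
  qed
  have "(\<lambda>A. complex_of_real (real (mcount C (eig A)))) \<in> borel_measurable (unitary_borel n)"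
  proof (rule borel_measurable_LIMSEQ_metric)
    show "(\<lambda>A. \<Sum>x\<in>#eig A. laurent (d m) (c m) x) \<in> borel_measurable (unitary_borel n)" for m
      by (rule sum_mset_laurent_measurable)
    fix A assume "A \<in> space (unitary_borel n)"
    then have eig1: "\<forall>x\<in>#eig A. norm x = 1" using eig_circle[of A n] by (simp add: space_unitary_borel circle_multisets_def)
    have lims: "(\<forall>x\<in>#Z. norm x = 1) \<Longrightarrow> (\<lambda>m. \<Sum>x\<in>#Z. laurent (d m) (c m) x) \<longlonglongrightarrow> complex_of_real (real (mcount C Z))" for Z
    proof (induction Z)
      case (add x Z)
      then have x: "norm x = 1" and Z: "\<forall>x\<in>#Z. norm x = 1" by simp_all
      show ?case
        using tendsto_add[OF lim[OF x] add.IH[OF Z]] by (cases "x \<in> C") simp_all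
    qed simp
    show "(\<lambda>m. \<Sum>x\<in>#eig A. laurent (d m) (c m) x) \<longlonglongrightarrow> complex_of_real (real (mcount C (eig A)))"
      by (rule lims[OF eig1])
  qed
  from measurable_compose[OF this borel_measurable_Re]
  show "(\<lambda>A. real (mcount C (eig A))) \<in> borel_measurable (unitary_borel n)" unfolding Re_complex_of_real .
qed

lemma mcount_image_mset: "mcount B (image_mset f X) = mcount (f -` B) X"
  by (induction X) auto

lemma image_mset_measurable:
  assumes "continuous_on UNIV f"
  shows "image_mset f \<in> multiset_borel \<rightarrow>\<^sub>M multiset_borel"
proof (rule measurable_multiset_borelI)
  fix C :: "complex set" assume "closed C"
  then have "closed (f -` C)" using assms by (rule closed_vimage)
  then have "mcount (f -` C) \<in> multiset_borel \<rightarrow>\<^sub>M count_space UNIV" by (intro mcount_measurable) auto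
  then show "(\<lambda>X. real (mcount C (image_mset f X))) \<in> borel_measurable multiset_borel"
    unfolding mcount_image_mset by (rule measurable_compose) simp
qed

lemma sum_multiset_measurable:
  assumes "\<And>i. i \<in> I \<Longrightarrow> X i \<in> M \<rightarrow>\<^sub>M multiset_borel" "finite I"
  shows "(\<lambda>\<omega>. \<Sum>i\<in>I. X i \<omega>) \<in> M \<rightarrow>\<^sub>M multiset_borel"
proof (rule measurable_multiset_borelI)
  fix C :: "complex set" assume C: "closed C"
  have "mcount C (\<Sum>i\<in>I. X i \<omega>) = (\<Sum>i\<in>I. mcount C (X i \<omega>))" for \<omega>
    using assms(2) by (induction I rule: finite_induct) auto
  moreover have "(\<lambda>\<omega>. real (mcount C (X i \<omega>))) \<in> borel_measurable M" if "i \<in> I" for i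
    by (rule measurable_compose[OF measurable_compose[OF assms(1)[OF that] mcount_measurable]]) (use C in auto)
  ultimately show "(\<lambda>\<omega>. real (mcount C (\<Sum>i\<in>I. X i \<omega>))) \<in> borel_measurable M"
    by (simp add: borel_measurable_sum)
qed

lemma laurent_pow:
  assumes p: "p \<ge> 1"
  shows "laurent d c (x ^ p) = laurent (p * d) (\<lambda>k. if int p dvd k then c (k div int p) else 0) x"
proof -
  have "laurent (p * d) (\<lambda>k. if int p dvd k then c (k div int p) else 0) x
      = (\<Sum>k\<in>(\<lambda>k. int p * k) ` {- int d..int d}. (if int p dvd k then c (k div int p) else 0) * x powi k)"
    unfolding laurent_def
  proof (rule sum.mono_neutral_right)
    show "(\<lambda>k. int p * k) ` {- int d..int d} \<subseteq> {- int (p * d)..int (p * d)}"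
    proof
      fix l assume "l \<in> (\<lambda>k. int p * k) ` {- int d..int d}"
      then obtain k where k: "- int d \<le> k" "k \<le> int d" "l = int p * k" by auto
      then have "int p * - int d \<le> l" "l \<le> int p * int d" by (simp_all only: mult_left_mono of_nat_0_le_iff)
      then show "l \<in> {- int (p * d)..int (p * d)}" by simp
    qed
    show "\<forall>k\<in>{- int (p * d)..int (p * d)} - (\<lambda>k. int p * k) ` {- int d..int d}.
        (if int p dvd k then c (k div int p) else 0) * x powi k = 0"
    proof
      fix k assume k: "k \<in> {- int (p * d)..int (p * d)} - (\<lambda>k. int p * k) ` {- int d..int d}"
      have "\<not> int p dvd k"
      proof
        assume "int p dvd k"
        then obtain l where l: "k = int p * l" by (rule dvdE)
        have "int p * l \<le> int p * int d" "int p * (- int d) \<le> int p * l" using k l by auto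
        then have "l \<le> int d" "- int d \<le> l" using p by (simp_all only: mult_le_cancel_left_pos of_nat_0_less_iff)
        then show False using k l by auto
      qed
      then show "(if int p dvd k then c (k div int p) else 0) * x powi k = 0" by simp
    qed
  qed simp
  also have "\<dots> = (\<Sum>k\<in>{- int d..int d}. c k * (x ^ p) powi k)"
    using p by (subst sum.reindex) (auto simp: inj_on_def power_int_mult intro!: sum.cong)
  finally show ?thesis by (simp add: laurent_def)
qed

lemma expectation_prod_eig:
  assumes U: "uniform_unitary M m U" and c: "\<And>k. \<bar>k\<bar> > int d \<Longrightarrow> c k = 0"
  shows "(\<integral>\<omega>. (\<Prod>x\<in>#eig (U \<omega>). laurent d c x) \<partial>M) = toeplitz_det m c"
proof -
  have Um: "U \<in> M \<rightarrow>\<^sub>M unitary_borel m" and haar: "haar_unitary m (distr M (unitary_borel m) U)"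
    using U by (auto simp: uniform_unitary_def)
  have "(\<integral>\<omega>. (\<Prod>x\<in>#eig (U \<omega>). laurent d c x) \<partial>M) = (\<integral>A. (\<Prod>x\<in>#eig A. laurent d c x) \<partial>distr M (unitary_borel m) U)"
    by (rule integral_distr[OF Um measurable_compose[OF eig_measurable prod_mset_measurable[OF laurent_measurable]], symmetric])
  also have "\<dots> = toeplitz_det m c"
    unfolding laurent_def by (rule haar_heine[OF haar c])
  finally show ?thesis .
qed

theorem theorem1p3:
  fixes n p :: nat
    and M :: "'a measure" and U :: "'a \<Rightarrow> complex mat"
    and M' :: "'b measure" and V :: "nat \<Rightarrow> 'b \<Rightarrow> complex mat"
  assumes "n \<ge> 1" and "p \<ge> 1"
    and "prob_space M"
    and "uniform_unitary M n U"
    and "prob_space M'"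
    and "\<And>i. i < p \<Longrightarrow> uniform_unitary M' (block_dim n p i) (V i)"
    and "prob_space.indep_vars M' (\<lambda>i. unitary_borel (block_dim n p i)) V {..<p}"
  shows "eq_in_distr multiset_borel
           M (\<lambda>\<omega>. eig (U \<omega> ^\<^sub>m p))
           M' (\<lambda>\<omega>. \<Sum>i<p. eig (V i \<omega>))"
proof -
  interpret M: prob_space M by fact
  interpret M': prob_space M' by fact
  have Um: "U \<in> M \<rightarrow>\<^sub>M unitary_borel n" using assms(4) by (simp add: uniform_unitary_def)
  have Uu: "U \<omega> \<in> unitary_group n" if "\<omega> \<in> space M" for \<omega>
    using measurable_space[OF Um that] by (simp add: space_unitary_borel)
  have Vm: "V i \<in> M' \<rightarrow>\<^sub>M unitary_borel (block_dim n p i)" if "i < p" for i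
    using assms(6)[OF that] by (simp add: uniform_unitary_def)
  have Vu: "V i \<omega> \<in> unitary_group (block_dim n p i)" if "i < p" "\<omega> \<in> space M'" for i \<omega>
    using measurable_space[OF Vm[OF that(1)] that(2)] by (simp add: space_unitary_borel)
  let ?X = "\<lambda>\<omega>. eig (U \<omega> ^\<^sub>m p)" and ?Y = "\<lambda>\<omega>. \<Sum>i<p. eig (V i \<omega>)"
  have X_eq: "?X \<omega> = image_mset (\<lambda>x. x ^ p) (eig (U \<omega>))" if "\<omega> \<in> space M" for \<omega>
    by (rule eig_pow[OF Uu[OF that]])
  have "(\<lambda>\<omega>. image_mset (\<lambda>x. x ^ p) (eig (U \<omega>))) \<in> M \<rightarrow>\<^sub>M multiset_borel"
    by (rule measurable_compose[OF measurable_compose[OF Um eig_measurable] image_mset_measurable]) (intro continuous_intros)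
  then have X: "?X \<in> M \<rightarrow>\<^sub>M multiset_borel"
    using measurable_cong[of M ?X "\<lambda>\<omega>. image_mset (\<lambda>x. x ^ p) (eig (U \<omega>))" multiset_borel, OF X_eq] by blast
  have Y: "?Y \<in> M' \<rightarrow>\<^sub>M multiset_borel"
    by (rule sum_multiset_measurable) (use measurable_compose[OF Vm eig_measurable] in auto)
  interpret multiset_pair M M' ?X ?Y n
  proof unfold_locales
    show "?X \<in> M \<rightarrow>\<^sub>M multiset_borel" by (rule X)
    show "?Y \<in> M' \<rightarrow>\<^sub>M multiset_borel" by (rule Y)
    show "?X \<omega> \<in> circle_multisets n" if "\<omega> \<in> space M" for \<omega>
      using eig_circle[OF Uu[OF that]] unfolding X_eq[OF that] by (auto simp: circle_multisets_def norm_power)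
    show "?Y \<omega> \<in> circle_multisets n" if "\<omega> \<in> space M'" for \<omega>
    proof -
      have V: "eig (V i \<omega>) \<in> circle_multisets (block_dim n p i)" if "i < p" for i
        by (rule eig_circle[OF Vu[OF that \<open>\<omega> \<in> space M'\<close>]])
      have "size (?Y \<omega>) = (\<Sum>i<p. size (eig (V i \<omega>)))" by (simp add: size_multiset_sum)
      also have "\<dots> = n" using V sum_block_dim[OF assms(2), of n] by (simp add: circle_multisets_def)
      finally have "size (?Y \<omega>) = n" .
      moreover have "norm x = 1" if "x \<in># ?Y \<omega>" for x
      proof -
        have "\<exists>i<p. x \<in># eig (V i \<omega>)"
          using \<open>x \<in># ?Y \<omega>\<close> unfolding set_mset_sum[OF finite_lessThan] by blast
        then obtain i where "i < p" "x \<in># eig (V i \<omega>)" by blast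
        then show ?thesis using V[of i] by (simp add: circle_multisets_def)
      qed
      ultimately show ?thesis by (simp add: circle_multisets_def)
    qed
    fix d and c :: "int \<Rightarrow> complex" assume c: "\<And>k. \<bar>k\<bar> > int d \<Longrightarrow> c k = 0"
    define c' where "c' k = (if int p dvd k then c (k div int p) else 0)" for k
    have c': "c' k = 0" if k: "\<bar>k\<bar> > int (p * d)" for k
    proof (cases "int p dvd k")
      case True
      then obtain l where l: "k = int p * l" by (rule dvdE)
      have "int p * int d < int p * \<bar>l\<bar>" using k by (simp add: l abs_mult)
      then have "int d < \<bar>l\<bar>" using assms(2) by (simp only: mult_less_cancel_left_pos of_nat_0_less_iff)
      then show ?thesis using assms(2) c[of l] by (simp add: c'_def l)
    qed (simp add: c'_def)
    have "(\<integral>\<omega>. (\<Prod>x\<in>#?X \<omega>. laurent d c x) \<partial>M) = (\<integral>\<omega>. (\<Prod>x\<in>#eig (U \<omega>). laurent (p * d) c' x) \<partial>M)"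
      by (rule Bochner_Integration.integral_cong[OF refl])
        (simp add: X_eq multiset.map_comp o_def laurent_pow[OF assms(2)] c'_def[abs_def])
    also have "\<dots> = toeplitz_det n c'" by (rule expectation_prod_eig[OF assms(4) c'])
    also have "\<dots> = (\<Prod>i<p. toeplitz_det (block_dim n p i) c)"
      unfolding c'_def[abs_def] by (rule toeplitz_det_dilate[OF assms(2)])
    also have "\<dots> = (\<Prod>i<p. \<integral>\<omega>. (\<Prod>x\<in>#eig (V i \<omega>). laurent d c x) \<partial>M')"
    proof (rule prod.cong[OF refl])
      fix i assume "i \<in> {..<p}"
      then have "uniform_unitary M' (block_dim n p i) (V i)" using assms(6) by simp
      from expectation_prod_eig[OF this c]
      show "toeplitz_det (block_dim n p i) c = (\<integral>\<omega>. (\<Prod>x\<in>#eig (V i \<omega>). laurent d c x) \<partial>M')" by simp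
    qed
    \<comment> \<open>Independence of the blocks merges the product of means into one mean. The
      factors are integrable because a fixed number of points on the circle keeps them
      bounded.\<close>
    also have "\<dots> = (\<integral>\<omega>. (\<Prod>i<p. \<Prod>x\<in>#eig (V i \<omega>). laurent d c x) \<partial>M')"
    proof (rule M'.indep_vars_lebesgue_integral[symmetric, OF finite_lessThan])
      have meas: "(\<lambda>A. \<Prod>x\<in>#eig A. laurent d c x) \<in> borel_measurable (unitary_borel m)" for m
        by (rule measurable_compose[OF eig_measurable prod_mset_measurable[OF laurent_measurable]])
      show "M'.indep_vars (\<lambda>_. borel) (\<lambda>i \<omega>. \<Prod>x\<in>#eig (V i \<omega>). laurent d c x) {..<p}"
        using M'.indep_vars_compose2[OF assms(7), of "\<lambda>i A. \<Prod>x\<in>#eig A. laurent d c x" "\<lambda>_. borel"] meas by simp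
      fix i assume "i \<in> {..<p}"
      then have i: "i < p" by simp
      have bd: "norm (laurent d c x) \<le> (\<Sum>k\<in>{- int d..int d}. norm (c k))" if "norm x = 1" for x
        unfolding laurent_def using that
        by (intro sum_norm_le) (simp add: norm_mult norm_power_int)
      show "integrable M' (\<lambda>\<omega>. \<Prod>x\<in>#eig (V i \<omega>). laurent d c x)"
      proof (rule M'.integrable_const_bound)
        show "AE \<omega> in M'. norm (\<Prod>x\<in>#eig (V i \<omega>). laurent d c x) \<le> (\<Sum>k\<in>{- int d..int d}. norm (c k)) ^ block_dim n p i"
          by (intro AE_I2 norm_prod_mset_le[OF eig_circle[OF Vu[OF i]] bd])
        show "(\<lambda>\<omega>. \<Prod>x\<in>#eig (V i \<omega>). laurent d c x) \<in> borel_measurable M'"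
          by (rule measurable_compose[OF Vm[OF i] meas])
      qed
    qed
    also have "\<dots> = (\<integral>\<omega>. (\<Prod>x\<in>#?Y \<omega>. laurent d c x) \<partial>M')"
    proof (rule Bochner_Integration.integral_cong[OF refl])
      fix \<omega>
      have "(\<Prod>x\<in>#(\<Sum>i\<in>I. eig (V i \<omega>)). laurent d c x) = (\<Prod>i\<in>I. \<Prod>x\<in>#eig (V i \<omega>). laurent d c x)" if "finite I" for I
        using that by (induction I rule: finite_induct) auto
      then show "(\<Prod>i<p. \<Prod>x\<in>#eig (V i \<omega>). laurent d c x) = (\<Prod>x\<in>#?Y \<omega>. laurent d c x)" by simp
    qed
    finally show "(\<integral>\<omega>. (\<Prod>x\<in>#?X \<omega>. laurent d c x) \<partial>M) = (\<integral>\<omega>. (\<Prod>x\<in>#?Y \<omega>. laurent d c x) \<partial>M')" .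
  qed
  show ?thesis unfolding eq_in_distr_def using X Y distr_eq by blast
qed

end
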